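(* Let $H\in(0,1)$ and let $h$ be a positive function slowly varying at $+\infty$ such that $\mathbf{Var}(S_n)=h^2(n)n^{2H}$ for all $n\ge 1$, and suppose that $\mathbf{E}|\xi_1|^\alpha<\infty$ for some $\alpha$ with $\alpha\ge 2$ and $\alpha H>1$. Then: 1) if $M\in\mathcal{R}_\nu$ with $\nu>0$, then the processes $r_n(t)$, $t\in[0,1]$, $C$-converge in $D[0,1]$ to $Z_{\nu,H}(t)$ as $n\to\infty$; 2) if $M\in\mathcal{R}_0$, then the processes $r_n(t)$, $t\in[0,1]$, $C$-converge in $D[0,1]$ to $\left(1-\frac{M(0)}{M(+\infty)}\right)B_H(t)$ as $n\to\infty$.
   Context: Setting. $\{\xi_k;\,k\in\mathbb{Z}\}$ are i.i.d. real random variables with mean zero and variance one; $\{a_k;\,k\in\mathbb{Z}\}$ is a nonrandom square summable sequence of real numbers; $X_j=\sum_{k=-\infty}^{\infty}a_{j-k}\xi_k$ for $j\in\mathbb{Z}$; $S_0=0$ and $S_n=\sum_{i=1}^nX_i$ for $n\ge1$. A function $g$ is slowly varying at $+\infty$ if $g(cx)/g(x)\to1$ as $x\to+\infty$ for every $c>0$. For $\nu\ge0$, $\mathcal{R}_\nu$ is the class of non-constant functions $M$ on $[0,+\infty)$ of the form $M(t)=l(t)t^\nu$, where $l$ is non-negative, non-decreasing on $[0,+\infty)$ and slowly varying at $+\infty$ (with the convention $0^0=1$). $M(+\infty)=\lim_{t\to+\infty}M(t)\in(0,+\infty]$, and $M(0)/M(+\infty)=0$ if $M(+\infty)=+\infty$.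 Put $\Delta M(i)=M(i+1)-M(i)$, $v_0=0$, $v_k=\sum_{i=0}^{k-1}X_{k-i}\Delta M(i)$ for $k\ge1$, $R_n=\sum_{k=0}^nv_k$ for $n\ge0$, and $r_n(t)=\frac{R_{[nt]}}{h(n)n^HM(n)}$ for $t\in[0,1]$, where $[x]$ is the largest integer not exceeding $x$ ($r_n$ is considered for those $n\geq 1$ with $M(n)>0$, which holds for all large $n$). $B_H$ is fractional Brownian motion: the centered Gaussian process with continuous paths and covariance $\frac12(t^{2H}+s^{2H}-|t-s|^{2H})$. For $\nu>0$, $Z_{\nu,H}(t)=\nu\int_0^tB_H(t-s)s^{\nu-1}\,ds$. $C$-convergence in $D[0,1]$ of processes $Y_n$ to a process $Y$ with continuous paths means: for every functional $F:D[0,1]\to\mathbb{R}$ that is measurable with respect to the Borel $\sigma$-algebra of Skorokhod's topology and continuous in the uniform topology at every point of $C[0,1]$, $F(Y_n)$ converges in distribution to $F(Y)$. *)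

theory Defs
  imports "HOL-Probability.Probability"
begin

section \<open>Slow variation and the class of weights\<close>

definition slowly_varying :: "(real \<Rightarrow> real) \<Rightarrow> bool" where
  "slowly_varying g \<longleftrightarrow> (\<forall>c>0. ((\<lambda>x. g (c * x) / g x) \<longlongrightarrow> 1) at_top)"

text \<open>
  Functions on \<open>[0,\<infinity>)\<close> are total functions on the reals of which only the values at
  nonnegative arguments matter. The case distinction implements \<open>0\<^sup>0 = 1\<close>, since
  \<^term>\<open>0 powr 0 = (0::real)\<close> in the library.
\<close>

definition weight_class :: "real \<Rightarrow> (real \<Rightarrow> real) set" where
  "weight_class \<nu> = {M. \<not> M constant_on {0..} \<and>
     (\<exists>l. (\<forall>t\<ge>0. l t \<ge> 0) \<and> mono_on {0..} l \<and> slowly_varying l \<and>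
          (\<forall>t\<ge>0. M t = l t * (if \<nu> = 0 then 1 else t powr \<nu>)))}"

text \<open>
  The limit at infinity is taken in the extended reals, where division of a real number
  by \<open>\<infinity>\<close> gives 0.
\<close>

definition weight_ratio :: "(real \<Rightarrow> real) \<Rightarrow> real" where
  "weight_ratio M = real_of_ereal (ereal (M 0) / Lim at_top (\<lambda>t. ereal (M t)))"

section \<open>Linear processes\<close>

text \<open>
  Unconditional convergence in mean square of \<open>\<Sum>k\<in>I. f k\<close> to \<open>Y\<close>. The nonnegative
  integral is infinite for functions that are not square integrable, so that the
  condition cannot hold because of the Bochner integral being 0 for such functions.
\<close>

definition has_L2_sum ::
    "'a measure \<Rightarrow> ('i \<Rightarrow> 'a \<Rightarrow> real) \<Rightarrow> ('a \<Rightarrow> real) \<Rightarrow> 'i set \<Rightarrow> bool" where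
  "has_L2_sum P f Y I \<longleftrightarrow> Y \<in> borel_measurable P \<and>
     ((\<lambda>F. \<integral>\<^sup>+\<omega>. ennreal ((Y \<omega> - (\<Sum>k\<in>F. f k \<omega>))\<^sup>2) \<partial>P) \<longlongrightarrow> 0) (finite_subsets_at_top I)"

definition linear_process ::
    "'a measure \<Rightarrow> (int \<Rightarrow> real) \<Rightarrow> (int \<Rightarrow> 'a \<Rightarrow> real) \<Rightarrow> (int \<Rightarrow> 'a \<Rightarrow> real) \<Rightarrow> bool" where
  "linear_process P a \<xi> X \<longleftrightarrow> (\<forall>j. has_L2_sum P (\<lambda>k \<omega>. a (j - k) * \<xi> k \<omega>) (X j) UNIV)"

definition partial_sum :: "(int \<Rightarrow> 'a \<Rightarrow> real) \<Rightarrow> nat \<Rightarrow> 'a \<Rightarrow> real" where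
  "partial_sum X n \<omega> = (\<Sum>i=1..n. X (int i) \<omega>)"

definition weight_diff :: "(real \<Rightarrow> real) \<Rightarrow> nat \<Rightarrow> real" where
  "weight_diff M i = M (real i + 1) - M (real i)"

definition weighted_sum :: "(real \<Rightarrow> real) \<Rightarrow> (int \<Rightarrow> 'a \<Rightarrow> real) \<Rightarrow> nat \<Rightarrow> 'a \<Rightarrow> real" where
  "weighted_sum M X k \<omega> = (\<Sum>i<k. X (int k - int i) \<omega> * weight_diff M i)"

definition cumulative_sum :: "(real \<Rightarrow> real) \<Rightarrow> (int \<Rightarrow> 'a \<Rightarrow> real) \<Rightarrow> nat \<Rightarrow> 'a \<Rightarrow> real" where
  "cumulative_sum M X n \<omega> = (\<Sum>k\<le>n. weighted_sum M X k \<omega>)"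

text \<open>For the finitely many \<open>n\<close> with \<open>M n = 0\<close> the process below is constantly 0.\<close>

definition normalized_process ::
    "(real \<Rightarrow> real) \<Rightarrow> real \<Rightarrow> (real \<Rightarrow> real) \<Rightarrow> (int \<Rightarrow> 'a \<Rightarrow> real) \<Rightarrow> nat \<Rightarrow> real \<Rightarrow> 'a \<Rightarrow> real" where
  "normalized_process h H M X n t \<omega> =
     cumulative_sum M X (nat \<lfloor>real n * t\<rfloor>) \<omega> / (h (real n) * real n powr H * M (real n))"

section \<open>Fractional Brownian motion\<close>

text \<open>Degenerate normal laws (point masses) are included.\<close>

definition normal_law :: "real \<Rightarrow> real \<Rightarrow> real measure" where
  "normal_law m \<sigma> = (if \<sigma> = 0 then return borel m
                      else density lborel (\<lambda>x. ennreal (normal_density m \<sigma> x)))"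

definition gaussian_process :: "'b measure \<Rightarrow> 't set \<Rightarrow> ('t \<Rightarrow> 'b \<Rightarrow> real) \<Rightarrow> bool" where
  "gaussian_process N T Y \<longleftrightarrow> (\<forall>t\<in>T. Y t \<in> borel_measurable N) \<and>
     (\<forall>F c. finite F \<and> F \<subseteq> T \<longrightarrow>
       (\<exists>m \<sigma>. \<sigma> \<ge> 0 \<and> distr N borel (\<lambda>\<omega>. \<Sum>t\<in>F. c t * Y t \<omega>) = normal_law m \<sigma>))"

definition fractional_brownian_motion :: "'b measure \<Rightarrow> real \<Rightarrow> (real \<Rightarrow> 'b \<Rightarrow> real) \<Rightarrow> bool" where
  "fractional_brownian_motion N H B \<longleftrightarrow> prob_space N \<and> gaussian_process N {0..} B \<and>
     (\<forall>t\<ge>0. (\<integral>\<omega>. B t \<omega> \<partial>N) = 0) \<and>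
     (\<forall>s\<ge>0. \<forall>t\<ge>0. (\<integral>\<omega>. B s \<omega> * B t \<omega> \<partial>N)
        = (t powr (2 * H) + s powr (2 * H) - \<bar>t - s\<bar> powr (2 * H)) / 2) \<and>
     (\<forall>\<omega>\<in>space N. continuous_on {0..} (\<lambda>t. B t \<omega>))"

definition Z_process :: "real \<Rightarrow> (real \<Rightarrow> 'b \<Rightarrow> real) \<Rightarrow> real \<Rightarrow> 'b \<Rightarrow> real" where
  "Z_process \<nu> B t \<omega> = \<nu> * (LINT s:{0..t}|lborel. B (t - s) \<omega> * s powr (\<nu> - 1))"

section \<open>The space \<open>D[0,1]\<close> and C-convergence\<close>

definition D01 :: "(real \<Rightarrow> real) set" where
  "D01 = {x \<in> extensional {0..1}.
     (\<forall>t\<in>{0..<1}. (x \<longlongrightarrow> x t) (at_right t)) \<and>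
     (\<forall>t\<in>{0<..1}. \<exists>l. (x \<longlongrightarrow> l) (at_left t))}"

definition time_changes :: "(real \<Rightarrow> real) set" where
  "time_changes = {\<tau>. continuous_on {0..1} \<tau> \<and> strict_mono_on {0..1} \<tau> \<and> \<tau> 0 = 0 \<and> \<tau> 1 = 1}"

text \<open>
  Basic neighbourhoods of Skorokhod's \<open>J\<^sub>1\<close> topology: \<open>y\<close> is uniformly \<open>e\<close>-close to \<open>x\<close>
  up to a time change that is itself uniformly \<open>e\<close>-close to the identity.
\<close>

definition skorokhod_nbhd :: "(real \<Rightarrow> real) \<Rightarrow> real \<Rightarrow> (real \<Rightarrow> real) set" where
  "skorokhod_nbhd x e = {y \<in> D01. \<exists>\<tau>\<in>time_changes. \<forall>t\<in>{0..1}.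
     \<bar>\<tau> t - t\<bar> < e \<and> \<bar>y (\<tau> t) - x t\<bar> < e}"

definition skorokhod_topology :: "(real \<Rightarrow> real) topology" where
  "skorokhod_topology = topology (\<lambda>U. U \<subseteq> D01 \<and> (\<forall>x\<in>U. \<exists>e>0. skorokhod_nbhd x e \<subseteq> U))"

lemma skorokhod_nbhd_mono: "d \<le> e \<Longrightarrow> skorokhod_nbhd x d \<subseteq> skorokhod_nbhd x e"
  unfolding skorokhod_nbhd_def by (blast intro: less_le_trans)

lemma openin_skorokhod_topology:
  "openin skorokhod_topology U \<longleftrightarrow> U \<subseteq> D01 \<and> (\<forall>x\<in>U. \<exists>e>0. skorokhod_nbhd x e \<subseteq> U)"
proof -
  have "istopology (\<lambda>U. U \<subseteq> D01 \<and> (\<forall>x\<in>U. \<exists>e>0. skorokhod_nbhd x e \<subseteq> U))"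
    unfolding istopology_def
  proof (intro conjI allI impI)
    fix S T assume S: "S \<subseteq> D01 \<and> (\<forall>x\<in>S. \<exists>e>0. skorokhod_nbhd x e \<subseteq> S)"
      and T: "T \<subseteq> D01 \<and> (\<forall>x\<in>T. \<exists>e>0. skorokhod_nbhd x e \<subseteq> T)"
    show "S \<inter> T \<subseteq> D01" using S by blast
    show "\<forall>x\<in>S \<inter> T. \<exists>e>0. skorokhod_nbhd x e \<subseteq> S \<inter> T"
    proof
      fix x assume "x \<in> S \<inter> T"
      then obtain d e where "d > 0" "e > 0" "skorokhod_nbhd x d \<subseteq> S" "skorokhod_nbhd x e \<subseteq> T"
        using S T by blast
      moreover have "skorokhod_nbhd x (min d e) \<subseteq> skorokhod_nbhd x d"
        "skorokhod_nbhd x (min d e) \<subseteq> skorokhod_nbhd x e"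
        by (simp_all add: skorokhod_nbhd_mono)
      ultimately show "\<exists>e>0. skorokhod_nbhd x e \<subseteq> S \<inter> T"
        by (intro exI[of _ "min d e"]) auto
    qed
  next
    fix \<K> assume K: "\<forall>S\<in>\<K>. S \<subseteq> D01 \<and> (\<forall>x\<in>S. \<exists>e>0. skorokhod_nbhd x e \<subseteq> S)"
    show "\<Union>\<K> \<subseteq> D01" using K by blast
    show "\<forall>x\<in>\<Union>\<K>. \<exists>e>0. skorokhod_nbhd x e \<subseteq> \<Union>\<K>" using K by (meson Union_iff Union_upper subset_trans)
  qed
  then show ?thesis
    unfolding skorokhod_topology_def by (simp add: topology_inverse')
qed

lemma topspace_skorokhod_topology: "topspace skorokhod_topology = D01"
proof
  show "topspace skorokhod_topology \<subseteq> D01"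
    using openin_skorokhod_topology[of "topspace skorokhod_topology"] by simp
  have "openin skorokhod_topology D01"
    unfolding openin_skorokhod_topology
    by (auto simp: skorokhod_nbhd_def intro: exI[of _ 1])
  then show "D01 \<subseteq> topspace skorokhod_topology"
    by (rule openin_subset)
qed

definition skorokhod_borel :: "(real \<Rightarrow> real) measure" where
  "skorokhod_borel = sigma D01 {U. openin skorokhod_topology U}"

lemma space_skorokhod_borel: "space skorokhod_borel = D01"
  unfolding skorokhod_borel_def by (simp add: space_measure_of_conv)

definition unif_continuous_at_C01 :: "((real \<Rightarrow> real) \<Rightarrow> real) \<Rightarrow> bool" where
  "unif_continuous_at_C01 F \<longleftrightarrow>
     (\<forall>x\<in>D01. continuous_on {0..1} x \<longrightarrow>
       (\<forall>e>0. \<exists>d>0. \<forall>y\<in>D01. (\<forall>t\<in>{0..1}. \<bar>y t - x t\<bar> < d) \<longrightarrow> \<bar>F y - F x\<bar> < e))"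

definition path01 :: "(real \<Rightarrow> 'a \<Rightarrow> real) \<Rightarrow> 'a \<Rightarrow> real \<Rightarrow> real" where
  "path01 Y \<omega> = (\<lambda>t\<in>{0..1}. Y t \<omega>)"

text \<open>
  The processes \<open>Y n\<close> live on \<open>P\<close>, the limit \<open>Z\<close> possibly on another space \<open>N\<close>. The first
  three conditions say that all processes are random elements of \<open>D[0,1]\<close> and that \<open>Z\<close> has
  continuous paths.
\<close>

definition C_converges ::
    "'a measure \<Rightarrow> (nat \<Rightarrow> real \<Rightarrow> 'a \<Rightarrow> real) \<Rightarrow> 'b measure \<Rightarrow> (real \<Rightarrow> 'b \<Rightarrow> real) \<Rightarrow> bool" where
  "C_converges P Y N Z \<longleftrightarrow>
     (\<forall>n. path01 (Y n) \<in> measurable P skorokhod_borel) \<and>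
     path01 Z \<in> measurable N skorokhod_borel \<and>
     (\<forall>\<omega>\<in>space N. continuous_on {0..1} (\<lambda>t. Z t \<omega>)) \<and>
     (\<forall>F\<in>borel_measurable skorokhod_borel. unif_continuous_at_C01 F \<longrightarrow>
       weak_conv_m (\<lambda>n. distr P borel (\<lambda>\<omega>. F (path01 (Y n) \<omega>)))
                   (distr N borel (\<lambda>\<omega>. F (path01 Z \<omega>))))"

end

theory Submission
  imports Defs
begin

text \<open>
  Let \<open>s n = h n * n powr H\<close> be the standard deviation of \<open>S n\<close>. Summation by parts turns \<open>R k\<close>
  into the sum of \<open>weight_diff M i * S (k - i)\<close> over \<open>i < k\<close>, so the normalized process is the
  image of \<open>S \<lfloor>n * t\<rfloor> / s n\<close> under a linear averaging operator that contracts the uniform norm;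
  regular variation of \<open>M\<close> makes these operators converge to fractional integration
  (\<open>\<nu> > 0\<close>) or to multiplication by a constant (\<open>\<nu> = 0\<close>). It remains to prove the invariance
  principle for \<open>S\<close> itself. The finite-dimensional distributions follow from characteristic
  functions, since all coefficients of the innovations are negligible compared with \<open>s n\<close>.
  Tightness follows by dyadic chaining from a Rosenthal type bound for the moment of
  order \<open>\<alpha>\<close>, where \<open>\<alpha> * H > 1\<close>. As \<open>h\<close> is not assumed to be measurable, the uniform convergence
  theorem for slowly varying functions is not available; the subadditivity of \<open>s\<close> is used instead.
\<close>

section \<open>Regularly varying standard deviations\<close>

lemma power_at_top:
  fixes x :: real
  assumes "1 < x"
  shows "filterlim (\<lambda>n. x ^ n) at_top sequentially"
proof (subst filterlim_at_top, intro allI)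
  fix Z
  obtain n0 where "Z < x ^ n0" using real_arch_pow[OF assms] by blast
  moreover have "x ^ n0 \<le> x ^ n" if "n \<ge> n0" for n using that assms by (intro power_increasing) auto
  ultimately show "\<forall>\<^sub>F n in sequentially. Z \<le> x ^ n"
    by (intro eventually_sequentiallyI[of n0]) force
qed

lemma powr_pow2: "(2 ^ r) powr H = (2 powr H) ^ r" for H :: real
proof -
  have "(2 ^ r) powr H = (2 powr real r) powr H" by (simp add: powr_realpow)
  also have "\<dots> = (2 powr H) powr real r" by (simp add: powr_powr mult.commute)
  also have "\<dots> = (2 powr H) ^ r" by (simp add: powr_realpow)
  finally show ?thesis .
qed

lemma div_error:
  assumes "m \<ge> 1"
  shows "\<bar>real m * real (n * j div m) - real j * real n\<bar> \<le> real m"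
proof -
  have "real m * real (n * j div m) + real (n * j mod m) = real n * real j"
    using arg_cong[OF mult_div_mod_eq[of m "n * j"], of real] by (simp only: of_nat_add of_nat_mult)
  moreover have "real (n * j mod m) < real m" using assms by simp
  ultimately show ?thesis by (simp add: mult.commute[of "real j"])
qed

locale regular_sequence =
  fixes s :: "nat \<Rightarrow> real" and H :: real
  assumes H_pos: "0 < H"
    and s_0: "s 0 = 0"
    and s_pos: "n \<ge> 1 \<Longrightarrow> s n > 0"
    and s_diff: "\<bar>s (m + n) - s m\<bar> \<le> s n"
    and s_ratio: "p \<ge> 1 \<Longrightarrow> (\<lambda>m. s (p * m) / s m) \<longlonglongrightarrow> real p powr H"
begin

lemma s_nonneg: "s n \<ge> 0"
  using s_pos[of n] s_0 by (cases n) auto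

lemma s_add: "s (m + n) \<le> s m + s n"
  using s_diff[of m n] by linarith

lemma s_linear: "s n \<le> real n * s 1"
proof (induction n)
  case (Suc n)
  then show ?case using s_add[of n 1] by (simp add: algebra_simps)
qed (simp add: s_0)

lemma s_abs_diff: "\<bar>s m - s n\<bar> \<le> s (if m \<le> n then n - m else m - n)"
  using s_diff[of m "n - m"] s_diff[of n "m - n"] by (auto simp: abs_minus_commute)

lemma filterlim_pow2: "filterlim (\<lambda>k. (2::nat) ^ k) at_top sequentially"
  by (rule filterlim_subseq) (simp add: strict_mono_Suc_iff)

lemma pow2_ratio: "(\<lambda>k. s (2 ^ Suc k) / s (2 ^ k)) \<longlonglongrightarrow> 2 powr H"
  using filterlim_compose[OF s_ratio[of 2] filterlim_pow2] by simp

lemma pow2_ratio':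
  "(\<lambda>k. s (2 ^ (k + r)) / s (2 ^ k)) \<longlonglongrightarrow> (2 powr H) ^ r"
  using filterlim_compose[OF s_ratio[of "2 ^ r"] filterlim_pow2]
  by (simp add: power_add mult.commute powr_pow2)

lemma pow2_growth:
  assumes \<theta>: "2 powr (- H) < \<theta>" and \<theta>1: "\<theta> < 1"
  shows "\<exists>C\<ge>1. \<forall>q. \<forall>j\<le>q. s (2 ^ j) \<le> C * \<theta> ^ (q - j) * s (2 ^ q)"
proof -
  have \<theta>0: "\<theta> > 0" using \<theta> by (smt (verit) powr_gt_zero)
  have "1 / \<theta> < 2 powr H"
    using \<theta> \<theta>0 by (simp add: powr_minus field_simps)
  then have "eventually (\<lambda>k. s (2 ^ Suc k) / s (2 ^ k) > 1 / \<theta>) sequentially"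
    using order_tendstoD(1)[OF pow2_ratio] by blast
  then obtain k0 where k0: "s (2 ^ Suc k) / s (2 ^ k) > 1 / \<theta>" if "k \<ge> k0" for k
    by (auto simp: eventually_sequentially)
  have step: "s (2 ^ k) \<le> \<theta> * s (2 ^ Suc k)" if "k \<ge> k0" for k
    using k0[OF that] s_pos[of "2 ^ k"] \<theta>0 by (simp add: field_simps)
  define D where "D = Max ((\<lambda>k. s (2 ^ k) / (\<theta> * s (2 ^ Suc k))) ` {..k0})"
  have D: "s (2 ^ k) \<le> max 1 D * (\<theta> * s (2 ^ Suc k))" for k
  proof (cases "k \<le> k0")
    case True
    have "s (2 ^ k) / (\<theta> * s (2 ^ Suc k)) \<le> D"
      unfolding D_def using True by (intro Max_ge) auto
    then have "s (2 ^ k) / (\<theta> * s (2 ^ Suc k)) \<le> max 1 D" by simp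
    then show ?thesis using s_pos[of "2 ^ Suc k"] \<theta>0 by (simp add: divide_le_eq)
  next
    case False
    have "s (2 ^ k) \<le> 1 * (\<theta> * s (2 ^ Suc k))" using step[of k] False by simp
    also have "\<dots> \<le> max 1 D * (\<theta> * s (2 ^ Suc k))"
      using s_nonneg \<theta>0 by (intro mult_right_mono) auto
    finally show ?thesis .
  qed
  have *: "s (2 ^ (q - d)) \<le> max 1 D ^ (card {i. q - d \<le> i \<and> i < q \<and> i < k0}) * \<theta> ^ d * s (2 ^ q)"
    if "d \<le> q" for d q
    using that
  proof (induction d)
    case 0
    have "{i. q - 0 \<le> i \<and> i < q \<and> i < k0} = {}" by auto
    then show ?case by (simp only: card.empty) simp
  next
    case (Suc d)
    have eq: "Suc (q - Suc d) = q - d" using Suc.prems by simp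
    have set: "{i. q - Suc d \<le> i \<and> i < q \<and> i < k0} =
       (if q - Suc d < k0 then {q - Suc d} else {}) \<union> {i. q - d \<le> i \<and> i < q \<and> i < k0}"
      using Suc.prems by auto
    have IH: "s (2 ^ (q - d)) \<le> max 1 D ^ (card {i. q - d \<le> i \<and> i < q \<and> i < k0}) * \<theta> ^ d * s (2 ^ q)"
      using Suc by simp
    show ?case
    proof (cases "q - Suc d < k0")
      case True
      have c: "card {i. q - Suc d \<le> i \<and> i < q \<and> i < k0} = Suc (card {i. q - d \<le> i \<and> i < q \<and> i < k0})"
        using set True Suc.prems by (simp add: card_insert_if)
      have "s (2 ^ (q - Suc d)) \<le> max 1 D * (\<theta> * s (2 ^ (q - d)))"
        using D[of "q - Suc d"] eq by simp
      also have "\<dots> \<le> max 1 D * (\<theta> * (max 1 D ^ (card {i. q - d \<le> i \<and> i < q \<and> i < k0}) * \<theta> ^ d * s (2 ^ q)))"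
        using IH \<theta>0 by (intro mult_left_mono) auto
      finally show ?thesis by (simp add: c mult_ac)
    next
      case False
      have c: "card {i. q - Suc d \<le> i \<and> i < q \<and> i < k0} = card {i. q - d \<le> i \<and> i < q \<and> i < k0}"
        using set False by simp
      have "s (2 ^ (q - Suc d)) \<le> (\<theta> * s (2 ^ (q - d)))"
        using step[of "q - Suc d"] False eq by simp
      also have "\<dots> \<le> (\<theta> * (max 1 D ^ (card {i. q - d \<le> i \<and> i < q \<and> i < k0}) * \<theta> ^ d * s (2 ^ q)))"
        using IH \<theta>0 by (intro mult_left_mono) auto
      finally show ?thesis by (simp add: c mult_ac)
    qed
  qed
  show ?thesis
  proof (intro exI[of _ "max 1 D ^ k0"] conjI allI impI)
    show "1 \<le> max 1 D ^ k0" by simp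
    fix q j :: nat assume j: "j \<le> q"
    have "card {i. j \<le> i \<and> i < q \<and> i < k0} \<le> card {..<k0}" by (intro card_mono) auto
    then have "max 1 D ^ card {i. j \<le> i \<and> i < q \<and> i < k0} \<le> max 1 D ^ k0"
      by (intro power_increasing) auto
    then have "max 1 D ^ card {i. j \<le> i \<and> i < q \<and> i < k0} * (\<theta> ^ (q - j) * s (2 ^ q))
      \<le> max 1 D ^ k0 * (\<theta> ^ (q - j) * s (2 ^ q))"
      using \<theta>0 s_nonneg by (intro mult_right_mono) auto
    then show "s (2 ^ j) \<le> max 1 D ^ k0 * \<theta> ^ (q - j) * s (2 ^ q)"
      using *[of "q - j" q] j by (simp add: mult_ac)
  qed
qed

lemma s_below_pow2: "\<exists>C\<ge>0. \<forall>k. \<forall>r<2 ^ k. s r \<le> C * s (2 ^ k)"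
proof -
  have "2 powr (- H) < 1" using H_pos powr_less_one by auto
  then obtain \<theta> where \<theta>: "2 powr (- H) < \<theta>" "\<theta> < 1" using dense by blast
  obtain C where C: "C \<ge> 1" "\<And>q j. j \<le> q \<Longrightarrow> s (2 ^ j) \<le> C * \<theta> ^ (q - j) * s (2 ^ q)"
    using pow2_growth[OF \<theta>] by blast
  have \<theta>0: "\<theta> > 0" using \<theta> by (smt (verit) powr_gt_zero)
  have bits: "s r \<le> (\<Sum>j<k. s (2 ^ j))" if "r < 2 ^ k" for r k
    using that
  proof (induction k arbitrary: r)
    case 0
    then show ?case by (simp add: s_0)
  next
    case (Suc k)
    show ?case
    proof (cases "r < 2 ^ k")
      case True
      then show ?thesis using Suc.IH[of r] s_nonneg[of "2 ^ k"] by simp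
    next
      case False
      then have "s (r - 2 ^ k) \<le> (\<Sum>j<k. s (2 ^ j))" using Suc by simp
      then show ?thesis using s_add[of "r - 2 ^ k" "2 ^ k"] False by simp
    qed
  qed
  have "s r \<le> C * (1 / (1 - \<theta>)) * s (2 ^ k)" if "r < 2 ^ k" for r k
  proof -
    have "s r \<le> (\<Sum>j<k. s (2 ^ j))" by (rule bits[OF that])
    also have "\<dots> \<le> (\<Sum>j<k. C * s (2 ^ k) * \<theta> ^ (k - j))"
      using C(2)[of _ k] by (intro sum_mono) (auto simp: mult_ac)
    also have "\<dots> = C * s (2 ^ k) * (\<Sum>j<k. \<theta> ^ (k - j))" by (simp add: sum_distrib_left)
    finally have 1: "s r \<le> C * s (2 ^ k) * (\<Sum>j<k. \<theta> ^ (k - j))" .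
    have 2: "(\<Sum>j<k. \<theta> ^ (k - j)) = (\<Sum>j\<in>{1..k}. \<theta> ^ j)"
      by (rule sum.reindex_bij_witness[of _ "\<lambda>j. k - j" "\<lambda>j. k - j"]) auto
    have "(\<Sum>j\<in>{1..k}. \<theta> ^ j) \<le> (\<Sum>j<Suc k. \<theta> ^ j)" using \<theta>0 by (intro sum_mono2) auto
    also have "\<dots> \<le> 1 / (1 - \<theta>)"
      using \<theta> \<theta>0 by (subst sum_gp_strict) (auto simp: divide_right_mono)
    finally have "C * s (2 ^ k) * (\<Sum>j\<in>{1..k}. \<theta> ^ j) \<le> C * s (2 ^ k) * (1 / (1 - \<theta>))"
      using C s_nonneg by (intro mult_left_mono) auto
    then show ?thesis using 1 unfolding 2 by (simp add: mult.assoc mult.commute mult.left_commute)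
  qed
  then show ?thesis using C \<theta> by (intro exI[of _ "C * (1 / (1 - \<theta>))"]) auto
qed

text \<open>
  Writing \<open>n\<close> as a bounded multiple of \<open>2 ^ k\<close> plus a remainder below \<open>2 ^ k\<close>, the multiple
  dominates the remainder as soon as it is large compared with the constant in \<open>s_below_pow2\<close>.
\<close>

lemma s_lower_pow2:
  "\<exists>c>0. \<exists>p0. \<forall>p\<ge>p0. \<forall>n. 2 ^ p \<le> n \<and> n < 2 ^ Suc p \<longrightarrow> c * s (2 ^ p) \<le> s n"
proof -
  obtain C where C: "C \<ge> 0" "\<And>k r. r < 2 ^ k \<Longrightarrow> s r \<le> C * s (2 ^ k)"
    using s_below_pow2 by blast
  have "1 < 2 powr H" using H_pos by simp
  then obtain r where "2 * (C + 1) < (2 powr H) ^ r" using real_arch_pow by blast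
  then have r: "(2 powr H) ^ r \<ge> 2 * (C + 1)" by simp
  note rH = powr_pow2[of r H]
  have "eventually (\<lambda>k. s (q * 2 ^ k) / s (2 ^ k) > real q powr H / 2) sequentially"
    if "q \<ge> 1" for q
    using that order_tendstoD(1)[OF filterlim_compose[OF s_ratio[OF that] filterlim_pow2], of "real q powr H / 2"]
    by simp
  then have "eventually (\<lambda>k. \<forall>q\<in>{2 ^ r..<2 ^ Suc r}. s (q * 2 ^ k) / s (2 ^ k) > real q powr H / 2) sequentially"
    by (intro eventually_ball_finite) (auto intro: order_trans[OF one_le_power])
  then obtain k0 where k0: "\<And>k q. k \<ge> k0 \<Longrightarrow> q \<in> {2 ^ r..<2 ^ Suc r} \<Longrightarrow> s (q * 2 ^ k) / s (2 ^ k) > real q powr H / 2"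
    unfolding eventually_sequentially by blast
  have ev: "eventually (\<lambda>k. s (2 ^ (k + r)) / s (2 ^ k) < 2 * (2 powr H) ^ r) sequentially"
    using order_tendstoD(2)[OF pow2_ratio'[of r], of "2 * (2 powr H) ^ r"] by simp
  then obtain k1 where k1: "\<And>k. k \<ge> k1 \<Longrightarrow> s (2 ^ (k + r)) / s (2 ^ k) < 2 * (2 powr H) ^ r"
    by (auto simp: eventually_sequentially)
  define c where "c = 1 / (2 * (2 powr H) ^ r)"
  have c: "c > 0" by (simp add: c_def)
  show ?thesis
  proof (intro exI[of _ c] conjI c exI[of _ "k0 + k1 + r"] allI impI, elim conjE)
    fix p n :: nat assume p: "k0 + k1 + r \<le> p" and n: "2 ^ p \<le> n" "n < 2 ^ Suc p"
    define k where "k = p - r"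
    have k: "k \<ge> k0" "k \<ge> k1" "p = k + r" using p by (auto simp: k_def)
    define q where "q = n div 2 ^ k"
    have "q \<ge> 2 ^ r" using n(1) k(3) unfolding q_def
      by (simp add: less_eq_div_iff_mult_less_eq power_add mult.commute)
    moreover have "q < 2 ^ Suc r" using n(2) k(3) unfolding q_def
      by (simp add: div_less_iff_less_mult power_add mult_ac)
    ultimately have q: "q \<in> {2 ^ r..<2 ^ Suc r}" by simp
    have "s (q * 2 ^ k) > s (2 ^ k) * (real q powr H / 2)"
      using k0[OF k(1) q] s_pos[of "2 ^ k"] by (simp add: field_simps)
    moreover have "real q powr H / 2 \<ge> C + 1"
    proof -
      have "real (2 ^ r) \<le> real q" using q by (metis atLeastLessThan_iff of_nat_le_iff)
      then have "(2 ^ r) powr H \<le> real q powr H"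
        using H_pos by (intro powr_mono2) auto
      then show ?thesis using r rH by simp
    qed
    ultimately have 1: "s (q * 2 ^ k) \<ge> s (2 ^ k) * (C + 1)"
      by (smt (verit) mult_left_mono s_nonneg)
    have 2: "n = q * 2 ^ k + n mod 2 ^ k" unfolding q_def by (metis div_mult_mod_eq)
    have "\<bar>s n - s (q * 2 ^ k)\<bar> \<le> C * s (2 ^ k)"
      using s_diff[of "q * 2 ^ k" "n mod 2 ^ k"] C(2)[of "n mod 2 ^ k" k] 2 by simp
    then have "s n \<ge> s (2 ^ k)" using 1 by (simp add: algebra_simps)
    moreover have "s (2 ^ p) < s (2 ^ k) * (2 * (2 powr H) ^ r)"
      using k1[OF k(2)] k(3) s_pos[of "2 ^ k"] by (simp add: field_simps)
    then have "c * s (2 ^ p) \<le> s (2 ^ k)"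
      unfolding c_def by (simp add: field_simps)
    ultimately show "c * s (2 ^ p) \<le> s n" by linarith
  qed
qed

lemma pow2_at_top: "filterlim (\<lambda>k. s (2 ^ k)) at_top sequentially"
proof -
  have "2 powr (- H) < 1" using H_pos powr_less_one by auto
  then obtain \<theta> where \<theta>: "2 powr (- H) < \<theta>" "\<theta> < 1" using dense by blast
  obtain C where C: "C \<ge> 1" "\<And>q j. j \<le> q \<Longrightarrow> s (2 ^ j) \<le> C * \<theta> ^ (q - j) * s (2 ^ q)"
    using pow2_growth[OF \<theta>] by blast
  have \<theta>0: "\<theta> > 0" using \<theta> by (smt (verit) powr_gt_zero)
  have "filterlim (\<lambda>r. (1 / \<theta>) ^ r) at_top sequentially"
    using \<theta> \<theta>0 by (intro power_at_top) auto
  then have "filterlim (\<lambda>r. (s 1 / C) * (1 / \<theta>) ^ r) at_top sequentially"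
    using s_pos[of 1] C by (intro filterlim_tendsto_pos_mult_at_top[OF tendsto_const]) auto
  then show ?thesis
  proof (rule filterlim_at_top_mono, intro always_eventually allI)
    fix q
    show "s 1 / C * (1 / \<theta>) ^ q \<le> s (2 ^ q)"
      using C(2)[of 0 q] C(1) \<theta>0 by (simp add: field_simps)
  qed
qed

lemma s_at_top: "filterlim s at_top sequentially"
proof (subst filterlim_at_top, intro allI)
  fix Z :: real
  obtain c p0 where c: "c > 0" "\<And>p n. p \<ge> p0 \<Longrightarrow> 2 ^ p \<le> n \<Longrightarrow> n < 2 ^ Suc p \<Longrightarrow> c * s (2 ^ p) \<le> s n"
    using s_lower_pow2 by blast
  obtain p1 where p1: "\<And>p. p \<ge> p1 \<Longrightarrow> s (2 ^ p) \<ge> Z / c"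
    using pow2_at_top unfolding filterlim_at_top eventually_sequentially by blast
  have "s n \<ge> Z" if n: "n \<ge> 2 ^ (p0 + p1)" for n
  proof -
    have "n \<ge> 1" using n by (meson order_trans one_le_numeral one_le_power)
    then obtain p where p: "2 ^ p \<le> n" "n < 2 ^ Suc p"
      using ex_power_ivl1[of 2 n] by auto
    have "(2::nat) ^ (p0 + p1) < 2 ^ Suc p" using n p by linarith
    then have "p0 + p1 \<le> p" by (metis less_Suc_eq_le one_less_numeral_iff power_less_imp_less_exp semiring_norm(76))
    then have "Z / c \<le> s (2 ^ p)" "c * s (2 ^ p) \<le> s n" using p1 c(2) p by auto
    then show ?thesis using c(1) by (smt (verit) mult.commute pos_divide_le_eq)
  qed
  then show "\<forall>\<^sub>F n in sequentially. Z \<le> s n" by (auto simp: eventually_sequentially)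
qed

lemma pow2_below_ratio:
  assumes \<theta>: "2 powr (- H) < \<theta>" and \<theta>1: "\<theta> < 1"
  shows "\<exists>C>0. \<exists>p0. \<forall>p\<ge>p0. \<forall>n r. 2 ^ p \<le> n \<and> n < 2 ^ Suc p \<and> r \<le> p \<longrightarrow>
    s (2 ^ (p - r)) \<le> C * \<theta> ^ r * s n"
proof -
  obtain C where C: "C \<ge> 1" "\<And>q j. j \<le> q \<Longrightarrow> s (2 ^ j) \<le> C * \<theta> ^ (q - j) * s (2 ^ q)"
    using pow2_growth[OF \<theta> \<theta>1] by blast
  obtain c p0 where c: "c > 0" "\<And>p n. p \<ge> p0 \<Longrightarrow> 2 ^ p \<le> n \<Longrightarrow> n < 2 ^ Suc p \<Longrightarrow> c * s (2 ^ p) \<le> s n"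
    using s_lower_pow2 by blast
  have \<theta>0: "\<theta> > 0" using \<theta> by (smt (verit) powr_gt_zero)
  show ?thesis
  proof (intro exI[of _ "C / c"] conjI exI[of _ p0] allI impI, goal_cases)
    case 1
    then show ?case using C c by simp
  next
    case (2 p n r)
    have "s (2 ^ (p - r)) \<le> C * \<theta> ^ r * s (2 ^ p)" using C(2)[of "p - r" p] 2 by simp
    also have "\<dots> \<le> C * \<theta> ^ r * (s n / c)"
      using c(2)[of p n] 2 c(1) C(1) \<theta>0 by (intro mult_left_mono) (auto simp: field_simps)
    finally show ?case by (simp add: field_simps)
  qed
qed

lemma s_proportional:
  fixes k :: "nat \<Rightarrow> nat" and j m :: nat and D :: real
  assumes m: "m \<ge> 1" and k: "\<And>n. \<bar>real m * real (k n) - real j * real n\<bar> \<le> D"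
  shows "(\<lambda>n. s (k n) / s n) \<longlonglongrightarrow> (real j / real m) powr H"
proof -
  have D0: "D \<ge> 0" using k[of 0] by linarith
  define q where "q n = n div m" for n
  have q: "real n = real m * real (q n) + real (n mod m)" for n
    unfolding q_def by (metis of_nat_add of_nat_mult mult_div_mod_eq)
  have modm: "real (n mod m) \<le> real m" for n using m by (simp add: less_imp_le)
  have qtop: "filterlim q at_top sequentially"
    unfolding q_def using m by (intro filterlim_at_top_div_const_nat) auto
  define E where "E = D + real j * real m + real m"
  have b1: "\<bar>s n - s (m * q n)\<bar> \<le> E * s 1" for n
  proof -
    have "\<bar>s n - s (m * q n)\<bar> \<le> s (n mod m)"
      using s_diff[of "m * q n" "n mod m"] by (simp add: q_def)
    also have "\<dots> \<le> real (n mod m) * s 1" by (rule s_linear)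
    also have "\<dots> \<le> E * s 1"
    proof (intro mult_right_mono)
      have "0 \<le> real j * real m" by simp
      then show "real (n mod m) \<le> E" using modm[of n] D0 unfolding E_def by linarith
    qed (rule s_nonneg)
    finally show ?thesis .
  qed
  have b2: "\<bar>s (k n) - s (j * q n)\<bar> \<le> E * s 1" for n
  proof -
    have "real m * \<bar>real (k n) - real (j * q n)\<bar> = \<bar>real m * real (k n) - real j * (real m * real (q n))\<bar>"
      using abs_mult[of "real m" "real (k n) - real (j * q n)"] by (simp add: algebra_simps)
    also have "\<dots> = \<bar>real m * real (k n) - real j * real n + real j * real (n mod m)\<bar>"
      using q[of n] by (simp add: algebra_simps)
    also have "\<dots> \<le> D + real j * real m"
      using k[of n] modm[of n] mult_left_mono[OF modm[of n], of "real j"]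
      by (smt (verit) of_nat_0_le_iff mult_nonneg_nonneg)
    also have "\<dots> \<le> E" by (simp add: E_def)
    also have "\<dots> \<le> real m * E"
    proof -
      have "0 \<le> E" using D0 by (simp add: E_def)
      then show ?thesis using m mult_right_mono[of 1 "real m" E] by simp
    qed
    finally have le: "\<bar>real (k n) - real (j * q n)\<bar> \<le> E" using m by simp
    have "\<bar>s (k n) - s (j * q n)\<bar> \<le> s (if k n \<le> j * q n then j * q n - k n else k n - j * q n)"
      by (rule s_abs_diff)
    also have "\<dots> \<le> real (if k n \<le> j * q n then j * q n - k n else k n - j * q n) * s 1"
      by (rule s_linear)
    also have "\<dots> \<le> E * s 1" using le s_nonneg[of 1]
      by (intro mult_right_mono) (auto split: if_splits simp: of_nat_diff simp del: of_nat_mult)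
    finally show ?thesis .
  qed
  have invq: "(\<lambda>n. 1 / s (q n)) \<longlonglongrightarrow> 0"
    using filterlim_compose[OF tendsto_inverse_0_at_top[OF s_at_top] qtop] by (simp add: inverse_eq_divide)
  have ratio: "(\<lambda>n. s (i * q n) / s (q n)) \<longlonglongrightarrow> real i powr H" for i
  proof (cases "i = 0")
    case True
    then show ?thesis by (simp add: s_0)
  next
    case False
    then show ?thesis using filterlim_compose[OF s_ratio[of i] qtop] by simp
  qed
  have close: "(\<lambda>n. f n / s (q n)) \<longlonglongrightarrow> real i powr H"
    if f: "\<And>n. \<bar>f n - s (i * q n)\<bar> \<le> E * s 1" for f i
  proof -
    have "(\<lambda>n. (f n - s (i * q n)) / s (q n)) \<longlonglongrightarrow> 0"
    proof (rule Lim_null_comparison)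
      show "\<forall>\<^sub>F n in sequentially. norm ((f n - s (i * q n)) / s (q n)) \<le> (E * s 1) * (1 / s (q n))"
        using f s_nonneg by (intro always_eventually) (auto simp: abs_divide divide_right_mono)
      show "(\<lambda>n. (E * s 1) * (1 / s (q n))) \<longlonglongrightarrow> 0"
        using tendsto_mult_right_zero[OF invq] by blast
    qed
    from tendsto_add[OF this ratio[of i]] show ?thesis
      by (simp add: diff_divide_distrib)
  qed
  have "(\<lambda>n. (s (k n) / s (q n)) / (s n / s (q n))) \<longlonglongrightarrow> real j powr H / real m powr H"
    using m by (intro tendsto_divide close b1 b2) auto
  moreover have "\<forall>\<^sub>F n in sequentially. (s (k n) / s (q n)) / (s n / s (q n)) = s (k n) / s n"
  proof -
    have "\<forall>\<^sub>F n in sequentially. q n \<ge> 1" using qtop by (simp add: filterlim_at_top)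
    then show ?thesis
    proof eventually_elim
      case (elim n)
      then have "s (q n) \<noteq> 0" using s_pos[of "q n"] by simp
      then show ?case by simp
    qed
  qed
  ultimately have "(\<lambda>n. s (k n) / s n) \<longlonglongrightarrow> real j powr H / real m powr H"
    by (rule Lim_transform_eventually)
  then show ?thesis using m by (simp add: powr_divide)
qed

end

section \<open>Moments of weighted sums\<close>

lemma powr_taylor2_pos:
  fixes x y \<alpha> :: real
  assumes x: "x > 0" and y: "\<bar>y\<bar> \<le> x / 2" and \<alpha>: "\<alpha> \<ge> 2"
  shows "(x + y) powr \<alpha> \<le> x powr \<alpha> + \<alpha> * x powr (\<alpha> - 1) * y
    + \<alpha> * (\<alpha> - 1) * 2 powr (\<alpha> - 2) * (x powr (\<alpha> - 2) * y\<^sup>2)"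
proof (cases "y = 0")
  case False
  define g where "g u = u powr \<alpha>" for u :: real
  define g1 where "g1 u = \<alpha> * u powr (\<alpha> - 1)" for u :: real
  define g2 where "g2 u = \<alpha> * (\<alpha> - 1) * u powr (\<alpha> - 2)" for u :: real
  have d1: "DERIV g u :> g1 u" if "u > 0" for u
    unfolding g_def g1_def using that by (auto intro!: derivative_eq_intros)
  have d2: "DERIV g1 u :> g2 u" if "u > 0" for u
    unfolding g1_def g2_def using that by (auto intro!: derivative_eq_intros simp: field_simps)
  have mvt: "\<exists>z. \<bar>z - a\<bar> \<le> \<bar>b - a\<bar> \<and> f b - f a = f' z * (b - a)"
    if ab: "a > 0" "b > 0" and d: "\<And>u. u > 0 \<Longrightarrow> DERIV f u :> f' u" for f f' :: "real \<Rightarrow> real" and a b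
  proof -
    consider "a < b" | "a = b" | "b < a" by linarith
    then show ?thesis
    proof cases
      case 1
      then obtain z where "a < z" "z < b" "f b - f a = (b - a) * f' z"
        using MVT2[of a b f f'] d ab by force
      then show ?thesis by (intro exI[of _ z]) (auto simp: mult.commute)
    next
      case 2
      then show ?thesis by (intro exI[of _ a]) auto
    next
      case 3
      then obtain z where "b < z" "z < a" "f a - f b = (a - b) * f' z"
        using MVT2[of b a f f'] d ab by force
      then show ?thesis by (intro exI[of _ z]) (auto simp: algebra_simps)
    qed
  qed
  have xy: "x + y > 0" using x y by linarith
  obtain z where z: "\<bar>z - x\<bar> \<le> \<bar>y\<bar>" "g (x + y) - g x = g1 z * y"
    using mvt[OF x xy d1] by auto
  have z0: "z > 0" using z y x by linarith
  obtain w where w: "\<bar>w - x\<bar> \<le> \<bar>z - x\<bar>" "g1 z - g1 x = g2 w * (z - x)"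
    using mvt[OF x z0 d2] by auto
  have w0: "w > 0" "w \<le> 2 * x" using w z y x by linarith+
  have "w powr (\<alpha> - 2) \<le> (2 * x) powr (\<alpha> - 2)" using w0 \<alpha> by (intro powr_mono2) auto
  also have "\<dots> = 2 powr (\<alpha> - 2) * x powr (\<alpha> - 2)" using x by (simp add: powr_mult)
  finally have g2: "g2 w \<le> \<alpha> * (\<alpha> - 1) * (2 powr (\<alpha> - 2) * x powr (\<alpha> - 2))"
    unfolding g2_def using \<alpha> by (intro mult_left_mono) auto
  have g20: "g2 w \<ge> 0" using \<alpha> by (simp add: g2_def)
  have "g (x + y) - g x - g1 x * y = g2 w * ((z - x) * y)"
  proof -
    have "g (x + y) - g x - g1 x * y = (g1 z - g1 x) * y" using z(2) by (simp add: algebra_simps)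
    then show ?thesis unfolding w(2) by simp
  qed
  also have "\<dots> \<le> g2 w * y\<^sup>2"
  proof (rule mult_left_mono[OF _ g20])
    have "(z - x) * y \<le> \<bar>z - x\<bar> * \<bar>y\<bar>" by (metis abs_ge_self abs_mult)
    also have "\<dots> \<le> \<bar>y\<bar> * \<bar>y\<bar>" using z(1) by (intro mult_right_mono) auto
    finally show "(z - x) * y \<le> y\<^sup>2" by (simp add: power2_eq_square)
  qed
  also have "\<dots> \<le> \<alpha> * (\<alpha> - 1) * (2 powr (\<alpha> - 2) * x powr (\<alpha> - 2)) * y\<^sup>2"
    using g2 by (intro mult_right_mono) auto
  finally show ?thesis by (simp add: g_def g1_def mult_ac)
qed (use x in auto)

definition powr_taylor_const :: "real \<Rightarrow> real" where
  "powr_taylor_const \<alpha> = 3 powr \<alpha> + \<alpha> * 2 powr (\<alpha> - 1) + \<alpha> * (\<alpha> - 1) * 2 powr (\<alpha> - 2)"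

lemma powr_taylor2:
  fixes x y \<alpha> :: real
  assumes \<alpha>: "\<alpha> \<ge> 2"
  shows "\<bar>x + y\<bar> powr \<alpha> \<le> \<bar>x\<bar> powr \<alpha> + \<alpha> * (\<bar>x\<bar> powr (\<alpha> - 1) * sgn x) * y
    + powr_taylor_const \<alpha> * (\<bar>x\<bar> powr (\<alpha> - 2) * y\<^sup>2 + \<bar>y\<bar> powr \<alpha>)"
proof -
  let ?C = "powr_taylor_const \<alpha>"
  have C: "?C \<ge> \<alpha> * (\<alpha> - 1) * 2 powr (\<alpha> - 2)" "?C \<ge> 3 powr \<alpha> + \<alpha> * 2 powr (\<alpha> - 1)" "?C \<ge> 0"
    using \<alpha> by (auto simp: powr_taylor_const_def)
  have nonneg: "\<bar>x + y\<bar> powr \<alpha> \<le> \<bar>x\<bar> powr \<alpha> + \<alpha> * (\<bar>x\<bar> powr (\<alpha> - 1) * sgn x) * y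
    + ?C * (\<bar>x\<bar> powr (\<alpha> - 2) * y\<^sup>2 + \<bar>y\<bar> powr \<alpha>)" if x: "x \<ge> 0" for x y :: real
  proof (cases "x > 0 \<and> \<bar>y\<bar> \<le> x / 2")
    case True
    then have "x + y > 0" by (auto simp: abs_if split: if_splits)
    then have "\<bar>x + y\<bar> powr \<alpha> \<le> x powr \<alpha> + \<alpha> * x powr (\<alpha> - 1) * y
      + \<alpha> * (\<alpha> - 1) * 2 powr (\<alpha> - 2) * (x powr (\<alpha> - 2) * y\<^sup>2)"
      using powr_taylor2_pos[of x y \<alpha>] True \<alpha> by simp
    also have "\<alpha> * (\<alpha> - 1) * 2 powr (\<alpha> - 2) * (x powr (\<alpha> - 2) * y\<^sup>2) \<le> ?C * (x powr (\<alpha> - 2) * y\<^sup>2)"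
      using C by (intro mult_right_mono) auto
    also have "\<dots> \<le> ?C * (x powr (\<alpha> - 2) * y\<^sup>2 + \<bar>y\<bar> powr \<alpha>)"
      using C by (intro mult_left_mono) auto
    finally show ?thesis using True by (simp add: mult_ac)
  next
    case False
    then have xy: "x \<le> 2 * \<bar>y\<bar>" using x by (auto simp: not_le)
    have 1: "\<bar>x + y\<bar> powr \<alpha> \<le> 3 powr \<alpha> * \<bar>y\<bar> powr \<alpha>"
    proof -
      have "\<bar>x + y\<bar> powr \<alpha> \<le> (3 * \<bar>y\<bar>) powr \<alpha>" using xy x \<alpha> by (intro powr_mono2) auto
      then show ?thesis by (simp add: powr_mult)
    qed
    have 2: "\<bar>\<alpha> * (\<bar>x\<bar> powr (\<alpha> - 1) * sgn x) * y\<bar> \<le> \<alpha> * 2 powr (\<alpha> - 1) * \<bar>y\<bar> powr \<alpha>"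
    proof -
      have "\<bar>\<alpha> * (\<bar>x\<bar> powr (\<alpha> - 1) * sgn x) * y\<bar> = \<alpha> * (x powr (\<alpha> - 1) * \<bar>y\<bar>)"
        using x \<alpha> by (cases "x = 0") (auto simp: abs_mult)
      also have "x powr (\<alpha> - 1) \<le> (2 * \<bar>y\<bar>) powr (\<alpha> - 1)" using xy x \<alpha> by (intro powr_mono2) auto
      also have "(2 * \<bar>y\<bar>) powr (\<alpha> - 1) * \<bar>y\<bar> = 2 powr (\<alpha> - 1) * \<bar>y\<bar> powr \<alpha>"
        by (cases "y = 0") (auto simp: powr_mult powr_diff)
      finally show ?thesis using \<alpha> by (simp add: mult_left_mono mult_right_mono)
    qed
    have "\<bar>x + y\<bar> powr \<alpha> \<le> \<bar>x\<bar> powr \<alpha> + \<alpha> * (\<bar>x\<bar> powr (\<alpha> - 1) * sgn x) * y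
      + (3 powr \<alpha> + \<alpha> * 2 powr (\<alpha> - 1)) * \<bar>y\<bar> powr \<alpha>"
      using 1 2 powr_ge_zero[of "\<bar>x\<bar>" \<alpha>] unfolding distrib_right by linarith
    also have "(3 powr \<alpha> + \<alpha> * 2 powr (\<alpha> - 1)) * \<bar>y\<bar> powr \<alpha> \<le> ?C * \<bar>y\<bar> powr \<alpha>"
      using C by (intro mult_right_mono) auto
    also have "\<dots> \<le> ?C * (\<bar>x\<bar> powr (\<alpha> - 2) * y\<^sup>2 + \<bar>y\<bar> powr \<alpha>)"
      using C by (intro mult_left_mono) auto
    finally show ?thesis by simp
  qed
  show ?thesis
  proof (cases "x \<ge> 0")
    case False
    then show ?thesis using nonneg[of "- x" "- y"] by (simp add: sgn_minus abs_minus_commute add.commute)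
  qed (rule nonneg)
qed

lemma powr_two_term_bound:
  fixes y T \<alpha> :: real
  assumes "y \<ge> 0" "T > 0" "\<alpha> \<ge> 2"
  shows "y powr (\<alpha> - 2) \<le> T powr (\<alpha> - 2) + y powr \<alpha> / T\<^sup>2"
proof (cases "y \<le> T")
  case True
  then have "y powr (\<alpha> - 2) \<le> T powr (\<alpha> - 2)" using assms by (intro powr_mono2) auto
  then show ?thesis by (smt (verit) divide_nonneg_nonneg powr_ge_zero zero_le_power2)
next
  case False
  then have "y powr (\<alpha> - 2) = y powr \<alpha> / y\<^sup>2"
    using assms by (simp add: powr_diff)
  also have "\<dots> \<le> y powr \<alpha> / T\<^sup>2"
    using False assms by (intro divide_left_mono power_mono) auto
  finally show ?thesis by (smt (verit) powr_ge_zero)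
qed

lemma (in prob_space) integrable_powr_le:
  fixes Y :: "'a \<Rightarrow> real"
  assumes Y[measurable]: "Y \<in> borel_measurable M"
    and i: "integrable M (\<lambda>\<omega>. \<bar>Y \<omega>\<bar> powr \<alpha>)" and b: "0 \<le> \<beta>" "\<beta> \<le> \<alpha>"
  shows "integrable M (\<lambda>\<omega>. \<bar>Y \<omega>\<bar> powr \<beta>)"
proof (rule Bochner_Integration.integrable_bound[where f = "\<lambda>\<omega>. 1 + \<bar>Y \<omega>\<bar> powr \<alpha>"])
  show "integrable M (\<lambda>\<omega>. 1 + \<bar>Y \<omega>\<bar> powr \<alpha>)" using i by simp
  have "y powr \<beta> \<le> 1 + y powr \<alpha>" if "y \<ge> 0" for y :: real
  proof (cases "y \<le> 1")
    case True
    then have "y powr \<beta> \<le> 1" using that b powr_mono2[of \<beta> y 1] by simp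
    then show ?thesis by (smt (verit) powr_ge_zero)
  next
    case False
    then have "y powr \<beta> \<le> y powr \<alpha>" using b by (intro powr_mono) auto
    then show ?thesis by simp
  qed
  then show "AE \<omega> in M. norm (\<bar>Y \<omega>\<bar> powr \<beta>) \<le> norm (1 + \<bar>Y \<omega>\<bar> powr \<alpha>)"
    by (intro AE_I2) (simp add: add_nonneg_nonneg)
qed measurable

text \<open>
  The constants are chosen such that the second order term of
  the Taylor expansion of \<open>\<bar>x\<bar> powr \<alpha>\<close> is absorbed by the growth of the right hand side when
  one more summand is added.
\<close>

lemma (in prob_space) weighted_sum_moment_bound:
  fixes \<xi> :: "'i \<Rightarrow> 'a \<Rightarrow> real"
  assumes indep: "indep_vars (\<lambda>_. borel) \<xi> UNIV"
    and \<alpha>: "\<alpha> \<ge> 2"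
    and int1: "\<And>k. integrable M (\<xi> k)" and int2: "\<And>k. integrable M (\<lambda>\<omega>. (\<xi> k \<omega>)\<^sup>2)"
    and int\<alpha>: "\<And>k. integrable M (\<lambda>\<omega>. \<bar>\<xi> k \<omega>\<bar> powr \<alpha>)"
    and mean: "\<And>k. expectation (\<xi> k) = 0" and var: "\<And>k. expectation (\<lambda>\<omega>. (\<xi> k \<omega>)\<^sup>2) = 1"
    and mom: "\<And>k. expectation (\<lambda>\<omega>. \<bar>\<xi> k \<omega>\<bar> powr \<alpha>) \<le> m"
  shows "\<exists>K\<ge>0. \<forall>F b. finite F \<longrightarrow> integrable M (\<lambda>\<omega>. \<bar>\<Sum>k\<in>F. b k * \<xi> k \<omega>\<bar> powr \<alpha>) \<and>
    expectation (\<lambda>\<omega>. \<bar>\<Sum>k\<in>F. b k * \<xi> k \<omega>\<bar> powr \<alpha>) \<le> K * (\<Sum>k\<in>F. (b k)\<^sup>2) powr (\<alpha> / 2)"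
proof -
  have rv[measurable]: "\<xi> k \<in> borel_measurable M" for k
    using indep by (auto simp: indep_vars_def)
  define C where "C = powr_taylor_const \<alpha>"
  have C: "C > 0"
  proof -
    have "\<alpha> * 2 powr (\<alpha> - 1) \<ge> 0" "\<alpha> * (\<alpha> - 1) * 2 powr (\<alpha> - 2) \<ge> 0" "3 powr \<alpha> > 0" using \<alpha> by auto
    then show ?thesis unfolding C_def powr_taylor_const_def by linarith
  qed
  define T where "T = sqrt (4 * C)"
  have T: "T > 0" "T\<^sup>2 = 4 * C" using C by (auto simp: T_def)
  have m0: "m \<ge> 0" using mom[of undefined] by (smt (verit) Bochner_Integration.integral_nonneg powr_ge_zero)
  define K where "K = max (4 * C * T powr (\<alpha> - 2)) (2 * C * m) + m"
  have K0: "K \<ge> 0"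
  proof -
    have "0 \<le> 4 * C * T powr (\<alpha> - 2)" using C by simp
    then show ?thesis unfolding K_def using m0 by linarith
  qed
  have K1: "C * (T powr (\<alpha> - 2) + K / T\<^sup>2) \<le> K / 2"
  proof -
    have "4 * C * T powr (\<alpha> - 2) \<le> K" using m0 by (simp add: K_def)
    then show ?thesis using C by (simp add: T field_simps)
  qed
  have K2: "C * m \<le> K / 2" using m0 by (auto simp: K_def)
  have K3: "m \<le> K"
  proof -
    have "0 \<le> 4 * C * T powr (\<alpha> - 2)" using C by simp
    then show ?thesis unfolding K_def by linarith
  qed
  have main: "integrable M (\<lambda>\<omega>. \<bar>\<Sum>k\<in>F. b k * \<xi> k \<omega>\<bar> powr \<alpha>) \<and>
    expectation (\<lambda>\<omega>. \<bar>\<Sum>k\<in>F. b k * \<xi> k \<omega>\<bar> powr \<alpha>) \<le> K * (\<Sum>k\<in>F. (b k)\<^sup>2) powr (\<alpha> / 2)"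
    if "finite F" for F b
    using that
  proof induction
    case empty
    then show ?case by simp
  next
    case (insert i F)
    define Y where "Y \<omega> = (\<Sum>k\<in>F. b k * \<xi> k \<omega>)" for \<omega>
    have [measurable]: "Y \<in> borel_measurable M" unfolding Y_def by measurable
    define v where "v = (\<Sum>k\<in>F. (b k)\<^sup>2)"
    define A where "A = expectation (\<lambda>\<omega>. \<bar>Y \<omega>\<bar> powr \<alpha>)"
    have iY: "integrable M (\<lambda>\<omega>. \<bar>Y \<omega>\<bar> powr \<alpha>)" and A: "A \<le> K * v powr (\<alpha> / 2)"
      using insert unfolding Y_def v_def A_def by auto
    have v0: "v \<ge> 0" by (simp add: v_def sum_nonneg)
    have sumY: "(\<Sum>k\<in>insert i F. b k * \<xi> k \<omega>) = Y \<omega> + b i * \<xi> i \<omega>" for \<omega>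
      using insert by (simp add: Y_def add.commute)
    have sumv: "(\<Sum>k\<in>insert i F. (b k)\<^sup>2) = v + (b i)\<^sup>2"
      using insert by (simp add: v_def add.commute)
    have bmom: "(\<lambda>\<omega>. \<bar>b i * \<xi> i \<omega>\<bar> powr \<alpha>) = (\<lambda>\<omega>. \<bar>b i\<bar> powr \<alpha> * \<bar>\<xi> i \<omega>\<bar> powr \<alpha>)"
      by (simp add: abs_mult powr_mult)
    have b2: "\<bar>b i\<bar> powr \<alpha> = ((b i)\<^sup>2) powr (\<alpha> / 2)"
    proof -
      have eq: "(b i)\<^sup>2 = \<bar>b i\<bar> powr 2" by (cases "b i = 0") (auto simp: powr_numeral)
      show ?thesis unfolding eq powr_powr by simp
    qed
    show ?case
    proof (cases "v = 0")
      case True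
      then have "b k = 0" if "k \<in> F" for k
        using that insert(1) by (simp add: v_def sum_nonneg_eq_0_iff)
      then have Y0: "Y \<omega> = 0" for \<omega> by (simp add: Y_def)
      show ?thesis unfolding sumY sumv Y0 True
        using int\<alpha>[of i] mult_left_mono[OF order_trans[OF mom[of i] K3], of "\<bar>b i\<bar> powr \<alpha>"]
        by (simp add: bmom b2 mult.commute)
    next
      case False
      with v0 have v: "v > 0" by simp
      have ind: "indep_var borel (\<xi> i) borel Y"
      proof -
        have "indep_vars (\<lambda>_. borel) (\<lambda>k \<omega>. (if k = i then 1 else b k) * \<xi> k \<omega>) (insert i F)"
          by (rule indep_vars_compose2[OF indep_vars_subset[OF indep]]) auto
        from indep_vars_sum[OF insert(1,2) this]
        have "indep_var borel (\<xi> i) borel (\<lambda>\<omega>. \<Sum>k\<in>F. (if k = i then 1 else b k) * \<xi> k \<omega>)"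
          by simp
        also have "(\<lambda>\<omega>. \<Sum>k\<in>F. (if k = i then 1 else b k) * \<xi> k \<omega>) = Y"
          unfolding Y_def using insert(2) by (intro ext sum.cong) auto
        finally show ?thesis .
      qed
      define f where "f x = \<bar>x\<bar> powr (\<alpha> - 1) * sgn x" for x :: real
      have [measurable]: "f \<in> borel_measurable borel" unfolding f_def by measurable
      have if1: "integrable M (\<lambda>\<omega>. f (Y \<omega>))"
      proof (rule Bochner_Integration.integrable_bound[OF integrable_powr_le[OF _ iY, of "\<alpha> - 1"]])
        show "AE \<omega> in M. norm (f (Y \<omega>)) \<le> norm (\<bar>Y \<omega>\<bar> powr (\<alpha> - 1))"
          by (intro AE_I2) (simp add: f_def abs_mult sgn_if)
      qed (use \<alpha> in auto)
      have ind1: "indep_var borel (\<xi> i) borel (\<lambda>\<omega>. f (Y \<omega>))"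
        using indep_var_compose[OF ind, of "\<lambda>x. x" borel f borel] by (simp add: comp_def)
      have ind2: "indep_var borel (\<lambda>\<omega>. (\<xi> i \<omega>)\<^sup>2) borel (\<lambda>\<omega>. \<bar>Y \<omega>\<bar> powr (\<alpha> - 2))"
        using indep_var_compose[OF ind, of "\<lambda>x. x\<^sup>2" borel "\<lambda>x. \<bar>x\<bar> powr (\<alpha> - 2)" borel] by (simp add: comp_def)
      have if2: "integrable M (\<lambda>\<omega>. \<bar>Y \<omega>\<bar> powr (\<alpha> - 2))"
        using \<alpha> by (intro integrable_powr_le[OF _ iY]) auto
      have i1: "integrable M (\<lambda>\<omega>. f (Y \<omega>) * \<xi> i \<omega>)"
        using indep_var_integrable[OF ind1 int1 if1] by (simp add: mult.commute)
      have e1: "expectation (\<lambda>\<omega>. f (Y \<omega>) * \<xi> i \<omega>) = 0"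
        using indep_var_lebesgue_integral[OF ind1 int1 if1] mean by (simp add: mult.commute)
      have i2: "integrable M (\<lambda>\<omega>. \<bar>Y \<omega>\<bar> powr (\<alpha> - 2) * (\<xi> i \<omega>)\<^sup>2)"
        using indep_var_integrable[OF ind2 int2 if2] by (simp add: mult.commute)
      have e2: "expectation (\<lambda>\<omega>. \<bar>Y \<omega>\<bar> powr (\<alpha> - 2) * (\<xi> i \<omega>)\<^sup>2) = expectation (\<lambda>\<omega>. \<bar>Y \<omega>\<bar> powr (\<alpha> - 2))"
        using indep_var_lebesgue_integral[OF ind2 int2 if2] var by (simp add: mult.commute)
      let ?g = "\<lambda>\<omega>. \<bar>Y \<omega>\<bar> powr \<alpha> + (\<alpha> * b i) * (f (Y \<omega>) * \<xi> i \<omega>)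
        + (C * (b i)\<^sup>2 * (\<bar>Y \<omega>\<bar> powr (\<alpha> - 2) * (\<xi> i \<omega>)\<^sup>2) + C * \<bar>b i\<bar> powr \<alpha> * \<bar>\<xi> i \<omega>\<bar> powr \<alpha>)"
      have le: "\<bar>Y \<omega> + b i * \<xi> i \<omega>\<bar> powr \<alpha> \<le> ?g \<omega>" for \<omega>
        using powr_taylor2[OF \<alpha>, of "Y \<omega>" "b i * \<xi> i \<omega>"]
        by (simp add: f_def C_def abs_mult powr_mult power_mult_distrib algebra_simps)
      have ig: "integrable M ?g" using iY i1 i2 int\<alpha> by auto
      have int: "integrable M (\<lambda>\<omega>. \<bar>Y \<omega> + b i * \<xi> i \<omega>\<bar> powr \<alpha>)"
        by (rule Bochner_Integration.integrable_bound[OF ig])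
           (use le in \<open>auto intro!: AE_I2 order_trans[OF le]\<close>)
      have low: "expectation (\<lambda>\<omega>. \<bar>Y \<omega>\<bar> powr (\<alpha> - 2)) \<le> v powr (\<alpha> / 2 - 1) * (T powr (\<alpha> - 2) + K / T\<^sup>2)"
      proof -
        define w where "w = sqrt v"
        have w: "w > 0" using v by (simp add: w_def)
        have wp: "w powr p = v powr (p / 2)" for p
          using v by (simp add: w_def powr_half_sqrt[symmetric] powr_powr)
        have pt: "\<bar>Y \<omega>\<bar> powr (\<alpha> - 2) \<le> (w * T) powr (\<alpha> - 2) + \<bar>Y \<omega>\<bar> powr \<alpha> / (w * T)\<^sup>2" for \<omega>
          using w T \<alpha> by (intro powr_two_term_bound) auto
        have "expectation (\<lambda>\<omega>. \<bar>Y \<omega>\<bar> powr (\<alpha> - 2)) \<le>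
          expectation (\<lambda>\<omega>. (w * T) powr (\<alpha> - 2) + \<bar>Y \<omega>\<bar> powr \<alpha> / (w * T)\<^sup>2)"
          using pt if2 iY by (intro integral_mono) auto
        also have "\<dots> = (w * T) powr (\<alpha> - 2) + A / (w * T)\<^sup>2"
          using iY by (simp add: A_def prob_space)
        also have "\<dots> \<le> (w * T) powr (\<alpha> - 2) + (K * v powr (\<alpha> / 2)) / (w * T)\<^sup>2"
          using A by (intro add_left_mono divide_right_mono) auto
        also have "\<dots> = v powr (\<alpha> / 2 - 1) * (T powr (\<alpha> - 2) + K / T\<^sup>2)"
        proof -
          have 1: "(w * T) powr (\<alpha> - 2) = v powr (\<alpha> / 2 - 1) * T powr (\<alpha> - 2)"
            using w T by (simp add: powr_mult wp diff_divide_distrib)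
          have 2: "w\<^sup>2 = v" using v by (simp add: w_def)
          have 3: "v powr (\<alpha> / 2) = v powr (\<alpha> / 2 - 1) * v" using v by (simp add: powr_diff)
          show ?thesis using v T(1) unfolding 1 3 power_mult_distrib 2 by (simp add: field_simps)
        qed
        finally show ?thesis .
      qed
      have "expectation (\<lambda>\<omega>. \<bar>Y \<omega> + b i * \<xi> i \<omega>\<bar> powr \<alpha>) \<le> expectation ?g"
        by (rule integral_mono[OF int ig le])
      also have "\<dots> = A + (C * (b i)\<^sup>2 * expectation (\<lambda>\<omega>. \<bar>Y \<omega>\<bar> powr (\<alpha> - 2))
         + C * \<bar>b i\<bar> powr \<alpha> * expectation (\<lambda>\<omega>. \<bar>\<xi> i \<omega>\<bar> powr \<alpha>))"
        using iY i1 i2 int\<alpha> by (simp add: e1 e2 A_def)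
      also have "\<dots> \<le> K * v powr (\<alpha> / 2) + (K / 2 * ((b i)\<^sup>2 * v powr (\<alpha> / 2 - 1)) + K / 2 * \<bar>b i\<bar> powr \<alpha>)"
      proof (intro add_mono A)
        have "C * (b i)\<^sup>2 * expectation (\<lambda>\<omega>. \<bar>Y \<omega>\<bar> powr (\<alpha> - 2))
          \<le> C * (b i)\<^sup>2 * (v powr (\<alpha> / 2 - 1) * (T powr (\<alpha> - 2) + K / T\<^sup>2))"
          using low C by (intro mult_left_mono) auto
        also have "\<dots> = (C * (T powr (\<alpha> - 2) + K / T\<^sup>2)) * ((b i)\<^sup>2 * v powr (\<alpha> / 2 - 1))"
          by (simp add: mult_ac)
        also have "\<dots> \<le> K / 2 * ((b i)\<^sup>2 * v powr (\<alpha> / 2 - 1))"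
          using K1 by (intro mult_right_mono) auto
        finally show "C * (b i)\<^sup>2 * expectation (\<lambda>\<omega>. \<bar>Y \<omega>\<bar> powr (\<alpha> - 2)) \<le> \<dots>" .
        have "C * \<bar>b i\<bar> powr \<alpha> * expectation (\<lambda>\<omega>. \<bar>\<xi> i \<omega>\<bar> powr \<alpha>) \<le> C * \<bar>b i\<bar> powr \<alpha> * m"
          using C mom by (intro mult_left_mono) auto
        also have "\<dots> = (C * m) * \<bar>b i\<bar> powr \<alpha>" by simp
        also have "\<dots> \<le> K / 2 * \<bar>b i\<bar> powr \<alpha>" using K2 by (intro mult_right_mono) auto
        finally show "C * \<bar>b i\<bar> powr \<alpha> * expectation (\<lambda>\<omega>. \<bar>\<xi> i \<omega>\<bar> powr \<alpha>) \<le> \<dots>" .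
      qed
      also have "\<dots> \<le> K * (v + (b i)\<^sup>2) powr (\<alpha> / 2)"
      proof -
        define u where "u = (b i)\<^sup>2"
        have u: "u \<ge> 0" by (simp add: u_def)
        have split: "(v + u) powr (\<alpha> / 2) = v * (v + u) powr (\<alpha> / 2 - 1) + u * (v + u) powr (\<alpha> / 2 - 1)"
        proof -
          have "(v + u) powr (\<alpha> / 2) = (v + u) * (v + u) powr (\<alpha> / 2 - 1)"
            using v u by (simp add: powr_diff)
          then show ?thesis by (simp only: distrib_right)
        qed
        have g1: "v powr (\<alpha> / 2 - 1) \<le> (v + u) powr (\<alpha> / 2 - 1)"
          using v u \<alpha> by (intro powr_mono2) auto
        have g2: "u powr (\<alpha> / 2 - 1) \<le> (v + u) powr (\<alpha> / 2 - 1)"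
          using v u \<alpha> by (intro powr_mono2) auto
        have h1: "v powr (\<alpha> / 2) = v * v powr (\<alpha> / 2 - 1)" using v by (simp add: powr_diff)
        have h2: "u powr (\<alpha> / 2) = u * u powr (\<alpha> / 2 - 1)"
          using u by (cases "u = 0") (auto simp: powr_diff)
        have A1: "v powr (\<alpha> / 2) + u * v powr (\<alpha> / 2 - 1) \<le> (v + u) powr (\<alpha> / 2)"
          unfolding split h1 using g1 v u by (intro add_mono mult_left_mono) auto
        have A2: "v powr (\<alpha> / 2) + u powr (\<alpha> / 2) \<le> (v + u) powr (\<alpha> / 2)"
          unfolding split h1 h2 using g1 g2 v u by (intro add_mono mult_left_mono) auto
        have "K * v powr (\<alpha> / 2) + (K / 2 * (u * v powr (\<alpha> / 2 - 1)) + K / 2 * u powr (\<alpha> / 2))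
          = K / 2 * (v powr (\<alpha> / 2) + u * v powr (\<alpha> / 2 - 1)) + K / 2 * (v powr (\<alpha> / 2) + u powr (\<alpha> / 2))"
          by (simp add: algebra_simps)
        also have "\<dots> \<le> K / 2 * (v + u) powr (\<alpha> / 2) + K / 2 * (v + u) powr (\<alpha> / 2)"
          using A1 A2 K0 by (intro add_mono mult_left_mono) auto
        finally show ?thesis by (simp add: b2 u_def)
      qed
      finally show ?thesis using int unfolding sumY sumv by simp
    qed
  qed
  show ?thesis using K0 main by blast
qed

section \<open>Mean square convergent linear combinations\<close>

lemma integrable_mult_of_squares:
  fixes f g :: "'a \<Rightarrow> real"
  assumes [measurable]: "f \<in> borel_measurable M" "g \<in> borel_measurable M"
    and "integrable M (\<lambda>x. (f x)\<^sup>2)" "integrable M (\<lambda>x. (g x)\<^sup>2)"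
  shows "integrable M (\<lambda>x. f x * g x)"
proof (rule Bochner_Integration.integrable_bound[where f = "\<lambda>x. (f x)\<^sup>2 + (g x)\<^sup>2"])
  show "integrable M (\<lambda>x. (f x)\<^sup>2 + (g x)\<^sup>2)" using assms by simp
  have "\<bar>u * v\<bar> \<le> u\<^sup>2 + v\<^sup>2" for u v :: real
  proof -
    have "0 \<le> (\<bar>u\<bar> - \<bar>v\<bar>)\<^sup>2 + (u\<^sup>2 + v\<^sup>2)" by simp
    then show ?thesis by (simp add: power2_diff abs_mult)
  qed
  then show "AE x in M. norm (f x * g x) \<le> norm ((f x)\<^sup>2 + (g x)\<^sup>2)"
    by (intro AE_I2) simp
qed measurable

lemma integrable_square_add:
  fixes f g :: "'a \<Rightarrow> real"
  assumes [measurable]: "f \<in> borel_measurable M" "g \<in> borel_measurable M"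
    and "integrable M (\<lambda>x. (f x)\<^sup>2)" "integrable M (\<lambda>x. (g x)\<^sup>2)"
  shows "integrable M (\<lambda>x. (f x + g x)\<^sup>2)"
  using assms integrable_mult_of_squares[OF assms] by (simp add: power2_sum mult.assoc)

locale white_noise = prob_space P for P :: "'a measure" +
  fixes \<xi> :: "int \<Rightarrow> 'a \<Rightarrow> real"
  assumes indep: "indep_vars (\<lambda>_. borel) \<xi> UNIV"
    and same: "distr P borel (\<xi> j) = distr P borel (\<xi> k)"
    and int1: "integrable P (\<xi> k)"
    and int2: "integrable P (\<lambda>\<omega>. (\<xi> k \<omega>)\<^sup>2)"
    and mean: "expectation (\<xi> k) = 0"
    and second: "expectation (\<lambda>\<omega>. (\<xi> k \<omega>)\<^sup>2) = 1"
begin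

lemma rv_noise[measurable]: "\<xi> k \<in> borel_measurable P"
  using indep by (auto simp: indep_vars_def)

definition fsum :: "(int \<Rightarrow> real) \<Rightarrow> int set \<Rightarrow> 'a \<Rightarrow> real" where
  "fsum b F \<omega> = (\<Sum>k\<in>F. b k * \<xi> k \<omega>)"

lemma fsum_measurable[measurable]: "fsum b F \<in> borel_measurable P"
  unfolding fsum_def by measurable

abbreviation lin :: "(int \<Rightarrow> real) \<Rightarrow> ('a \<Rightarrow> real) \<Rightarrow> bool" where
  "lin b Y \<equiv> has_L2_sum P (\<lambda>k \<omega>. b k * \<xi> k \<omega>) Y UNIV"

lemma linD: "lin b Y \<Longrightarrow> Y \<in> borel_measurable P"
  by (simp add: has_L2_sum_def)

lemma lin_tendsto:
  "lin b Y \<Longrightarrow> ((\<lambda>F. \<integral>\<^sup>+\<omega>. ennreal ((Y \<omega> - fsum b F \<omega>)\<^sup>2) \<partial>P) \<longlongrightarrow> 0) (finite_subsets_at_top UNIV)"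
  by (simp add: has_L2_sum_def fsum_def)

lemma lin_zero: "lin (\<lambda>_. 0) (\<lambda>_. 0)"
  by (simp add: has_L2_sum_def)

lemma lin_cmult:
  assumes "lin b Y"
  shows "lin (\<lambda>k. c * b k) (\<lambda>\<omega>. c * Y \<omega>)"
proof -
  note [measurable] = linD[OF assms]
  have "(\<integral>\<^sup>+\<omega>. ennreal ((c * Y \<omega> - fsum (\<lambda>k. c * b k) F \<omega>)\<^sup>2) \<partial>P)
    = ennreal (c\<^sup>2) * (\<integral>\<^sup>+\<omega>. ennreal ((Y \<omega> - fsum b F \<omega>)\<^sup>2) \<partial>P)" for F
  proof -
    have "(\<integral>\<^sup>+\<omega>. ennreal ((c * Y \<omega> - fsum (\<lambda>k. c * b k) F \<omega>)\<^sup>2) \<partial>P)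
      = (\<integral>\<^sup>+\<omega>. ennreal (c\<^sup>2) * ennreal ((Y \<omega> - fsum b F \<omega>)\<^sup>2) \<partial>P)"
    proof (rule nn_integral_cong)
      fix \<omega>
      have "c * Y \<omega> - fsum (\<lambda>k. c * b k) F \<omega> = c * (Y \<omega> - fsum b F \<omega>)"
        by (simp add: fsum_def right_diff_distrib sum_distrib_left mult.assoc)
      then show "ennreal ((c * Y \<omega> - fsum (\<lambda>k. c * b k) F \<omega>)\<^sup>2) = ennreal (c\<^sup>2) * ennreal ((Y \<omega> - fsum b F \<omega>)\<^sup>2)"
        by (simp add: power_mult_distrib ennreal_mult)
    qed
    then show ?thesis by (simp add: nn_integral_cmult)
  qed
  moreover have "((\<lambda>F. ennreal (c\<^sup>2) * (\<integral>\<^sup>+\<omega>. ennreal ((Y \<omega> - fsum b F \<omega>)\<^sup>2) \<partial>P)) \<longlongrightarrow> ennreal (c\<^sup>2) * 0) (finite_subsets_at_top UNIV)"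
    by (intro ennreal_tendsto_cmult lin_tendsto assms) simp
  ultimately show ?thesis unfolding has_L2_sum_def by (simp add: fsum_def)
qed

lemma lin_add:
  assumes "lin b Y" "lin c Z"
  shows "lin (\<lambda>k. b k + c k) (\<lambda>\<omega>. Y \<omega> + Z \<omega>)"
proof -
  note [measurable] = linD[OF assms(1)] linD[OF assms(2)]
  let ?U = "\<lambda>F. \<integral>\<^sup>+\<omega>. ennreal ((Y \<omega> - fsum b F \<omega>)\<^sup>2) \<partial>P"
  let ?V = "\<lambda>F. \<integral>\<^sup>+\<omega>. ennreal ((Z \<omega> - fsum c F \<omega>)\<^sup>2) \<partial>P"
  have le: "(\<integral>\<^sup>+\<omega>. ennreal ((Y \<omega> + Z \<omega> - fsum (\<lambda>k. b k + c k) F \<omega>)\<^sup>2) \<partial>P) \<le> 2 * ?U F + 2 * ?V F" for F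
  proof -
    have "(\<integral>\<^sup>+\<omega>. ennreal ((Y \<omega> + Z \<omega> - fsum (\<lambda>k. b k + c k) F \<omega>)\<^sup>2) \<partial>P)
      \<le> (\<integral>\<^sup>+\<omega>. 2 * ennreal ((Y \<omega> - fsum b F \<omega>)\<^sup>2) + 2 * ennreal ((Z \<omega> - fsum c F \<omega>)\<^sup>2) \<partial>P)"
    proof (rule nn_integral_mono)
      fix \<omega>
      define u v where "u = Y \<omega> - fsum b F \<omega>" and "v = Z \<omega> - fsum c F \<omega>"
      have "Y \<omega> + Z \<omega> - fsum (\<lambda>k. b k + c k) F \<omega> = u + v"
        by (simp add: u_def v_def fsum_def distrib_right sum.distrib)
      moreover have "(u + v)\<^sup>2 \<le> 2 * u\<^sup>2 + 2 * v\<^sup>2"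
        using zero_le_power2[of "u - v"] by (simp add: power2_sum power2_diff)
      ultimately have "(Y \<omega> + Z \<omega> - fsum (\<lambda>k. b k + c k) F \<omega>)\<^sup>2 \<le> 2 * u\<^sup>2 + 2 * v\<^sup>2"
        by simp
      then have "ennreal ((Y \<omega> + Z \<omega> - fsum (\<lambda>k. b k + c k) F \<omega>)\<^sup>2) \<le> ennreal (2 * u\<^sup>2 + 2 * v\<^sup>2)"
        by (rule ennreal_leI)
      also have "\<dots> = 2 * ennreal (u\<^sup>2) + 2 * ennreal (v\<^sup>2)"
        by (simp add: ennreal_plus ennreal_mult)
      finally show "ennreal ((Y \<omega> + Z \<omega> - fsum (\<lambda>k. b k + c k) F \<omega>)\<^sup>2)
        \<le> 2 * ennreal ((Y \<omega> - fsum b F \<omega>)\<^sup>2) + 2 * ennreal ((Z \<omega> - fsum c F \<omega>)\<^sup>2)"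
        by (simp add: u_def v_def)
    qed
    also have "\<dots> = 2 * ?U F + 2 * ?V F"
      by (simp add: nn_integral_add nn_integral_cmult)
    finally show ?thesis .
  qed
  have "((\<lambda>F. 2 * ?U F + 2 * ?V F) \<longlongrightarrow> 2 * 0 + 2 * 0) (finite_subsets_at_top UNIV)"
    by (intro tendsto_add ennreal_tendsto_cmult lin_tendsto assms) auto
  then have "((\<lambda>F. 2 * ?U F + 2 * ?V F) \<longlongrightarrow> 0) (finite_subsets_at_top UNIV)" by simp
  then have "((\<lambda>F. \<integral>\<^sup>+\<omega>. ennreal ((Y \<omega> + Z \<omega> - fsum (\<lambda>k. b k + c k) F \<omega>)\<^sup>2) \<partial>P) \<longlongrightarrow> 0) (finite_subsets_at_top UNIV)"
    by (rule tendsto_sandwich[OF _ _ tendsto_const, rotated 2]) (auto intro!: always_eventually le)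
  then show ?thesis unfolding has_L2_sum_def by (simp add: fsum_def)
qed

lemma lin_sum:
  assumes "\<And>i. i \<in> J \<Longrightarrow> lin (b i) (Y i)"
  shows "lin (\<lambda>k. \<Sum>i\<in>J. c i * b i k) (\<lambda>\<omega>. \<Sum>i\<in>J. c i * Y i \<omega>)"
  using assms
proof (induction J rule: infinite_finite_induct)
  case (insert i J)
  then show ?case using lin_add[OF lin_cmult[of "b i" "Y i" "c i"], of "\<lambda>k. \<Sum>i\<in>J. c i * b i k"]
    by simp
qed (use lin_zero in simp_all)

lemma lin_diff:
  assumes "lin b Y" "lin c Z"
  shows "lin (\<lambda>k. b k - c k) (\<lambda>\<omega>. Y \<omega> - Z \<omega>)"
  using lin_add[OF assms(1) lin_cmult[OF assms(2), of "-1"]] by simp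

lemma square_integrable_fsum: "integrable P (\<lambda>\<omega>. (fsum b F \<omega>)\<^sup>2)"
proof (induction F rule: infinite_finite_induct)
  case (insert i F)
  have "integrable P (\<lambda>\<omega>. (b i * \<xi> i \<omega>)\<^sup>2)" using int2 by (simp add: power_mult_distrib)
  then have "integrable P (\<lambda>\<omega>. (b i * \<xi> i \<omega> + fsum b F \<omega>)\<^sup>2)"
    using insert by (intro integrable_square_add) auto
  then show ?case using insert by (simp add: fsum_def)
qed (simp_all add: fsum_def)

lemma expectation_product: "integrable P (\<lambda>\<omega>. \<xi> k \<omega> * \<xi> l \<omega>)"
  "expectation (\<lambda>\<omega>. \<xi> k \<omega> * \<xi> l \<omega>) = (if k = l then 1 else 0)"
proof -
  show "integrable P (\<lambda>\<omega>. \<xi> k \<omega> * \<xi> l \<omega>)"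
    by (intro integrable_mult_of_squares int2) auto
  show "expectation (\<lambda>\<omega>. \<xi> k \<omega> * \<xi> l \<omega>) = (if k = l then 1 else 0)"
  proof (cases "k = l")
    case True
    then show ?thesis using second by (simp add: power2_eq_square)
  next
    case False
    have "indep_vars (\<lambda>_. borel) \<xi> {k, l}" by (rule indep_vars_subset[OF indep]) auto
    from indep_vars_sum[of "{l}" k, simplified, OF _ this] False
    have "indep_var borel (\<xi> k) borel (\<xi> l)" by simp
    from indep_var_lebesgue_integral[OF this int1 int1] show ?thesis using False mean by simp
  qed
qed

lemma fsum_moments:
  shows "integrable P (fsum b F)" "expectation (fsum b F) = 0"
    "expectation (\<lambda>\<omega>. (fsum b F \<omega>)\<^sup>2) = (\<Sum>k\<in>F. (b k)\<^sup>2)"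
proof -
  show "integrable P (fsum b F)"
    by (rule square_integrable_imp_integrable[OF _ square_integrable_fsum]) simp
  show "expectation (fsum b F) = 0"
    unfolding fsum_def using int1 mean by simp
  show "expectation (\<lambda>\<omega>. (fsum b F \<omega>)\<^sup>2) = (\<Sum>k\<in>F. (b k)\<^sup>2)"
  proof (cases "finite F")
    case True
    have "(fsum b F \<omega>)\<^sup>2 = (\<Sum>k\<in>F. \<Sum>l\<in>F. b k * b l * (\<xi> k \<omega> * \<xi> l \<omega>))" for \<omega>
      by (simp add: fsum_def power2_eq_square sum_product mult_ac)
    then have "expectation (\<lambda>\<omega>. (fsum b F \<omega>)\<^sup>2) = (\<Sum>k\<in>F. \<Sum>l\<in>F. b k * b l * (if k = l then 1 else 0))"
      using expectation_product by (simp add: Bochner_Integration.integrable_sum)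
    also have "\<dots> = (\<Sum>k\<in>F. (b k)\<^sup>2)"
      using True by (simp add: if_distrib[of "(*) _"] sum.delta power2_eq_square cong: if_cong)
    finally show ?thesis .
  qed (simp add: fsum_def)
qed

definition l2err :: "(int \<Rightarrow> real) \<Rightarrow> ('a \<Rightarrow> real) \<Rightarrow> int set \<Rightarrow> real" where
  "l2err b Y F = expectation (\<lambda>\<omega>. (Y \<omega> - fsum b F \<omega>)\<^sup>2)"

lemma lin_square_integrable:
  assumes "lin b Y"
  shows "integrable P (\<lambda>\<omega>. (Y \<omega>)\<^sup>2)" "integrable P (\<lambda>\<omega>. (Y \<omega> - fsum b F \<omega>)\<^sup>2)"
proof -
  note [measurable] = linD[OF assms]
  have "\<forall>\<^sub>F F in finite_subsets_at_top UNIV. (\<integral>\<^sup>+\<omega>. ennreal ((Y \<omega> - fsum b F \<omega>)\<^sup>2) \<partial>P) < 1"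
    using order_tendstoD(2)[OF lin_tendsto[OF assms]] by simp
  then obtain F0 where "(\<integral>\<^sup>+\<omega>. ennreal ((Y \<omega> - fsum b F0 \<omega>)\<^sup>2) \<partial>P) < 1"
    using eventually_happens' by (force simp: eventually_finite_subsets_at_top)
  then have "integrable P (\<lambda>\<omega>. (Y \<omega> - fsum b F0 \<omega>)\<^sup>2)"
    by (intro integrableI_nonneg) (auto intro: less_trans)
  from integrable_square_add[OF _ _ this square_integrable_fsum[of b F0]]
  show Y2: "integrable P (\<lambda>\<omega>. (Y \<omega>)\<^sup>2)" by simp
  have "integrable P (\<lambda>\<omega>. (- fsum b F \<omega>)\<^sup>2)" using square_integrable_fsum by simp
  from integrable_square_add[OF _ _ Y2 this]
  show "integrable P (\<lambda>\<omega>. (Y \<omega> - fsum b F \<omega>)\<^sup>2)" by simp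
qed

lemma l2err_nonneg: "l2err b Y F \<ge> 0" by (simp add: l2err_def)

lemma l2err_tendsto:
  assumes "lin b Y"
  shows "(l2err b Y \<longlongrightarrow> 0) (finite_subsets_at_top UNIV)"
proof -
  have "(\<integral>\<^sup>+\<omega>. ennreal ((Y \<omega> - fsum b F \<omega>)\<^sup>2) \<partial>P) = ennreal (l2err b Y F)" for F
    unfolding l2err_def by (rule nn_integral_eq_integral[OF lin_square_integrable(2)[OF assms]]) simp
  then have "((\<lambda>F. ennreal (l2err b Y F)) \<longlongrightarrow> ennreal 0) (finite_subsets_at_top UNIV)"
    using lin_tendsto[OF assms] by simp
  then show ?thesis by (subst (asm) tendsto_ennreal_iff) (auto simp: l2err_nonneg)
qed

lemma expectation_square_ge:
  fixes f :: "'a \<Rightarrow> real"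
  assumes "integrable P (\<lambda>\<omega>. (f \<omega>)\<^sup>2)" and [measurable]: "f \<in> borel_measurable P"
  shows "(expectation f)\<^sup>2 \<le> expectation (\<lambda>\<omega>. (f \<omega>)\<^sup>2)"
  using variance_positive[of f] variance_eq[OF square_integrable_imp_integrable[OF _ assms(1)] assms(1)]
  by simp

lemma lin_integrable: "lin b Y \<Longrightarrow> integrable P Y"
  by (rule square_integrable_imp_integrable[OF linD lin_square_integrable(1)])

lemma lin_mean:
  assumes "lin b Y"
  shows "expectation Y = 0"
proof -
  note [measurable] = linD[OF assms]
  have "(expectation Y)\<^sup>2 \<le> l2err b Y F" for F
  proof -
    have "(expectation (\<lambda>\<omega>. Y \<omega> - fsum b F \<omega>))\<^sup>2 \<le> l2err b Y F"
      unfolding l2err_def using lin_square_integrable[OF assms] by (intro expectation_square_ge) auto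
    then show ?thesis using lin_integrable[OF assms] fsum_moments by simp
  qed
  then have "(expectation Y)\<^sup>2 \<le> 0"
    by (intro tendsto_lowerbound[OF l2err_tendsto[OF assms]] always_eventually) auto
  then show ?thesis by simp
qed

lemma lin_second_moment:
  assumes "lin b Y"
  shows "((\<lambda>k. (b k)\<^sup>2) has_sum expectation (\<lambda>\<omega>. (Y \<omega>)\<^sup>2)) UNIV"
  unfolding has_sum_def
proof (rule tendstoI)
  fix e :: real assume e: "e > 0"
  note [measurable] = linD[OF assms]
  define V where "V = expectation (\<lambda>\<omega>. (Y \<omega>)\<^sup>2)"
  have V: "V \<ge> 0" by (simp add: V_def)
  define \<eta> where "\<eta> = e / (2 * (V + 1))"
  have \<eta>: "\<eta> > 0" using e V by (simp add: \<eta>_def)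
  have \<eta>V: "\<eta> * V \<le> e / 2" using e V by (simp add: \<eta>_def field_simps)
  have ptw: "\<bar>y\<^sup>2 - f\<^sup>2\<bar> \<le> \<eta> * y\<^sup>2 + (1 / \<eta> + 1) * (y - f)\<^sup>2" for y f :: real
  proof -
    define w where "w = y - f"
    have f: "f = y - w" by (simp add: w_def)
    have "0 \<le> (\<eta> * \<bar>y\<bar> - \<bar>w\<bar>)\<^sup>2 / \<eta>" using \<eta> by simp
    also have "\<dots> = \<eta> * y\<^sup>2 + w\<^sup>2 / \<eta> - 2 * \<bar>y * w\<bar>"
      using \<eta> by (simp add: power2_diff power_mult_distrib abs_mult field_simps power2_eq_square)
    finally have 1: "2 * \<bar>y * w\<bar> \<le> \<eta> * y\<^sup>2 + w\<^sup>2 / \<eta>" by simp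
    have "y\<^sup>2 - f\<^sup>2 = 2 * (y * w) - w\<^sup>2" by (simp add: f power2_diff)
    then have "\<bar>y\<^sup>2 - f\<^sup>2\<bar> \<le> 2 * \<bar>y * w\<bar> + w\<^sup>2"
      using zero_le_power2[of w] by linarith
    then show ?thesis using 1 by (simp add: w_def algebra_simps)
  qed
  have bound: "\<bar>V - (\<Sum>k\<in>F. (b k)\<^sup>2)\<bar> \<le> e / 2 + (1 / \<eta> + 1) * l2err b Y F" for F
  proof -
    have "\<bar>V - (\<Sum>k\<in>F. (b k)\<^sup>2)\<bar> = \<bar>expectation (\<lambda>\<omega>. (Y \<omega>)\<^sup>2 - (fsum b F \<omega>)\<^sup>2)\<bar>"
      using lin_square_integrable[OF assms] square_integrable_fsum
      by (simp add: fsum_moments V_def)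
    also have "\<dots> \<le> expectation (\<lambda>\<omega>. \<bar>(Y \<omega>)\<^sup>2 - (fsum b F \<omega>)\<^sup>2\<bar>)" by (rule integral_abs_bound)
    also have "\<dots> \<le> expectation (\<lambda>\<omega>. \<eta> * (Y \<omega>)\<^sup>2 + (1 / \<eta> + 1) * (Y \<omega> - fsum b F \<omega>)\<^sup>2)"
      using lin_square_integrable[OF assms] square_integrable_fsum ptw
      by (intro integral_mono) auto
    also have "\<dots> = \<eta> * V + (1 / \<eta> + 1) * l2err b Y F"
      using lin_square_integrable[OF assms] by (simp add: V_def l2err_def)
    finally show ?thesis using \<eta>V by linarith
  qed
  have "((\<lambda>F. e / 2 + (1 / \<eta> + 1) * l2err b Y F) \<longlongrightarrow> e / 2 + (1 / \<eta> + 1) * 0) (finite_subsets_at_top UNIV)"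
    by (intro tendsto_intros l2err_tendsto assms)
  then have "\<forall>\<^sub>F F in finite_subsets_at_top UNIV. e / 2 + (1 / \<eta> + 1) * l2err b Y F < e"
    using e by (intro order_tendstoD(2)[of _ "e / 2"]) auto
  then show "\<forall>\<^sub>F F in finite_subsets_at_top UNIV. dist (\<Sum>k\<in>F. (b k)\<^sup>2) (expectation (\<lambda>\<omega>. (Y \<omega>)\<^sup>2)) < e"
  proof eventually_elim
    case (elim F)
    then show ?case using bound[of F] by (simp add: dist_real_def V_def abs_minus_commute)
  qed
qed

lemma lin_coeff_bound:
  assumes "lin b Y"  and "finite F"
  shows "(\<Sum>k\<in>F. (b k)\<^sup>2) \<le> expectation (\<lambda>\<omega>. (Y \<omega>)\<^sup>2)"
  using has_sum_mono_neutral[OF has_sum_finite[OF assms(2), of "\<lambda>k. (b k)\<^sup>2"] lin_second_moment[OF assms(1)]] by simp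

lemma lin_norm_triangle:
  assumes "lin b Y" "lin c Z"
  shows "sqrt (expectation (\<lambda>\<omega>. (Y \<omega> + Z \<omega>)\<^sup>2)) \<le>
    sqrt (expectation (\<lambda>\<omega>. (Y \<omega>)\<^sup>2)) + sqrt (expectation (\<lambda>\<omega>. (Z \<omega>)\<^sup>2))"
proof (rule tendsto_le)
  show "((\<lambda>F. L2_set (\<lambda>k. b k + c k) F) \<longlongrightarrow> sqrt (expectation (\<lambda>\<omega>. (Y \<omega> + Z \<omega>)\<^sup>2))) (finite_subsets_at_top UNIV)"
    using lin_second_moment[OF lin_add[OF assms]] unfolding L2_set_def has_sum_def by (rule tendsto_real_sqrt)
  show "((\<lambda>F. L2_set b F + L2_set c F) \<longlongrightarrow>
      sqrt (expectation (\<lambda>\<omega>. (Y \<omega>)\<^sup>2)) + sqrt (expectation (\<lambda>\<omega>. (Z \<omega>)\<^sup>2))) (finite_subsets_at_top UNIV)"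
    using lin_second_moment[OF assms(1)] lin_second_moment[OF assms(2)]
    unfolding L2_set_def has_sum_def by (intro tendsto_intros)
qed (auto intro!: always_eventually L2_set_triangle_ineq)

lemma lin_tail_bound:
  assumes \<alpha>: "\<alpha> \<ge> 2" and mom: "\<And>k. integrable P (\<lambda>\<omega>. \<bar>\<xi> k \<omega>\<bar> powr \<alpha>)"
    and K0: "K \<ge> 0" and K: "\<And>F b. finite F \<Longrightarrow> integrable P (\<lambda>\<omega>. \<bar>fsum b F \<omega>\<bar> powr \<alpha>) \<and>
      expectation (\<lambda>\<omega>. \<bar>fsum b F \<omega>\<bar> powr \<alpha>) \<le> K * (\<Sum>k\<in>F. (b k)\<^sup>2) powr (\<alpha> / 2)"
    and Y: "lin b Y" and x: "x > 0"
  shows "prob {\<omega>\<in>space P. \<bar>Y \<omega>\<bar> \<ge> x} \<le> K * 2 powr \<alpha> * (expectation (\<lambda>\<omega>. (Y \<omega>)\<^sup>2)) powr (\<alpha> / 2) / x powr \<alpha>"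
proof -
  note [measurable] = linD[OF Y]
  have "prob {\<omega>\<in>space P. \<bar>Y \<omega>\<bar> \<ge> x} \<le> K * (\<Sum>k\<in>F. (b k)\<^sup>2) powr (\<alpha> / 2) / (x / 2) powr \<alpha> + l2err b Y F / (x / 2)\<^sup>2"
    if F: "finite F" for F
  proof -
    have "prob {\<omega>\<in>space P. \<bar>Y \<omega>\<bar> \<ge> x} \<le> prob ({\<omega>\<in>space P. (x / 2) powr \<alpha> \<le> \<bar>fsum b F \<omega>\<bar> powr \<alpha>} \<union> {\<omega>\<in>space P. (x / 2)\<^sup>2 \<le> (Y \<omega> - fsum b F \<omega>)\<^sup>2})"
    proof (rule finite_measure_mono)
      show "{\<omega> \<in> space P. x \<le> \<bar>Y \<omega>\<bar>} \<subseteq> {\<omega>\<in>space P. (x / 2) powr \<alpha> \<le> \<bar>fsum b F \<omega>\<bar> powr \<alpha>} \<union> {\<omega>\<in>space P. (x / 2)\<^sup>2 \<le> (Y \<omega> - fsum b F \<omega>)\<^sup>2}"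
      proof safe
        fix \<omega> assume 1: "x \<le> \<bar>Y \<omega>\<bar>" and 2: "\<not> (x / 2)\<^sup>2 \<le> (Y \<omega> - fsum b F \<omega>)\<^sup>2"
        have "\<bar>Y \<omega> - fsum b F \<omega>\<bar> < x / 2"
          using 2 x by (metis abs_le_square_iff abs_of_pos half_gt_zero not_le)
        then have "x / 2 \<le> \<bar>fsum b F \<omega>\<bar>" using 1 by linarith
        then show "(x / 2) powr \<alpha> \<le> \<bar>fsum b F \<omega>\<bar> powr \<alpha>" using x \<alpha> by (intro powr_mono2) auto
      qed
    qed measurable
    also have "\<dots> \<le> prob {\<omega>\<in>space P. (x / 2) powr \<alpha> \<le> \<bar>fsum b F \<omega>\<bar> powr \<alpha>} + prob {\<omega>\<in>space P. (x / 2)\<^sup>2 \<le> (Y \<omega> - fsum b F \<omega>)\<^sup>2}"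
      by (rule measure_Un_le) measurable
    also have "\<dots> \<le> expectation (\<lambda>\<omega>. \<bar>fsum b F \<omega>\<bar> powr \<alpha>) / (x / 2) powr \<alpha> + l2err b Y F / (x / 2)\<^sup>2"
      unfolding l2err_def using K[OF F, of b] lin_square_integrable[OF Y] x
      by (intro add_mono integral_Markov_inequality_measure[where A = "{}"]) auto
    also have "\<dots> \<le> K * (\<Sum>k\<in>F. (b k)\<^sup>2) powr (\<alpha> / 2) / (x / 2) powr \<alpha> + l2err b Y F / (x / 2)\<^sup>2"
      using K[OF F, of b] x by (intro add_mono divide_right_mono) auto
    finally show ?thesis .
  qed
  then have ev: "\<forall>\<^sub>F F in finite_subsets_at_top UNIV. prob {\<omega>\<in>space P. \<bar>Y \<omega>\<bar> \<ge> x} \<le>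
      K * (\<Sum>k\<in>F. (b k)\<^sup>2) powr (\<alpha> / 2) / (x / 2) powr \<alpha> + l2err b Y F / (x / 2)\<^sup>2"
    by (intro eventually_finite_subsets_at_top_weakI) auto
  have "((\<lambda>F. K * (\<Sum>k\<in>F. (b k)\<^sup>2) powr (\<alpha> / 2) / (x / 2) powr \<alpha> + l2err b Y F / (x / 2)\<^sup>2) \<longlongrightarrow>
    K * (expectation (\<lambda>\<omega>. (Y \<omega>)\<^sup>2)) powr (\<alpha> / 2) / (x / 2) powr \<alpha> + 0 / (x / 2)\<^sup>2) (finite_subsets_at_top UNIV)"
    using lin_second_moment[OF Y] \<alpha> x unfolding has_sum_def
    by (intro tendsto_intros tendsto_powr' l2err_tendsto[OF Y]) (auto intro!: always_eventually sum_nonneg)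
  from tendsto_lowerbound[OF this ev] show ?thesis
    using x by (simp add: powr_divide mult_ac)
qed

lemma char_approx_gauss:
  assumes "e > 0"
  shows "\<exists>d>0. \<forall>u. \<bar>u\<bar> \<le> d \<longrightarrow> cmod (char (distr P borel (\<xi> k)) u - exp (- (u\<^sup>2 / 2))) \<le> e * u\<^sup>2"
proof -
  define g where "g t = expectation (\<lambda>\<omega>. min (6 * (\<xi> k \<omega>)\<^sup>2) (\<bar>t\<bar> * \<bar>\<xi> k \<omega>\<bar> ^ 3))" for t
  have ig: "integrable P (\<lambda>\<omega>. min (6 * (\<xi> k \<omega>)\<^sup>2) (\<bar>t\<bar> * \<bar>\<xi> k \<omega>\<bar> ^ 3))" for t
    by (rule Bochner_Integration.integrable_bound[where f = "\<lambda>\<omega>. 6 * (\<xi> k \<omega>)\<^sup>2"]) (use int2 in \<open>auto intro!: AE_I2\<close>)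
  have gmono: "g t \<le> g s" if "\<bar>t\<bar> \<le> \<bar>s\<bar>" for t s
    unfolding g_def using that
    by (intro integral_mono ig min.mono mult_right_mono) auto
  have "(\<lambda>n. g (1 / real (Suc n))) \<longlonglongrightarrow> expectation (\<lambda>\<omega>. min (6 * (\<xi> k \<omega>)\<^sup>2) (0 * \<bar>\<xi> k \<omega>\<bar> ^ 3))"
    unfolding g_def
  proof (rule integral_dominated_convergence[where w = "\<lambda>\<omega>. 6 * (\<xi> k \<omega>)\<^sup>2"])
    have "(\<lambda>n. \<bar>1 / real (Suc n)\<bar>) \<longlonglongrightarrow> 0"
      using lim_inverse_n' LIMSEQ_Suc[OF lim_inverse_n'] by (intro tendsto_rabs_zero) (simp add: inverse_eq_divide)
    then show "AE \<omega> in P. (\<lambda>n. min (6 * (\<xi> k \<omega>)\<^sup>2) (\<bar>1 / real (Suc n)\<bar> * \<bar>\<xi> k \<omega>\<bar> ^ 3)) \<longlonglongrightarrow> min (6 * (\<xi> k \<omega>)\<^sup>2) (0 * \<bar>\<xi> k \<omega>\<bar> ^ 3)"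
      by (intro AE_I2 tendsto_intros)
  qed (use int2 in \<open>auto intro!: AE_I2\<close>)
  then have "(\<lambda>n. g (1 / real (Suc n))) \<longlonglongrightarrow> 0" by simp
  then have "\<forall>\<^sub>F n in sequentially. g (1 / real (Suc n)) < e" using assms by (rule order_tendstoD)
  then obtain n where n: "g (1 / real (Suc n)) < e" by (auto simp: eventually_sequentially)
  define d where "d = min (1 / real (Suc n)) (sqrt e)"
  have d: "d > 0" "d \<le> 1 / real (Suc n)" "d\<^sup>2 \<le> e"
  proof -
    show "d > 0" using assms by (simp add: d_def)
    then have "d\<^sup>2 \<le> (sqrt e)\<^sup>2" by (intro power_mono) (auto simp: d_def)
    then show "d\<^sup>2 \<le> e" using assms by simp
  qed (auto simp: d_def)
  have "cmod (char (distr P borel (\<xi> k)) u - exp (- (u\<^sup>2 / 2))) \<le> e * u\<^sup>2" if u: "\<bar>u\<bar> \<le> d" for u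
  proof -
    have 1: "cmod (char (distr P borel (\<xi> k)) u - (1 - u\<^sup>2 / 2)) \<le> e * u\<^sup>2 / 6"
    proof -
      have "cmod (char (distr P borel (\<xi> k)) u - (1 - u\<^sup>2 * 1 / 2)) \<le> u\<^sup>2 / 6 * g u"
        unfolding g_def using int1 int2 mean second by (intro char_approx3') auto
      also have "\<dots> \<le> u\<^sup>2 / 6 * e"
      proof (rule mult_left_mono)
        have "g u \<le> g (1 / real (Suc n))" using u d by (intro gmono) simp
        then show "g u \<le> e" using n by simp
      qed simp
      finally show ?thesis by (simp add: mult.commute)
    qed
    have 2: "cmod (of_real (1 - u\<^sup>2 / 2) - of_real (exp (- (u\<^sup>2 / 2)))) \<le> e * u\<^sup>2 / 8"
    proof -
      define x where "x = u\<^sup>2 / 2"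
      have x: "x \<ge> 0" by (simp add: x_def)
      have low: "1 - x \<le> exp (- x)" by (rule exp_minus_ge)
      have up: "exp (- x) \<le> 1 - x + x\<^sup>2 / 2"
      proof -
        have "1 + x + x\<^sup>2 / 2 \<le> exp x" using exp_lower_Taylor_quadratic[OF x] by (simp add: power2_eq_square)
        then have "exp (- x) * (1 + x + x\<^sup>2 / 2) \<le> exp (- x) * exp x" by (intro mult_left_mono) auto
        then have a: "exp (- x) * (1 + x + x\<^sup>2 / 2) \<le> 1" by (simp add: exp_minus)
        have "(1 - x + x\<^sup>2 / 2) * (1 + x + x\<^sup>2 / 2) = 1 + x ^ 4 / 4"
          by (simp add: algebra_simps power2_eq_square power4_eq_xxxx)
        then have "exp (- x) * (1 + x + x\<^sup>2 / 2) \<le> (1 - x + x\<^sup>2 / 2) * (1 + x + x\<^sup>2 / 2)"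
          using a zero_le_power[OF x, of 4] by linarith
        moreover have "1 + x + x\<^sup>2 / 2 > 0" using x by (smt (verit) zero_le_power2 divide_nonneg_pos)
        ultimately show ?thesis by (simp add: mult_le_cancel_right)
      qed
      have "cmod (of_real (1 - u\<^sup>2 / 2) - of_real (exp (- (u\<^sup>2 / 2)))) = \<bar>(1 - x) - exp (- x)\<bar>"
        unfolding x_def of_real_diff[symmetric] norm_of_real ..
      also have "\<dots> \<le> x\<^sup>2 / 2" using low up by simp
      also have "\<dots> = u\<^sup>2 * u\<^sup>2 / 8" by (simp add: x_def power2_eq_square)
      also have "\<dots> \<le> e * u\<^sup>2 / 8"
      proof -
        have "u\<^sup>2 \<le> e" using u d(3) abs_le_square_iff[of u d] d(1) by simp
        then show ?thesis by (intro divide_right_mono mult_right_mono) auto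
      qed
      finally show ?thesis .
    qed
    have "cmod (char (distr P borel (\<xi> k)) u - exp (- (u\<^sup>2 / 2))) \<le> e * u\<^sup>2 / 6 + e * u\<^sup>2 / 8"
      using norm_triangle_le[OF add_mono[OF 1 2]] by simp
    also have "\<dots> \<le> e * u\<^sup>2" using assms by simp
    finally show ?thesis .
  qed
  then show ?thesis using d by blast
qed

lemma cmod_iexp_diff: "cmod (iexp x - iexp y) \<le> \<bar>x - y\<bar>"
proof -
  have "iexp x - iexp y = iexp y * (iexp (x - y) - 1)"
  proof -
    have "iexp x = iexp y * iexp (x - y)" by (simp add: exp_add[symmetric] algebra_simps)
    then show ?thesis by (simp add: right_diff_distrib)
  qed
  then have "cmod (iexp x - iexp y) = cmod (iexp (x - y) - 1)" by (simp add: norm_mult)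
  also have "\<dots> \<le> \<bar>x - y\<bar>" using iexp_approx1[of "x - y" 0] by simp
  finally show ?thesis .
qed

lemma char_distr_diff:
  assumes "integrable P (\<lambda>\<omega>. (Y \<omega> - Z \<omega>)\<^sup>2)" and [measurable]: "Y \<in> borel_measurable P" "Z \<in> borel_measurable P"
  shows "cmod (char (distr P borel Y) 1 - char (distr P borel Z) 1) \<le> sqrt (expectation (\<lambda>\<omega>. (Y \<omega> - Z \<omega>)\<^sup>2))"
proof -
  have i: "integrable P (\<lambda>\<omega>. Y \<omega> - Z \<omega>)" by (rule square_integrable_imp_integrable[OF _ assms(1)]) simp
  have "char (distr P borel Y) 1 - char (distr P borel Z) 1 = (CLINT \<omega>|P. iexp (Y \<omega>) - iexp (Z \<omega>))"
    by (simp add: char_def integral_distr integrable_iexp)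
  also have "cmod \<dots> \<le> expectation (\<lambda>\<omega>. cmod (iexp (Y \<omega>) - iexp (Z \<omega>)))" by (rule integral_norm_bound)
  also have "\<dots> \<le> expectation (\<lambda>\<omega>. \<bar>Y \<omega> - Z \<omega>\<bar>)"
    using i cmod_iexp_diff by (intro integral_mono) (auto simp: integrable_iexp)
  also have "\<dots> \<le> sqrt (expectation (\<lambda>\<omega>. (Y \<omega> - Z \<omega>)\<^sup>2))"
    using expectation_square_ge[of "\<lambda>\<omega>. \<bar>Y \<omega> - Z \<omega>\<bar>"] assms(1) by (intro real_le_rsqrt) simp
  finally show ?thesis .
qed

lemma lin_char_gauss:
  assumes e: "e > 0"
  shows "\<exists>d>0. \<forall>b Y. lin b Y \<and> (\<forall>k. \<bar>b k\<bar> \<le> d) \<longrightarrow>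
    cmod (char (distr P borel Y) 1 - exp (- (expectation (\<lambda>\<omega>. (Y \<omega>)\<^sup>2) / 2))) \<le> e * expectation (\<lambda>\<omega>. (Y \<omega>)\<^sup>2)"
proof -
  define \<phi> where "\<phi> = char (distr P borel (\<xi> 0))"
  have \<phi>: "char (distr P borel (\<xi> k)) = \<phi>" for k using same[of k 0] by (simp add: \<phi>_def)
  obtain d where d: "d > 0" "\<And>u. \<bar>u\<bar> \<le> d \<Longrightarrow> cmod (\<phi> u - exp (- (u\<^sup>2 / 2))) \<le> e * u\<^sup>2"
    using char_approx_gauss[OF e, of 0] unfolding \<phi>_def by blast
  show ?thesis
  proof (intro exI[of _ d] conjI d(1) allI impI, elim conjE)
    fix b Y assume Y: "lin b Y" and b: "\<forall>k. \<bar>b k\<bar> \<le> d"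
    note [measurable] = linD[OF Y]
    define V where "V = expectation (\<lambda>\<omega>. (Y \<omega>)\<^sup>2)"
    have char_fsum: "char (distr P borel (fsum b F)) 1 = (\<Prod>k\<in>F. \<phi> (b k))" for F
    proof -
      have "char (distr P borel (fsum b F)) 1 = (\<Prod>k\<in>F. char (distr P borel (\<lambda>\<omega>. b k * \<xi> k \<omega>)) 1)"
        unfolding fsum_def
      proof (rule char_distr_sum)
        show "indep_vars (\<lambda>_. borel) (\<lambda>k \<omega>. b k * \<xi> k \<omega>) F"
          by (rule indep_vars_compose2[OF indep_vars_subset[OF indep]]) auto
      qed
      also have "\<dots> = (\<Prod>k\<in>F. \<phi> (b k))"
      proof (rule prod.cong[OF refl])
        fix k
        have "char (distr P borel (\<lambda>\<omega>. b k * \<xi> k \<omega>)) 1 = char (distr P borel (\<xi> k)) (b k)"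
          by (simp add: char_def integral_distr)
        then show "char (distr P borel (\<lambda>\<omega>. b k * \<xi> k \<omega>)) 1 = \<phi> (b k)" by (simp add: \<phi>)
      qed
      finally show ?thesis .
    qed
    have fin: "cmod (char (distr P borel Y) 1 - of_real (exp (- ((\<Sum>k\<in>F. (b k)\<^sup>2) / 2))))
      \<le> sqrt (l2err b Y F) + e * (\<Sum>k\<in>F. (b k)\<^sup>2)" if F: "finite F" for F
    proof -
      have 1: "cmod (char (distr P borel Y) 1 - char (distr P borel (fsum b F)) 1) \<le> sqrt (l2err b Y F)"
        unfolding l2err_def by (intro char_distr_diff lin_square_integrable[OF Y]) auto
      have "cmod ((\<Prod>k\<in>F. \<phi> (b k)) - (\<Prod>k\<in>F. of_real (exp (- ((b k)\<^sup>2 / 2))))) \<le> (\<Sum>k\<in>F. cmod (\<phi> (b k) - of_real (exp (- ((b k)\<^sup>2 / 2)))))"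
      proof (rule norm_prod_diff)
        show "cmod (\<phi> (b k)) \<le> 1" for k unfolding \<phi>_def
          by (intro real_distribution.cmod_char_le_1 real_distribution_distr) simp
        show "cmod (of_real (exp (- ((b k)\<^sup>2 / 2)))) \<le> 1" for k by simp
      qed
      also have "\<dots> \<le> (\<Sum>k\<in>F. e * (b k)\<^sup>2)" using d(2) b by (intro sum_mono) auto
      finally have le: "cmod ((\<Prod>k\<in>F. \<phi> (b k)) - (\<Prod>k\<in>F. of_real (exp (- ((b k)\<^sup>2 / 2))))) \<le> e * (\<Sum>k\<in>F. (b k)\<^sup>2)"
        by (simp add: sum_distrib_left)
      have "(\<Prod>k\<in>F. of_real (exp (- ((b k)\<^sup>2 / 2)))) = (of_real (exp (- ((\<Sum>k\<in>F. (b k)\<^sup>2) / 2))) :: complex)"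
        unfolding of_real_prod[symmetric] exp_sum[OF F, symmetric] by (simp add: sum_negf sum_divide_distrib)
      with le have 2: "cmod (char (distr P borel (fsum b F)) 1 - of_real (exp (- ((\<Sum>k\<in>F. (b k)\<^sup>2) / 2)))) \<le> e * (\<Sum>k\<in>F. (b k)\<^sup>2)"
        by (simp only: char_fsum)
      show ?thesis using norm_triangle_le[OF add_mono[OF 1 2]] by simp
    qed
    have sums: "((\<lambda>F. \<Sum>k\<in>F. (b k)\<^sup>2) \<longlongrightarrow> V) (finite_subsets_at_top UNIV)"
      using lin_second_moment[OF Y] unfolding has_sum_def V_def .
    have "cmod (char (distr P borel Y) 1 - of_real (exp (- (V / 2)))) \<le> sqrt 0 + e * V"
    proof (rule tendsto_le[OF _ _ _ eventually_finite_subsets_at_top_weakI])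
      show "((\<lambda>F. sqrt (l2err b Y F) + e * (\<Sum>k\<in>F. (b k)\<^sup>2)) \<longlongrightarrow> sqrt 0 + e * V) (finite_subsets_at_top UNIV)"
        by (intro tendsto_intros sums l2err_tendsto Y)
      show "((\<lambda>F. cmod (char (distr P borel Y) 1 - of_real (exp (- ((\<Sum>k\<in>F. (b k)\<^sup>2) / 2))))) \<longlongrightarrow>
         cmod (char (distr P borel Y) 1 - of_real (exp (- (V / 2))))) (finite_subsets_at_top UNIV)"
        by (intro tendsto_intros sums) auto
    qed (use fin in auto)
    then show "cmod (char (distr P borel Y) 1 - exp (- (expectation (\<lambda>\<omega>. (Y \<omega>)\<^sup>2) / 2))) \<le> e * expectation (\<lambda>\<omega>. (Y \<omega>)\<^sup>2)"
      by (simp add: V_def)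
  qed
qed

end

section \<open>Maximal inequality and modulus of continuity\<close>

lemma (in prob_space) dyadic_maximal_inequality:
  fixes S :: "nat \<Rightarrow> 'a \<Rightarrow> real" and s :: "nat \<Rightarrow> real"
  assumes meas[measurable]: "\<And>k. S k \<in> borel_measurable M"
    and K: "K \<ge> 0"
    and tail: "\<And>a b x. a < b \<Longrightarrow> x > 0 \<Longrightarrow>
      prob {\<omega>\<in>space M. \<bar>S b \<omega> - S a \<omega>\<bar> \<ge> x} \<le> K * s (b - a) powr \<alpha> / x powr \<alpha>"
    and s: "\<And>n. s n \<ge> 0"
    and C: "C \<ge> 0" and \<theta>: "\<theta> > 0" and growth: "\<And>q j. j \<le> q \<Longrightarrow> s (2 ^ j) \<le> C * \<theta> ^ (q - j) * s (2 ^ q)"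
    and \<alpha>: "\<alpha> > 0" and less: "2 * \<theta> powr \<alpha> < 1"
  shows "\<exists>K'\<ge>0. \<forall>q a x. x > 0 \<longrightarrow>
    prob {\<omega>\<in>space M. \<exists>k\<le>2 ^ q. \<bar>S (a + k) \<omega> - S a \<omega>\<bar> \<ge> x} \<le> K' * s (2 ^ q) powr \<alpha> / x powr \<alpha>"
proof -
  define w where "w = sqrt (2 * \<theta> powr \<alpha>)"
  have w: "0 < w" "w < 1" using less \<theta> by (auto simp: w_def)
  have w2: "2 * \<theta> powr \<alpha> = w * w" by (simp add: w_def)
  define \<rho> where "\<rho> = w powr (1 / \<alpha>)"
  have \<rho>: "0 < \<rho>" "\<rho> < 1" using w \<alpha> powr_less_mono2[of "1 / \<alpha>" w 1] by (auto simp: \<rho>_def)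
  have \<rho>\<alpha>: "\<rho> powr \<alpha> = w" using w \<alpha> by (simp add: \<rho>_def powr_powr)
  define \<delta> where "\<delta> r = (1 - \<rho>) * \<rho> ^ r" for r :: nat
  have \<delta>0: "\<delta> r > 0" for r using \<rho> by (simp add: \<delta>_def)
  have \<delta>sum: "(\<Sum>r\<le>n. \<delta> r) < 1" for n
  proof -
    have "(\<Sum>r\<le>n. \<delta> r) = 1 - \<rho> ^ Suc n"
      using \<rho> by (simp add: \<delta>_def sum_distrib_left[symmetric] sum_gp0)
    then show ?thesis using \<rho> by simp
  qed
  define K' where "K' = K * C powr \<alpha> / (1 - \<rho>) powr \<alpha> / (1 - w)"
  have K': "K' \<ge> 0" using K w by (simp add: K'_def)
  show ?thesis
  proof (intro exI[of _ K'] conjI K' allI impI)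
    fix q a :: nat and x :: real assume x: "x > 0"
    define E where "E r = {\<omega>\<in>space M. \<exists>i<2 ^ r. \<bar>S (a + Suc i * 2 ^ (q - r)) \<omega> - S (a + i * 2 ^ (q - r)) \<omega>\<bar> \<ge> x * \<delta> r}" for r
    have E_meas: "E r \<in> sets M" for r unfolding E_def by measurable
    have E_prob: "prob (E r) \<le> (K * C powr \<alpha> / (1 - \<rho>) powr \<alpha> * s (2 ^ q) powr \<alpha> / x powr \<alpha>) * w ^ r" if r: "r \<le> q" for r
    proof -
      have "E r = (\<Union>i<2 ^ r. {\<omega>\<in>space M. \<bar>S (a + Suc i * 2 ^ (q - r)) \<omega> - S (a + i * 2 ^ (q - r)) \<omega>\<bar> \<ge> x * \<delta> r})"
        unfolding E_def by auto
      then have "prob (E r) \<le> (\<Sum>i<2 ^ r. prob {\<omega>\<in>space M. \<bar>S (a + Suc i * 2 ^ (q - r)) \<omega> - S (a + i * 2 ^ (q - r)) \<omega>\<bar> \<ge> x * \<delta> r})"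
        by (simp only:) (rule measure_UNION_le, auto)
      also have "\<dots> \<le> (\<Sum>i<(2::nat) ^ r. K * s (2 ^ (q - r)) powr \<alpha> / (x * \<delta> r) powr \<alpha>)"
      proof (rule sum_mono)
        fix i
        have "a + Suc i * 2 ^ (q - r) - (a + i * 2 ^ (q - r)) = 2 ^ (q - r)" by simp
        then show "prob {\<omega>\<in>space M. \<bar>S (a + Suc i * 2 ^ (q - r)) \<omega> - S (a + i * 2 ^ (q - r)) \<omega>\<bar> \<ge> x * \<delta> r}
          \<le> K * s (2 ^ (q - r)) powr \<alpha> / (x * \<delta> r) powr \<alpha>"
          using tail[of "a + i * 2 ^ (q - r)" "a + Suc i * 2 ^ (q - r)" "x * \<delta> r"] x \<delta>0[of r] by simp
      qed
      also have "\<dots> = 2 ^ r * (K * s (2 ^ (q - r)) powr \<alpha> / (x * \<delta> r) powr \<alpha>)" by simp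
      also have "\<dots> \<le> 2 ^ r * (K * (C * \<theta> ^ r * s (2 ^ q)) powr \<alpha> / (x * \<delta> r) powr \<alpha>)"
        using growth[of "q - r" q] r K s \<alpha>
        by (intro mult_left_mono divide_right_mono powr_mono2) auto
      also have "(C * \<theta> ^ r * s (2 ^ q)) powr \<alpha> = C powr \<alpha> * (\<theta> powr \<alpha>) ^ r * s (2 ^ q) powr \<alpha>"
        using C \<theta> s by (simp add: powr_mult powr_realpow[symmetric] powr_powr mult.commute)
      also have "(x * \<delta> r) powr \<alpha> = x powr \<alpha> * (1 - \<rho>) powr \<alpha> * w ^ r"
        using x \<rho> by (simp add: \<delta>_def powr_mult \<rho>\<alpha>[symmetric] powr_realpow[symmetric] powr_powr mult.commute)
      also have "2 ^ r * (K * (C powr \<alpha> * (\<theta> powr \<alpha>) ^ r * s (2 ^ q) powr \<alpha>) / (x powr \<alpha> * (1 - \<rho>) powr \<alpha> * w ^ r))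
        = (K * C powr \<alpha> / (1 - \<rho>) powr \<alpha> * s (2 ^ q) powr \<alpha> / x powr \<alpha>) * ((2 * \<theta> powr \<alpha>) ^ r / w ^ r)"
        by (simp add: power_mult_distrib mult_ac)
      also have "(2 * \<theta> powr \<alpha>) ^ r / w ^ r = w ^ r"
        using w unfolding w2 by (simp add: power_mult_distrib)
      finally show ?thesis .
    qed
    have incl: "{\<omega>\<in>space M. \<exists>k\<le>2 ^ q. \<bar>S (a + k) \<omega> - S a \<omega>\<bar> \<ge> x} \<subseteq> (\<Union>r\<le>q. E r)"
    proof (rule ccontr)
      assume "\<not> ?thesis"
      then obtain \<omega> k where \<omega>: "\<omega> \<in> space M" and k: "k \<le> 2 ^ q" "\<bar>S (a + k) \<omega> - S a \<omega>\<bar> \<ge> x"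
        and no: "\<And>r. r \<le> q \<Longrightarrow> \<omega> \<notin> E r" by blast
      have small: "\<bar>S (a + Suc i * 2 ^ (q - r)) \<omega> - S (a + i * 2 ^ (q - r)) \<omega>\<bar> \<le> x * \<delta> r"
        if "r \<le> q" "i < 2 ^ r" for r i
        using no[OF that(1)] that(2) \<omega> unfolding E_def by force
      have "\<bar>S (a + i * 2 ^ (q - r)) \<omega> - S a \<omega>\<bar> \<le> x * (\<Sum>l\<le>r. \<delta> l)" if "r \<le> q" "i \<le> 2 ^ r" for r i
        using that
      proof (induction r arbitrary: i)
        case 0
        then have "i = 0 \<or> i = 1" by auto
        then show ?case using small[of 0 0] x \<delta>0[of 0] by auto
      next
        case (Suc r)
        have step: "\<bar>S (a + 2 * i' * 2 ^ (q - Suc r)) \<omega> - S a \<omega>\<bar> \<le> x * (\<Sum>l\<le>r. \<delta> l)" if "i' \<le> 2 ^ r" for i'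
        proof -
          have e: "q - r = Suc (q - Suc r)" using Suc.prems by simp
          have "2 * i' * 2 ^ (q - Suc r) = i' * 2 ^ (q - r)" unfolding e by simp
          then show ?thesis using Suc.IH[of i'] that Suc.prems by (simp only: Suc_leD)
        qed
        show ?case
        proof (cases "even i")
          case True
          then obtain i' where i': "i = 2 * i'" by auto
          then have "\<bar>S (a + i * 2 ^ (q - Suc r)) \<omega> - S a \<omega>\<bar> \<le> x * (\<Sum>l\<le>r. \<delta> l)"
            using step[of i'] Suc.prems by simp
          also have "\<dots> \<le> x * (\<Sum>l\<le>Suc r. \<delta> l)" using x \<delta>0[of "Suc r"] by simp
          finally show ?thesis .
        next
          case False
          then obtain i' where i': "i = Suc (2 * i')" by (metis oddE Suc_eq_plus1)
          then have "i' \<le> 2 ^ r" "2 * i' < 2 ^ Suc r" using Suc.prems by auto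
          then have "\<bar>S (a + 2 * i' * 2 ^ (q - Suc r)) \<omega> - S a \<omega>\<bar> \<le> x * (\<Sum>l\<le>r. \<delta> l)"
            "\<bar>S (a + i * 2 ^ (q - Suc r)) \<omega> - S (a + 2 * i' * 2 ^ (q - Suc r)) \<omega>\<bar> \<le> x * \<delta> (Suc r)"
            using step[of i'] small[of "Suc r" "2 * i'"] Suc.prems i' by auto
          then show ?thesis by (simp add: distrib_left)
        qed
      qed
      from this[of q k] k have "\<bar>S (a + k) \<omega> - S a \<omega>\<bar> \<le> x * (\<Sum>l\<le>q. \<delta> l)" by simp
      also have "\<dots> < x * 1" using x \<delta>sum by (intro mult_strict_left_mono) auto
      finally show False using k by simp
    qed
    have "prob {\<omega>\<in>space M. \<exists>k\<le>2 ^ q. \<bar>S (a + k) \<omega> - S a \<omega>\<bar> \<ge> x} \<le> prob (\<Union>r\<le>q. E r)"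
      using E_meas by (intro finite_measure_mono incl) auto
    also have "\<dots> \<le> (\<Sum>r\<le>q. prob (E r))" using E_meas by (intro measure_UNION_le) auto
    also have "\<dots> \<le> (\<Sum>r\<le>q. (K * C powr \<alpha> / (1 - \<rho>) powr \<alpha> * s (2 ^ q) powr \<alpha> / x powr \<alpha>) * w ^ r)"
      using E_prob by (intro sum_mono) auto
    also have "\<dots> = (K * C powr \<alpha> / (1 - \<rho>) powr \<alpha> * s (2 ^ q) powr \<alpha> / x powr \<alpha>) * (\<Sum>r\<le>q. w ^ r)"
      by (simp add: sum_distrib_left)
    also have "\<dots> \<le> (K * C powr \<alpha> / (1 - \<rho>) powr \<alpha> * s (2 ^ q) powr \<alpha> / x powr \<alpha>) * (1 / (1 - w))"
    proof (rule mult_left_mono)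
      show "(\<Sum>r\<le>q. w ^ r) \<le> 1 / (1 - w)"
        using w by (simp add: sum_gp0 divide_right_mono)
    qed (use K in auto)
    finally show "prob {\<omega>\<in>space M. \<exists>k\<le>2 ^ q. \<bar>S (a + k) \<omega> - S a \<omega>\<bar> \<ge> x} \<le> K' * s (2 ^ q) powr \<alpha> / x powr \<alpha>"
      by (simp add: K'_def mult_ac)
  qed
qed

lemma block_oscillation:
  fixes f :: "nat \<Rightarrow> real" and L :: nat
  assumes L: "L \<ge> 1" and f: "\<And>b k. b < B \<Longrightarrow> k \<le> L \<Longrightarrow> \<bar>f (b * L + k) - f (b * L)\<bar> < x"
    and i: "i \<le> i'" "i' \<le> i + L" "i' < B * L"
  shows "\<bar>f i' - f i\<bar> < 3 * x"
proof -
  define b where "b = i div L"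
  define b' where "b' = i' div L"
  have bB: "b < B" "b' < B" using i L by (auto simp: b_def b'_def div_less_iff_less_mult)
  have i1: "\<bar>f i - f (b * L)\<bar> < x"
    using f[OF bB(1), of "i mod L"] L by (simp add: b_def less_imp_le)
  have i2: "\<bar>f i' - f (b' * L)\<bar> < x"
    using f[OF bB(2), of "i' mod L"] L by (simp add: b'_def less_imp_le)
  have "b \<le> b'" using i by (simp add: b_def b'_def div_le_mono)
  moreover have "b' \<le> (i + L) div L" using i by (simp add: b'_def div_le_mono)
  then have "b' \<le> b + 1" using L by (simp add: b_def)
  ultimately consider "b' = b" | "b' = b + 1" by linarith
  then show ?thesis
  proof cases
    case 1
    show ?thesis using i1 i2[unfolded 1] by linarith
  next
    case 2
    have "\<bar>f (b' * L) - f (b * L)\<bar> < x"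
      using f[OF bB(1), of L] by (simp add: 2 add.commute)
    then show ?thesis using i1 i2 by linarith
  qed
qed

lemma (in prob_space) modulus_of_continuity:
  fixes S :: "nat \<Rightarrow> 'a \<Rightarrow> real" and s :: "nat \<Rightarrow> real"
  assumes reg: "regular_sequence s H"
    and meas[measurable]: "\<And>k. S k \<in> borel_measurable M"
    and K: "K \<ge> 0"
    and tail: "\<And>a b x. a < b \<Longrightarrow> x > 0 \<Longrightarrow>
      prob {\<omega>\<in>space M. \<bar>S b \<omega> - S a \<omega>\<bar> \<ge> x} \<le> K * s (b - a) powr \<alpha> / x powr \<alpha>"
    and \<alpha>: "\<alpha> > 0" "\<alpha> * H > 1"
    and \<eta>: "\<eta> > 0" and e: "e > 0"
  shows "\<exists>m0. \<forall>m\<ge>m0. \<forall>\<^sub>F n in sequentially.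
    prob {\<omega>\<in>space M. \<exists>i\<le>n. \<exists>i'\<le>n. \<bar>real i - real i'\<bar> \<le> real n / real m + 1 \<and> \<bar>S i \<omega> - S i' \<omega>\<bar> \<ge> \<eta> * s n} \<le> e"
proof -
  interpret regular_sequence s H by (rule reg)
  have "1 / \<alpha> < H" using \<alpha> by (simp add: field_simps)
  then have "2 powr (- H) < 2 powr (- (1 / \<alpha>))" by simp
  then obtain \<theta> where \<theta>: "2 powr (- H) < \<theta>" "\<theta> < 2 powr (- (1 / \<alpha>))" using dense by blast
  have \<theta>0: "\<theta> > 0" using \<theta> by (smt (verit) powr_gt_zero)
  have "2 powr (- (1 / \<alpha>)) < 1" using \<alpha> by (intro powr_less_one) auto
  then have \<theta>1: "\<theta> < 1" using \<theta> by linarith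
  have less: "2 * \<theta> powr \<alpha> < 1"
  proof -
    have "\<theta> powr \<alpha> < (2 powr (- (1 / \<alpha>))) powr \<alpha>" using \<theta> \<theta>0 \<alpha> by (intro powr_less_mono2) auto
    also have "\<dots> = 2 powr (- 1)" unfolding powr_powr using \<alpha> by simp
    also have "\<dots> = 1 / 2" by simp
    finally show ?thesis by simp
  qed
  obtain C where C: "C \<ge> 1" "\<And>q j. j \<le> q \<Longrightarrow> s (2 ^ j) \<le> C * \<theta> ^ (q - j) * s (2 ^ q)"
    using pow2_growth[OF \<theta>(1) \<theta>1] by blast
  have C0: "C \<ge> 0" using C by simp
  obtain K' where K': "K' \<ge> 0" "\<And>q a x. x > 0 \<Longrightarrow>
    prob {\<omega>\<in>space M. \<exists>k\<le>2 ^ q. \<bar>S (a + k) \<omega> - S a \<omega>\<bar> \<ge> x} \<le> K' * s (2 ^ q) powr \<alpha> / x powr \<alpha>"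
    using dyadic_maximal_inequality[OF meas K tail s_nonneg C0 \<theta>0 C(2) \<alpha>(1) less] by blast
  obtain D p0 where D: "D > 0" "\<And>p n r. p \<ge> p0 \<Longrightarrow> 2 ^ p \<le> n \<Longrightarrow> n < 2 ^ Suc p \<Longrightarrow> r \<le> p \<Longrightarrow> s (2 ^ (p - r)) \<le> D * \<theta> ^ r * s n"
    using pow2_below_ratio[OF \<theta>(1) \<theta>1] by blast
  define Q where "Q = 2 * K' * (3 * D / \<eta>) powr \<alpha>"
  have "(\<lambda>r. Q * (2 * \<theta> powr \<alpha>) ^ r) \<longlonglongrightarrow> 0"
    using less by (intro tendsto_mult_right_zero LIMSEQ_power_zero) auto
  then have "\<forall>\<^sub>F r in sequentially. Q * (2 * \<theta> powr \<alpha>) ^ r < e" using e by (rule order_tendstoD)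
  then obtain r where r: "Q * (2 * \<theta> powr \<alpha>) ^ r < e" by (auto simp: eventually_sequentially)
  have "prob {\<omega>\<in>space M. \<exists>i\<le>n. \<exists>i'\<le>n. \<bar>real i - real i'\<bar> \<le> real n / real m + 1 \<and> \<bar>S i \<omega> - S i' \<omega>\<bar> \<ge> \<eta> * s n} \<le> e"
    if m: "m \<ge> 2 ^ (r + 2)" and n: "n \<ge> 2 ^ (p0 + r + 1)" for m n
  proof -
    have "n \<ge> 1" using n by (meson order_trans one_le_numeral one_le_power)
    then obtain p where p: "2 ^ p \<le> n" "n < 2 ^ Suc p"
      using ex_power_ivl1[of 2 n] by auto
    have "(2::nat) ^ (p0 + r + 1) < 2 ^ Suc p" using n p by linarith
    then have pr: "p0 + r + 1 \<le> p" by (metis less_Suc_eq_le one_less_numeral_iff power_less_imp_less_exp semiring_norm(76))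
    define q where "q = p - r"
    have q: "p = q + r" "q \<ge> 1" using pr by (auto simp: q_def)
    define B where "B = (2::nat) ^ (r + 1)"
    have BL: "B * 2 ^ q = 2 ^ Suc p" by (simp add: B_def q power_add)
    define x where "x = \<eta> * s n / 3"
    have x: "x > 0" using \<eta> s_pos[OF \<open>n \<ge> 1\<close>] by (simp add: x_def)
    have gap: "real n / real m + 1 \<le> 2 ^ q"
    proof -
      have "real n / real m \<le> 2 ^ Suc p / 2 ^ (r + 2)"
      proof (rule frac_le)
        have "real n \<le> real (2 ^ Suc p)" using p by linarith
        then show "real n \<le> 2 ^ Suc p" by simp
        have "real (2 ^ (r + 2)) \<le> real m" using m by linarith
        then show "2 ^ (r + 2) \<le> real m" by simp
      qed auto
      also have "\<dots> = 2 ^ q / 2" by (simp add: q power_add)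
      finally have 1: "real n / real m \<le> 2 ^ q / 2" .
      have "(2::real) ^ 1 \<le> 2 ^ q" using q by (intro power_increasing) auto
      then have "2 \<le> (2::real) ^ q" by simp
      then show ?thesis using 1 by linarith
    qed
    define A where "A b = {\<omega>\<in>space M. \<exists>k\<le>2 ^ q. \<bar>S (b * 2 ^ q + k) \<omega> - S (b * 2 ^ q) \<omega>\<bar> \<ge> x}" for b
    have A_meas: "A b \<in> sets M" for b unfolding A_def by measurable
    have osc: "\<bar>S i \<omega> - S i' \<omega>\<bar> < \<eta> * s n"
      if \<omega>: "\<omega> \<in> space M" and no: "\<And>b. b < B \<Longrightarrow> \<omega> \<notin> A b"
        and i: "i \<le> n" "i' \<le> n" "\<bar>real i - real i'\<bar> \<le> real n / real m + 1" for \<omega> i i'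
    proof -
      have f: "\<bar>S (b * 2 ^ q + k) \<omega> - S (b * 2 ^ q) \<omega>\<bar> < x" if "b < B" "k \<le> 2 ^ q" for b k
        using no[OF that(1)] \<omega> that(2) unfolding A_def by force
      have d: "\<bar>real i - real i'\<bar> \<le> real (2 ^ q)" using i gap by simp
      have bl: "\<bar>S j' \<omega> - S j \<omega>\<bar> < 3 * x" if "j \<le> j'" "real j' - real j \<le> real (2 ^ q)" "j' \<le> n" for j j'
      proof (rule block_oscillation[where L = "2 ^ q" and B = B and f = "\<lambda>k. S k \<omega>"])
        have "real j' \<le> real (j + 2 ^ q)" using that by simp
        then show "j' \<le> j + 2 ^ q" by linarith
        show "j' < B * 2 ^ q" using that p by (simp add: BL)
      qed (use f that in auto)
      show ?thesis
      proof (cases "i \<le> i'")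
        case True
        then show ?thesis using bl[of i i'] d i by (simp add: x_def abs_minus_commute)
      next
        case False
        then show ?thesis using bl[of i' i] d i by (simp add: x_def)
      qed
    qed
    have "prob {\<omega>\<in>space M. \<exists>i\<le>n. \<exists>i'\<le>n. \<bar>real i - real i'\<bar> \<le> real n / real m + 1 \<and> \<bar>S i \<omega> - S i' \<omega>\<bar> \<ge> \<eta> * s n}
      \<le> prob (\<Union>b<B. A b)"
    proof (rule finite_measure_mono)
      show "{\<omega>\<in>space M. \<exists>i\<le>n. \<exists>i'\<le>n. \<bar>real i - real i'\<bar> \<le> real n / real m + 1 \<and> \<bar>S i \<omega> - S i' \<omega>\<bar> \<ge> \<eta> * s n} \<subseteq> (\<Union>b<B. A b)"
        using osc by (force simp: not_le[symmetric])
    qed (use A_meas in auto)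
    also have "\<dots> \<le> (\<Sum>b<B. prob (A b))" using A_meas by (intro measure_UNION_le) auto
    also have "\<dots> \<le> (\<Sum>b<B. K' * s (2 ^ q) powr \<alpha> / x powr \<alpha>)"
      unfolding A_def using K'(2)[OF x] by (intro sum_mono) auto
    also have "\<dots> = real B * (K' * s (2 ^ q) powr \<alpha> / x powr \<alpha>)" by simp
    also have "\<dots> \<le> real B * (K' * (D * \<theta> ^ r * s n) powr \<alpha> / x powr \<alpha>)"
      using D(2)[of p n r] p pr K' s_nonneg \<alpha>
      by (intro mult_left_mono divide_right_mono powr_mono2) (auto simp: q_def)
    also have "\<dots> = real B * (K' * (D * \<theta> ^ r * s n / x) powr \<alpha>)"
      using D(1) \<theta>0 s_nonneg x by (simp add: powr_divide)
    also have "D * \<theta> ^ r * s n / x = \<theta> ^ r * (3 * D / \<eta>)"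
      using \<eta> s_pos[OF \<open>n \<ge> 1\<close>] by (simp add: x_def field_simps)
    also have "(\<theta> ^ r * (3 * D / \<eta>)) powr \<alpha> = (\<theta> powr \<alpha>) ^ r * (3 * D / \<eta>) powr \<alpha>"
      using \<theta>0 D(1) \<eta> powr_mult[of "\<theta> ^ r" "3 * D / \<eta>" \<alpha>]
      by (simp add: powr_realpow[symmetric] powr_powr mult.commute)
    also have "real B * (K' * ((\<theta> powr \<alpha>) ^ r * (3 * D / \<eta>) powr \<alpha>)) = Q * (2 * \<theta> powr \<alpha>) ^ r"
      by (simp add: B_def Q_def power_mult_distrib mult_ac)
    finally show ?thesis using r by simp
  qed
  then show ?thesis unfolding eventually_sequentially by blast
qed

section \<open>Finite-dimensional distributions\<close>

inductive_set trig_functions :: "nat \<Rightarrow> ((nat \<Rightarrow> real) \<Rightarrow> real) set" for m where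
  cos: "(\<lambda>x. a * cos ((\<Sum>j\<le>m. c j * x j) + b)) \<in> trig_functions m"
| add: "g \<in> trig_functions m \<Longrightarrow> h \<in> trig_functions m \<Longrightarrow> (\<lambda>x. g x + h x) \<in> trig_functions m"

lemma trig_functions_const: "(\<lambda>_. a) \<in> trig_functions m"
  using trig_functions.cos[of a "\<lambda>_. 0" m 0] by simp

lemma trig_functions_mult:
  assumes "g \<in> trig_functions m" "h \<in> trig_functions m"
  shows "(\<lambda>x. g x * h x) \<in> trig_functions m"
  using assms(1)
proof induction
  case (cos a c b)
  show ?case using assms(2)
  proof induction
    case (cos a' c' b')
    have "(\<lambda>x. a * cos ((\<Sum>j\<le>m. c j * x j) + b) * (a' * cos ((\<Sum>j\<le>m. c' j * x j) + b')))
      = (\<lambda>x. (a * a' / 2) * cos ((\<Sum>j\<le>m. (c j - c' j) * x j) + (b - b'))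
           + (a * a' / 2) * cos ((\<Sum>j\<le>m. (c j + c' j) * x j) + (b + b')))"
    proof
      fix x :: "nat \<Rightarrow> real"
      define u v where "u = (\<Sum>j\<le>m. c j * x j) + b" and "v = (\<Sum>j\<le>m. c' j * x j) + b'"
      have 1: "(\<Sum>j\<le>m. (c j - c' j) * x j) + (b - b') = u - v"
        by (simp add: u_def v_def left_diff_distrib sum_subtractf)
      have 2: "(\<Sum>j\<le>m. (c j + c' j) * x j) + (b + b') = u + v"
        by (simp add: u_def v_def distrib_right sum.distrib)
      have "a * cos u * (a' * cos v) = (a * a' / 2) * cos (u - v) + (a * a' / 2) * cos (u + v)"
        by (simp add: cos_add cos_diff algebra_simps)
      then show "a * cos ((\<Sum>j\<le>m. c j * x j) + b) * (a' * cos ((\<Sum>j\<le>m. c' j * x j) + b'))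
        = (a * a' / 2) * cos ((\<Sum>j\<le>m. (c j - c' j) * x j) + (b - b'))
           + (a * a' / 2) * cos ((\<Sum>j\<le>m. (c j + c' j) * x j) + (b + b'))"
        unfolding 1 2 by (simp only: u_def v_def)
    qed
    then show ?case by (simp only:) (intro trig_functions.intros)
  next
    case (add g h)
    then show ?case by (simp add: distrib_left trig_functions.add)
  qed
next
  case (add g g')
  then show ?case by (simp add: distrib_right trig_functions.add)
qed

lemma trig_functions_sin:
  assumes "j \<le> m"
  shows "(\<lambda>x. sin (d * x j)) \<in> trig_functions m"
proof -
  have "(\<lambda>x. sin (d * x j)) = (\<lambda>x. 1 * cos ((\<Sum>i\<le>m. (if i = j then d else 0) * x i) + (- (pi / 2))))"
  proof
    fix x :: "nat \<Rightarrow> real"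
    have "(\<Sum>i\<le>m. (if i = j then d else 0) * x i) = (\<Sum>i\<le>m. if i = j then d * x i else 0)"
      by (intro sum.cong) auto
    also have "\<dots> = d * x j" using assms by simp
    finally show "sin (d * x j) = 1 * cos ((\<Sum>i\<le>m. (if i = j then d else 0) * x i) + (- (pi / 2)))"
      by (simp add: cos_diff)
  qed
  then show ?thesis by (simp only: trig_functions.cos)
qed

lemma (in prob_space) expectation_cos_char:
  assumes [measurable]: "U \<in> borel_measurable M"
  shows "expectation (\<lambda>\<omega>. cos (U \<omega> + b)) = Re (char (distr M borel U) 1 * iexp b)"
proof -
  have "char (distr M borel U) 1 * iexp b = (CLINT \<omega>|M. iexp (U \<omega>) * iexp b)"
    by (simp add: char_def integral_distr integrable_iexp)
  also have "Re \<dots> = (LINT \<omega>|M. Re (iexp (U \<omega>) * iexp b))"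
    by (intro integral_Re[symmetric]) (auto simp: integrable_iexp)
  also have "(\<lambda>\<omega>. Re (iexp (U \<omega>) * iexp b)) = (\<lambda>\<omega>. cos (U \<omega> + b))"
    by (intro ext) (simp add: exp_add[symmetric] distrib_left[symmetric] Re_exp flip: of_real_add)
  finally show ?thesis by simp
qed

lemma (in prob_space) trig_functions_integrable:
  assumes "g \<in> trig_functions m" and [measurable]: "\<And>j. X j \<in> borel_measurable M"
  shows "integrable M (\<lambda>\<omega>. g (\<lambda>j. X j \<omega>))"
  using assms(1)
proof induction
  case (cos a c b)
  have "integrable M (\<lambda>\<omega>. cos ((\<Sum>j\<le>m. c j * X j \<omega>) + b))"
    by (rule integrable_const_bound[where B = 1]) auto
  then show ?case by simp
qed simp

lemma trig_functions_expectation_tendsto: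
  assumes P: "prob_space P" and N: "prob_space N"
    and Y[measurable]: "\<And>n j. Y n j \<in> borel_measurable P" and Z[measurable]: "\<And>j. Z j \<in> borel_measurable N"
    and conv: "\<And>c. (\<lambda>n. char (distr P borel (\<lambda>\<omega>. \<Sum>j\<le>m. c j * Y n j \<omega>)) 1)
      \<longlonglongrightarrow> char (distr N borel (\<lambda>\<omega>. \<Sum>j\<le>m. c j * Z j \<omega>)) 1"
    and g: "g \<in> trig_functions m"
  shows "(\<lambda>n. \<integral>\<omega>. g (\<lambda>j. Y n j \<omega>) \<partial>P) \<longlonglongrightarrow> (\<integral>\<omega>. g (\<lambda>j. Z j \<omega>) \<partial>N)"
proof -
  interpret P: prob_space P by fact
  interpret N: prob_space N by fact
  show ?thesis using g
  proof induction
    case (cos a c b)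
    have "(\<lambda>n. \<integral>\<omega>. cos ((\<Sum>j\<le>m. c j * Y n j \<omega>) + b) \<partial>P) \<longlonglongrightarrow> (\<integral>\<omega>. cos ((\<Sum>j\<le>m. c j * Z j \<omega>) + b) \<partial>N)"
      by (simp add: P.expectation_cos_char N.expectation_cos_char) (intro tendsto_intros conv)
    then show ?case by (simp add: tendsto_mult_left)
  next
    case (add g h)
    then show ?case
      by (simp add: P.trig_functions_integrable N.trig_functions_integrable tendsto_add)
  qed
qed

lemma compact_cube: "compact {x :: nat \<Rightarrow> real. \<forall>j. x j \<in> (if j \<le> m then {-1..1} else {0})}" (is "compact ?S")
proof -
  let ?A = "\<lambda>j::nat. if j \<le> m then {-1..1} else {0::real}"
  have "compactin (product_topology (\<lambda>_. euclidean) UNIV) (PiE UNIV ?A)"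
    by (subst compactin_PiE) auto
  moreover have "PiE UNIV ?A = ?S" unfolding PiE_UNIV_domain Pi_def by simp
  ultimately show ?thesis by (simp add: euclidean_product_topology)
qed

lemma continuous_on_finitely_lipschitz:
  fixes f :: "(nat \<Rightarrow> real) \<Rightarrow> real"
  assumes lip: "\<And>x y. \<bar>f x - f y\<bar> \<le> L * (\<Sum>j\<le>m. \<bar>x j - y j\<bar>)"
  shows "continuous_on UNIV f"
  unfolding continuous_on_eq_continuous_at[OF open_UNIV] continuous_at
proof
  fix x :: "nat \<Rightarrow> real"
  have "((\<lambda>y. f y - f x) \<longlongrightarrow> 0) (at x)"
  proof (rule Lim_null_comparison)
    show "\<forall>\<^sub>F y in at x. norm (f y - f x) \<le> L * (\<Sum>j\<le>m. \<bar>y j - x j\<bar>)"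
      using lip by simp
    have "((\<lambda>y. y j) \<longlongrightarrow> x j) (at x)" for j
    proof -
      have "continuous_on UNIV (\<lambda>y :: nat \<Rightarrow> real. y j)" by (rule continuous_on_product_coordinates)
      then show ?thesis unfolding continuous_on_eq_continuous_at[OF open_UNIV] continuous_at by blast
    qed
    then have "((\<lambda>y. L * (\<Sum>j\<le>m. \<bar>y j - x j\<bar>)) \<longlongrightarrow> L * (\<Sum>j\<le>m. \<bar>x j - x j\<bar>)) (at x)"
      by (intro tendsto_intros)
    then show "((\<lambda>y. L * (\<Sum>j\<le>m. \<bar>y j - x j\<bar>)) \<longlongrightarrow> 0) (at x)" by simp
  qed
  then show "(f \<longlongrightarrow> f x) (at x)" by (simp add: LIM_zero_iff)
qed

text \<open>
  Approximating \<open>f\<close> by a polynomial in \<open>sin (d * x j)\<close> keeps the approximation globally bounded,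
  so that only a moment bound is needed outside of a large cube.
\<close>

lemma trig_functions_dense:
  fixes f :: "(nat \<Rightarrow> real) \<Rightarrow> real"
  assumes lip: "\<And>x y. \<bar>f x - f y\<bar> \<le> L * (\<Sum>j\<le>m. \<bar>x j - y j\<bar>)"
    and bd: "\<And>x. \<bar>f x\<bar> \<le> B" and d: "d > 0" and e: "e > 0"
  shows "\<exists>g\<in>trig_functions m. \<forall>x. \<bar>f x - g x\<bar> \<le> e + (2 * B + e) * (2 * d / pi) * (\<Sum>j\<le>m. \<bar>x j\<bar>)"
proof -
  define S where "S = {x :: nat \<Rightarrow> real. \<forall>j. x j \<in> (if j \<le> m then {-1..1} else {0})}"
  define s where "s x j = (if j \<le> m then sin (d * x j) else 0)" for x :: "nat \<Rightarrow> real" and j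
  have sS: "s x \<in> S" for x by (auto simp: s_def S_def)
  define R where "R = {p. continuous_on S p \<and> (\<lambda>x. p (s x)) \<in> trig_functions m}"
  have B0: "B \<ge> 0" using bd[of undefined] by linarith
  interpret function_ring_on R S
  proof
    show "compact S" unfolding S_def by (rule compact_cube)
  next
    fix x y assume "x \<in> S" "y \<in> S" "x \<noteq> y"
    then obtain j where j: "x j \<noteq> y j" by auto
    then have "j \<le> m" using \<open>x \<in> S\<close> \<open>y \<in> S\<close> by (force simp: S_def split: if_splits)
    then have "(\<lambda>x. x j) \<in> R"
      using trig_functions_sin[of j m d]
      by (auto simp: R_def s_def intro: continuous_on_product_coordinates continuous_on_subset)
    then show "\<exists>f\<in>R. f x \<noteq> f y" using j by (intro bexI) auto
  qed (auto simp: R_def trig_functions_const intro!: continuous_intros trig_functions_mult trig_functions.add)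
  define q where "q y = f (\<lambda>j. if j \<le> m then arcsin (y j) / d else 0)" for y
  have contq: "continuous_on S q"
  proof -
    have "continuous_on S (\<lambda>y j. if j \<le> m then arcsin (y j) / d else 0)"
    proof (intro continuous_on_coordinatewise_then_product)
      fix j
      have "continuous_on S (\<lambda>y. y j)"
        by (rule continuous_on_subset[OF continuous_on_product_coordinates]) auto
      then have "continuous_on S (\<lambda>y. arcsin (y j) / d)" if "j \<le> m"
        using that d by (intro continuous_intros) (auto simp: S_def)
      then show "continuous_on S (\<lambda>y. if j \<le> m then arcsin (y j) / d else 0)"
        by (cases "j \<le> m") auto
    qed
    from continuous_on_compose2[OF continuous_on_finitely_lipschitz[OF lip] this] show ?thesis
      unfolding q_def by simp
  qed
  obtain p where p: "p \<in> R" "\<And>y. y \<in> S \<Longrightarrow> \<bar>q y - p y\<bar> < e"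
    using Stone_Weierstrass_basic[OF contq e] by blast
  show ?thesis
  proof (intro bexI[of _ "\<lambda>x. p (s x)"] allI)
    show "(\<lambda>x. p (s x)) \<in> trig_functions m" using p by (simp add: R_def)
    fix x :: "nat \<Rightarrow> real"
    have pe: "\<bar>q (s x) - p (s x)\<bar> < e" using p(2) sS by blast
    show "\<bar>f x - p (s x)\<bar> \<le> e + (2 * B + e) * (2 * d / pi) * (\<Sum>j\<le>m. \<bar>x j\<bar>)"
    proof (cases "\<forall>j\<le>m. \<bar>x j\<bar> \<le> pi / (2 * d)")
      case True
      have "arcsin (sin (d * x j)) / d = x j" if "j \<le> m" for j
      proof -
        have "\<bar>d * x j\<bar> \<le> pi / 2" using True that d by (auto simp: abs_mult field_simps)
        then have "arcsin (sin (d * x j)) = d * x j" by (intro arcsin_sin) (auto simp: abs_le_iff)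
        then show ?thesis using d by simp
      qed
      then have "\<bar>f x - q (s x)\<bar> \<le> L * (\<Sum>j\<le>m. 0)"
        unfolding q_def by (intro order_trans[OF lip]) (simp add: s_def)
      then have "\<bar>f x - p (s x)\<bar> \<le> e" using pe by simp
      moreover have "0 \<le> (2 * B + e) * (2 * d / pi) * (\<Sum>j\<le>m. \<bar>x j\<bar>)"
        using B0 e d by (intro mult_nonneg_nonneg sum_nonneg) auto
      ultimately show ?thesis by linarith
    next
      case False
      then obtain j where j: "j \<le> m" "\<bar>x j\<bar> > pi / (2 * d)" by force
      have "\<bar>x j\<bar> \<le> (\<Sum>j\<le>m. \<bar>x j\<bar>)" using j by (intro member_le_sum) auto
      then have "pi / (2 * d) \<le> (\<Sum>j\<le>m. \<bar>x j\<bar>)" using j by linarith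
      then have "1 \<le> (2 * d / pi) * (\<Sum>j\<le>m. \<bar>x j\<bar>)" using d by (simp add: field_simps)
      then have W: "(2 * B + e) * 1 \<le> (2 * B + e) * ((2 * d / pi) * (\<Sum>j\<le>m. \<bar>x j\<bar>))"
        using B0 e by (intro mult_left_mono) auto
      have "\<bar>q (s x)\<bar> \<le> B" unfolding q_def by (rule bd)
      then have "\<bar>f x - p (s x)\<bar> \<le> 2 * B + e" using pe bd[of x] by linarith
      then show ?thesis using W e unfolding mult.assoc[symmetric] mult_1_right by linarith
    qed
  qed
qed

lemma fdd_convergence:
  fixes f :: "(nat \<Rightarrow> real) \<Rightarrow> real"
  assumes P: "prob_space P" and N: "prob_space N"
    and Y[measurable]: "\<And>n j. Y n j \<in> borel_measurable P" and Z[measurable]: "\<And>j. Z j \<in> borel_measurable N"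
    and conv: "\<And>c. (\<lambda>n. char (distr P borel (\<lambda>\<omega>. \<Sum>j\<le>m. c j * Y n j \<omega>)) 1)
      \<longlonglongrightarrow> char (distr N borel (\<lambda>\<omega>. \<Sum>j\<le>m. c j * Z j \<omega>)) 1"
    and Yint: "\<And>n j. integrable P (Y n j)" and Zint: "\<And>j. integrable N (Z j)"
    and YC: "\<And>j. j \<le> m \<Longrightarrow> \<forall>\<^sub>F n in sequentially. (\<integral>\<omega>. \<bar>Y n j \<omega>\<bar> \<partial>P) \<le> C"
    and ZC: "\<And>j. j \<le> m \<Longrightarrow> (\<integral>\<omega>. \<bar>Z j \<omega>\<bar> \<partial>N) \<le> C"
    and lip: "\<And>x y. \<bar>f x - f y\<bar> \<le> L * (\<Sum>j\<le>m. \<bar>x j - y j\<bar>)"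
    and bd: "\<And>x. \<bar>f x\<bar> \<le> B"
  shows "(\<lambda>n. \<integral>\<omega>. f (\<lambda>j. Y n j \<omega>) \<partial>P) \<longlonglongrightarrow> (\<integral>\<omega>. f (\<lambda>j. Z j \<omega>) \<partial>N)"
proof (rule tendstoI)
  fix e :: real assume e: "e > 0"
  interpret P: prob_space P by fact
  interpret N: prob_space N by fact
  have C0: "C \<ge> 0" using ZC[of 0] by (smt (verit) Bochner_Integration.integral_nonneg le0)
  have B0: "B \<ge> 0" using bd[of undefined] by linarith
  have [measurable]: "f \<in> borel_measurable borel"
    using continuous_on_finitely_lipschitz[OF lip] by (rule borel_measurable_continuous_onI)
  define Q where "Q = (2 * B + e / 6) * (2 / pi) * (real (Suc m) * C)"
  have Q: "Q \<ge> 0" using B0 e C0 by (simp add: Q_def)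
  define d where "d = e / (6 * (Q + 1))"
  have d: "d > 0" "Q * d \<le> e / 6"
    using e Q by (auto simp: d_def field_simps)
  obtain g where g: "g \<in> trig_functions m"
    "\<And>x. \<bar>f x - g x\<bar> \<le> e / 6 + (2 * B + e / 6) * (2 * d / pi) * (\<Sum>j\<le>m. \<bar>x j\<bar>)"
    using trig_functions_dense[OF lip bd d(1), of "e / 6"] e by auto
  have close: "\<bar>(\<integral>\<omega>. f (\<lambda>j. X j \<omega>) \<partial>M) - (\<integral>\<omega>. g (\<lambda>j. X j \<omega>) \<partial>M)\<bar> \<le> e / 3"
    if M: "prob_space M" and X[measurable]: "\<And>j. X j \<in> borel_measurable M" and Xint: "\<And>j. integrable M (X j)"
      and XC: "\<And>j. j \<le> m \<Longrightarrow> (\<integral>\<omega>. \<bar>X j \<omega>\<bar> \<partial>M) \<le> C" for M :: "'x measure" and X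
  proof -
    interpret M: prob_space M by fact
    have [measurable]: "(\<lambda>\<omega> j. X j \<omega>) \<in> borel_measurable M"
      by (rule measurable_coordinatewise_then_product) simp
    have if': "integrable M (\<lambda>\<omega>. f (\<lambda>j. X j \<omega>))"
      by (rule M.integrable_const_bound[where B = B]) (use bd in auto)
    note ig = M.trig_functions_integrable[OF g(1) X]
    have "\<bar>(\<integral>\<omega>. f (\<lambda>j. X j \<omega>) \<partial>M) - (\<integral>\<omega>. g (\<lambda>j. X j \<omega>) \<partial>M)\<bar>
      = \<bar>\<integral>\<omega>. f (\<lambda>j. X j \<omega>) - g (\<lambda>j. X j \<omega>) \<partial>M\<bar>" using if' ig by simp
    also have "\<dots> \<le> (\<integral>\<omega>. \<bar>f (\<lambda>j. X j \<omega>) - g (\<lambda>j. X j \<omega>)\<bar> \<partial>M)" by (rule integral_abs_bound)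
    also have "\<dots> \<le> (\<integral>\<omega>. e / 6 + (2 * B + e / 6) * (2 * d / pi) * (\<Sum>j\<le>m. \<bar>X j \<omega>\<bar>) \<partial>M)"
      using g(2) if' ig Xint by (intro integral_mono) auto
    also have "\<dots> = e / 6 + (2 * B + e / 6) * (2 * d / pi) * (\<Sum>j\<le>m. \<integral>\<omega>. \<bar>X j \<omega>\<bar> \<partial>M)"
      using Xint by (simp add: M.prob_space)
    also have "\<dots> \<le> e / 6 + (2 * B + e / 6) * (2 * d / pi) * (\<Sum>j\<le>m. C)"
      using XC B0 e d by (intro add_left_mono mult_left_mono sum_mono) auto
    also have "\<dots> = e / 6 + Q * d" by (simp add: Q_def)
    finally show ?thesis using d by simp
  qed
  have "\<forall>\<^sub>F n in sequentially. dist (\<integral>\<omega>. g (\<lambda>j. Y n j \<omega>) \<partial>P) (\<integral>\<omega>. g (\<lambda>j. Z j \<omega>) \<partial>N) < e / 3"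
    using trig_functions_expectation_tendsto[OF P N Y Z conv g(1)] e by (intro tendstoD) auto
  moreover have "\<forall>\<^sub>F n in sequentially. \<forall>j\<in>{..m}. (\<integral>\<omega>. \<bar>Y n j \<omega>\<bar> \<partial>P) \<le> C"
    using YC by (intro eventually_ball_finite) auto
  ultimately show "\<forall>\<^sub>F n in sequentially. dist (\<integral>\<omega>. f (\<lambda>j. Y n j \<omega>) \<partial>P) (\<integral>\<omega>. f (\<lambda>j. Z j \<omega>) \<partial>N) < e"
  proof eventually_elim
    case (elim n)
    have "\<bar>(\<integral>\<omega>. f (\<lambda>j. Y n j \<omega>) \<partial>P) - (\<integral>\<omega>. g (\<lambda>j. Y n j \<omega>) \<partial>P)\<bar> \<le> e / 3"
      using elim by (intro close[OF P] Y Yint) auto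
    moreover have "\<bar>(\<integral>\<omega>. f (\<lambda>j. Z j \<omega>) \<partial>N) - (\<integral>\<omega>. g (\<lambda>j. Z j \<omega>) \<partial>N)\<bar> \<le> e / 3"
      using ZC by (intro close[OF N] Z Zint) auto
    ultimately show ?case using elim(1) unfolding dist_real_def by linarith
  qed
qed

section \<open>Weights and their limit operators\<close>

definition lipschitz_from_0 :: "real \<Rightarrow> (real \<Rightarrow> real) \<Rightarrow> bool" where
  "lipschitz_from_0 L z \<longleftrightarrow> (\<forall>u v. \<bar>z u - z v\<bar> \<le> L * \<bar>u - v\<bar>) \<and> (\<forall>u\<le>0. z u = 0)"

lemma lipschitz_from_0_nonneg: "lipschitz_from_0 L z \<Longrightarrow> L \<ge> 0"
  unfolding lipschitz_from_0_def by (metis abs_ge_zero abs_one diff_0_right mult_1_right order_trans)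

lemma lipschitz_from_0_bound:
  assumes "lipschitz_from_0 L z" "u \<le> 1"
  shows "\<bar>z u\<bar> \<le> L"
proof (cases "u \<le> 0")
  case True
  then show ?thesis using assms lipschitz_from_0_nonneg[OF assms(1)] by (simp add: lipschitz_from_0_def)
next
  case False
  have "\<bar>z u - z 0\<bar> \<le> L * \<bar>u - 0\<bar>" using assms(1) unfolding lipschitz_from_0_def by blast
  moreover have "z 0 = 0" using assms(1) by (simp add: lipschitz_from_0_def)
  moreover have "L * \<bar>u\<bar> \<le> L * 1" using False assms lipschitz_from_0_nonneg[OF assms(1)] by (intro mult_left_mono) auto
  ultimately show ?thesis by simp
qed

lemma lipschitz_from_0_continuous:
  assumes "lipschitz_from_0 L z"
  shows "continuous_on A z"
proof -
  have "L-lipschitz_on A z"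
    using assms lipschitz_from_0_nonneg[OF assms]
    by (intro lipschitz_onI) (auto simp: lipschitz_from_0_def dist_real_def)
  then show ?thesis by (rule lipschitz_on_continuous_on)
qed

definition discrete_average :: "(nat \<Rightarrow> nat \<Rightarrow> real) \<Rightarrow> nat \<Rightarrow> (real \<Rightarrow> real) \<Rightarrow> real \<Rightarrow> real" where
  "discrete_average w n z t = (\<Sum>i<nat \<lfloor>real n * t\<rfloor>. w n i * z ((real (nat \<lfloor>real n * t\<rfloor>) - real i) / real n))"

lemma nat_floor_le:
  assumes "t \<in> {0..1}"
  shows "nat \<lfloor>real n * t\<rfloor> \<le> n"
proof -
  have "real n * t \<le> real n" using assms mult_left_mono[of t 1 "real n"] by simp
  then have "\<lfloor>real n * t\<rfloor> \<le> int n" by (simp add: floor_le_iff)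
  then show ?thesis by simp
qed

lemma floor_div_close:
  assumes "t \<in> {0..1}" "n > 0"
  shows "\<bar>real (nat \<lfloor>real n * t\<rfloor>) / real n - t\<bar> \<le> 1 / real n"
proof -
  have 0: "0 \<le> real n * t" using assms by simp
  have "real (nat \<lfloor>real n * t\<rfloor>) = real_of_int \<lfloor>real n * t\<rfloor>"
    using 0 by (subst of_nat_nat) auto
  then have "\<bar>real (nat \<lfloor>real n * t\<rfloor>) - real n * t\<bar> \<le> 1"
    by linarith
  then have "\<bar>real (nat \<lfloor>real n * t\<rfloor>) - real n * t\<bar> / real n \<le> 1 / real n"
    by (intro divide_right_mono) auto
  also have "\<bar>real (nat \<lfloor>real n * t\<rfloor>) - real n * t\<bar> / real n = \<bar>real (nat \<lfloor>real n * t\<rfloor>) / real n - t\<bar>"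
  proof -
    have "real (nat \<lfloor>real n * t\<rfloor>) / real n - t = (real (nat \<lfloor>real n * t\<rfloor>) - real n * t) / real n"
      using assms by (simp add: diff_divide_distrib)
    then show ?thesis by (simp add: abs_divide)
  qed
  finally show ?thesis .
qed

text \<open>The weights \<open>w\<close> are the increments of \<open>M\<close> normalised by \<open>M n\<close>, and \<open>G\<close> is the limiting
  distribution function of the corresponding discrete measures on the points \<open>i / n\<close>.\<close>

lemma discrete_average_tendsto:
  fixes M :: "real \<Rightarrow> real" and G :: "real \<Rightarrow> real"
  assumes w: "\<And>n i. w n i = weight_diff M i / M (real n)"
    and w_nonneg: "\<And>n i. w n i \<ge> 0" and w_sum: "\<And>n. (\<Sum>i<n. w n i) \<le> 1"
    and G: "\<And>N l. N \<ge> 1 \<Longrightarrow> l \<le> N \<Longrightarrow>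
      (\<lambda>n. (M (real (n * l div N)) - M 0) / M (real n)) \<longlonglongrightarrow> G (real l / real N)"
    and \<Phi>: "\<And>N t. N \<ge> 1 \<Longrightarrow> t \<in> {0..1} \<Longrightarrow>
      \<bar>\<Phi> t - (\<Sum>l<N. (G (real (Suc l) / real N) - G (real l / real N)) * z (t - real l / real N))\<bar> \<le> L / real N"
    and z: "lipschitz_from_0 L z" and e: "e > 0"
  shows "\<forall>\<^sub>F n in sequentially. \<forall>t\<in>{0..1}. \<bar>discrete_average w n z t - \<Phi> t\<bar> \<le> e"
proof -
  have L: "L \<ge> 0" by (rule lipschitz_from_0_nonneg[OF z])
  have "\<forall>\<^sub>F N in sequentially. 2 * L * (1 / real N) < e / 3"
  proof -
    have "(\<lambda>N. 2 * L * (1 / real N)) \<longlonglongrightarrow> 2 * L * 0" by (intro tendsto_intros lim_1_over_n)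
    then show ?thesis using e by (intro order_tendstoD) auto
  qed
  then obtain N where N: "N \<ge> 1" "2 * L / real N < e / 3"
    using eventually_happens'[OF _ eventually_conj[OF _ eventually_ge_at_top[of 1]]] by (metis (mono_tags, lifting) sequentially_bot times_divide_eq_right mult.right_neutral)
  define \<Delta> where "\<Delta> l = G (real (Suc l) / real N) - G (real l / real N)" for l
  define d where "d n l = n * l div N" for n l
  define \<mu> where "\<mu> n l = (\<Sum>i\<in>{d n l..<d n (Suc l)}. w n i)" for n l
  have dmono: "d n l \<le> d n (Suc l)" for n l unfolding d_def by (intro div_le_mono) simp
  have \<mu>: "\<mu> n l = (M (real (n * Suc l div N)) - M 0) / M (real n) - (M (real (n * l div N)) - M 0) / M (real n)" for n l
  proof -
    have "\<mu> n l = (\<Sum>i\<in>{d n l..<d n (Suc l)}. M (real (Suc i)) - M (real i)) / M (real n)"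
      unfolding \<mu>_def w weight_diff_def by (simp add: sum_divide_distrib add.commute)
    also have "(\<Sum>i\<in>{d n l..<d n (Suc l)}. M (real (Suc i)) - M (real i)) = M (real (d n (Suc l))) - M (real (d n l))"
      using sum_Suc_diff'[OF dmono, of "\<lambda>i. M (real i)"] .
    finally show ?thesis by (simp add: d_def diff_divide_distrib)
  qed
  have \<mu>_lim: "(\<lambda>n. \<mu> n l) \<longlonglongrightarrow> \<Delta> l" if "l < N" for l
    unfolding \<mu> \<Delta>_def using that N(1) by (intro tendsto_diff G) auto
  have "(\<lambda>n. 3 * L * (1 / real n) + L * (\<Sum>l<N. \<bar>\<mu> n l - \<Delta> l\<bar>)) \<longlonglongrightarrow> 3 * L * 0 + L * (\<Sum>l<N. \<bar>\<Delta> l - \<Delta> l\<bar>)"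
    by (intro tendsto_intros \<mu>_lim lim_1_over_n) auto
  then have "(\<lambda>n. 3 * L * (1 / real n) + L * (\<Sum>l<N. \<bar>\<mu> n l - \<Delta> l\<bar>)) \<longlonglongrightarrow> 0" by simp
  then have "\<forall>\<^sub>F n in sequentially. 3 * L * (1 / real n) + L * (\<Sum>l<N. \<bar>\<mu> n l - \<Delta> l\<bar>) < e / 3"
    using e by (intro order_tendstoD) auto
  then show ?thesis using eventually_gt_at_top[of 0]
  proof eventually_elim
    case (elim n)
    show ?case
    proof
      fix t :: real assume t: "t \<in> {0..1}"
      define k where "k = nat \<lfloor>real n * t\<rfloor>"
      have kn: "k \<le> n" unfolding k_def by (rule nat_floor_le[OF t])
      have kt: "\<bar>real k / real n - t\<bar> \<le> 1 / real n" unfolding k_def by (rule floor_div_close[OF t elim(2)])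
      define y where "y i = z ((real k - real i) / real n)" for i
      have "discrete_average w n z t = (\<Sum>i<k. w n i * y i)"
        by (simp add: discrete_average_def k_def y_def)
      also have "\<dots> = (\<Sum>i<n. w n i * y i)"
      proof (rule sum.mono_neutral_left)
        have "y i = 0" if "i \<ge> k" for i
          unfolding y_def using z that by (simp add: lipschitz_from_0_def divide_nonpos_nonneg)
        then show "\<forall>i\<in>{..<n} - {..<k}. w n i * y i = 0" by auto
      qed (use kn in auto)
      also have "\<dots> = (\<Sum>l<N. \<Sum>i\<in>{d n l..<d n (Suc l)}. w n i * y i)"
      proof -
        have "(\<Sum>l<m. \<Sum>i\<in>{d n l..<d n (Suc l)}. w n i * y i) = (\<Sum>i\<in>{0..<d n m}. w n i * y i)" for m
        proof (induction m)
          case (Suc m)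
          then show ?case using dmono[of n m] by (simp add: sum.atLeastLessThan_concat)
        qed (simp add: d_def)
        from this[of N] show ?thesis using N(1) by (simp add: d_def atLeast0LessThan)
      qed
      finally have avg: "discrete_average w n z t = (\<Sum>l<N. \<Sum>i\<in>{d n l..<d n (Suc l)}. w n i * y i)" .
      have cell: "\<bar>(\<Sum>i\<in>{d n l..<d n (Suc l)}. w n i * y i) - \<mu> n l * z (t - real l / real N)\<bar> \<le> L * (2 / real n + 1 / real N) * \<mu> n l"
        if "l < N" for l
      proof -
        have pt: "\<bar>y i - z (t - real l / real N)\<bar> \<le> L * (2 / real n + 1 / real N)" if i: "i \<in> {d n l..<d n (Suc l)}" for i
        proof -
          have "n * l < (i + 1) * N"
          proof -
            have "n * l div N < i + 1" using i by (simp add: d_def)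
            then show ?thesis using N(1) by (simp add: div_less_iff_less_mult)
          qed
          then have "real (n * l) < real ((i + 1) * N)" by linarith
          then have l1: "real l / real N < real i / real n + 1 / real n"
            using N(1) elim(2) by (simp add: field_simps)
          have "i * N \<le> n * Suc l"
          proof -
            have "i \<le> n * Suc l div N" using i by (simp add: d_def)
            then show ?thesis using N(1) by (simp add: less_eq_div_iff_mult_less_eq)
          qed
          then have "real (i * N) \<le> real (n * Suc l)" by linarith
          then have l2: "real i / real n \<le> real l / real N + 1 / real N"
            using N(1) elim(2) by (simp add: field_simps)
          have "\<bar>real i / real n - real l / real N\<bar> \<le> 1 / real n + 1 / real N"
            using l1 l2 by (smt (verit) divide_nonneg_nonneg of_nat_0_le_iff)
          then have "\<bar>(real k - real i) / real n - (t - real l / real N)\<bar> \<le> 2 / real n + 1 / real N"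
            using kt by (simp add: diff_divide_distrib)
          then have "L * \<bar>(real k - real i) / real n - (t - real l / real N)\<bar> \<le> L * (2 / real n + 1 / real N)"
            using L by (rule mult_left_mono)
          then show ?thesis using z unfolding lipschitz_from_0_def y_def by (meson order_trans)
        qed
        have "(\<Sum>i\<in>{d n l..<d n (Suc l)}. w n i * y i) - \<mu> n l * z (t - real l / real N)
          = (\<Sum>i\<in>{d n l..<d n (Suc l)}. w n i * (y i - z (t - real l / real N)))"
          by (simp add: \<mu>_def sum_distrib_right right_diff_distrib sum_subtractf)
        also have "\<bar>\<dots>\<bar> \<le> (\<Sum>i\<in>{d n l..<d n (Suc l)}. \<bar>w n i * (y i - z (t - real l / real N))\<bar>)" by (rule sum_abs)
        also have "\<dots> \<le> (\<Sum>i\<in>{d n l..<d n (Suc l)}. w n i * (L * (2 / real n + 1 / real N)))"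
          using pt w_nonneg by (intro sum_mono) (auto simp: abs_mult intro!: mult_left_mono)
        also have "\<dots> = L * (2 / real n + 1 / real N) * \<mu> n l"
          by (simp add: \<mu>_def sum_distrib_right[symmetric] mult.commute)
        finally show ?thesis .
      qed
      have \<mu>sum: "(\<Sum>l<N. \<mu> n l) \<le> 1"
      proof -
        have "(\<Sum>l<m. \<mu> n l) = (\<Sum>i\<in>{0..<d n m}. w n i)" for m
        proof (induction m)
          case (Suc m)
          then show ?case using dmono[of n m] by (simp add: \<mu>_def sum.atLeastLessThan_concat)
        qed (simp add: d_def)
        from this[of N] show ?thesis using N(1) w_sum[of n] by (simp add: d_def atLeast0LessThan)
      qed
      have "\<bar>discrete_average w n z t - (\<Sum>l<N. \<mu> n l * z (t - real l / real N))\<bar>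
        \<le> (\<Sum>l<N. L * (2 / real n + 1 / real N) * \<mu> n l)"
        unfolding avg sum_subtractf[symmetric] using cell by (intro order_trans[OF sum_abs] sum_mono) auto
      also have "\<dots> = L * (2 / real n + 1 / real N) * (\<Sum>l<N. \<mu> n l)" by (simp add: sum_distrib_left)
      also have "\<dots> \<le> L * (2 / real n + 1 / real N) * 1"
        using L \<mu>sum by (intro mult_left_mono) auto
      finally have 1: "\<bar>discrete_average w n z t - (\<Sum>l<N. \<mu> n l * z (t - real l / real N))\<bar> \<le> L * (2 / real n + 1 / real N)" by simp
      have "\<bar>(\<Sum>l<N. \<mu> n l * z (t - real l / real N)) - (\<Sum>l<N. \<Delta> l * z (t - real l / real N))\<bar>
        \<le> (\<Sum>l<N. \<bar>\<mu> n l - \<Delta> l\<bar> * L)"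
        unfolding sum_subtractf[symmetric] left_diff_distrib[symmetric]
      proof (intro order_trans[OF sum_abs] sum_mono)
        fix l
        have "0 \<le> real l / real N" by simp
        then have "t - real l / real N \<le> 1" using t unfolding atLeastAtMost_iff by linarith
        then have "\<bar>z (t - real l / real N)\<bar> \<le> L" by (rule lipschitz_from_0_bound[OF z])
        then show "\<bar>(\<mu> n l - \<Delta> l) * z (t - real l / real N)\<bar> \<le> \<bar>\<mu> n l - \<Delta> l\<bar> * L"
          by (simp add: abs_mult mult_left_mono)
      qed
      then have 2: "\<bar>(\<Sum>l<N. \<mu> n l * z (t - real l / real N)) - (\<Sum>l<N. \<Delta> l * z (t - real l / real N))\<bar>
        \<le> L * (\<Sum>l<N. \<bar>\<mu> n l - \<Delta> l\<bar>)" by (simp add: sum_distrib_left mult.commute)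
      have 3: "\<bar>\<Phi> t - (\<Sum>l<N. \<Delta> l * z (t - real l / real N))\<bar> \<le> L / real N"
        using \<Phi>[OF N(1) t] by (simp add: \<Delta>_def)
      have "L * (2 / real n + 1 / real N) + L / real N = 2 * L * (1 / real n) + 2 * L / real N"
        by (simp add: algebra_simps)
      moreover have "2 * L * (1 / real n) \<le> 3 * L * (1 / real n)" using L by (intro mult_right_mono) auto
      ultimately show "\<bar>discrete_average w n z t - \<Phi> t\<bar> \<le> e"
        using 1 2 3 elim(1) N(2) by linarith
    qed
  qed
qed

locale limit_operator =
  fixes w :: "nat \<Rightarrow> nat \<Rightarrow> real" and \<Phi> :: "(real \<Rightarrow> real) \<Rightarrow> real \<Rightarrow> real"
  assumes w_nonneg: "w n i \<ge> 0" and w_sum: "(\<Sum>i<n. w n i) \<le> 1"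
    and op_sum: "finite (J :: nat set) \<Longrightarrow> (\<And>j. j \<in> J \<Longrightarrow> continuous_on {0..1} (e j)) \<Longrightarrow> t \<in> {0..1} \<Longrightarrow>
      \<Phi> (\<lambda>u. \<Sum>j\<in>J. x j * e j u) t = (\<Sum>j\<in>J. x j * \<Phi> (e j) t)"
    and op_contraction: "continuous_on {0..1} z \<Longrightarrow> continuous_on {0..1} z' \<Longrightarrow>
      (\<And>u. u \<in> {0..1} \<Longrightarrow> \<bar>z u - z' u\<bar> \<le> \<delta>) \<Longrightarrow> t \<in> {0..1} \<Longrightarrow> \<bar>\<Phi> z t - \<Phi> z' t\<bar> \<le> \<delta>"
    and op_const: "continuous_on {0..1} (\<Phi> (\<lambda>_. 1))"
    and op_lipschitz: "lipschitz_from_0 L z \<Longrightarrow> continuous_on {0..1} (\<Phi> z)"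
    and op_limit: "lipschitz_from_0 L z \<Longrightarrow> \<epsilon> > 0 \<Longrightarrow>
      \<forall>\<^sub>F n in sequentially. \<forall>t\<in>{0..1}. \<bar>discrete_average w n z t - \<Phi> z t\<bar> \<le> \<epsilon>"

lemma weight_class_weights:
  assumes "M \<in> weight_class \<nu>" "\<nu> \<ge> 0"
  shows weight_class_mono: "mono_on {0..} M"
    and weight_class_nonneg: "\<And>t. t \<ge> 0 \<Longrightarrow> M t \<ge> 0"
    and weight_class_diff_nonneg: "weight_diff M i / M (real n) \<ge> 0"
    and weight_class_diff_sum: "(\<Sum>i<n. weight_diff M i / M (real n)) \<le> 1"
proof -
  obtain l where l: "\<And>t. t \<ge> 0 \<Longrightarrow> l t \<ge> 0" "mono_on {0..} l"
    "\<And>t. t \<ge> 0 \<Longrightarrow> M t = l t * (if \<nu> = 0 then 1 else t powr \<nu>)"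
    using assms unfolding weight_class_def by auto
  show mono: "mono_on {0..} M"
  proof (rule mono_onI)
    fix r t :: real assume rt: "r \<in> {0..}" "t \<in> {0..}" "r \<le> t"
    then have "(if \<nu> = 0 then 1 else r powr \<nu>) \<le> (if \<nu> = 0 then 1 else t powr \<nu>)"
      using assms(2) by (auto intro: powr_mono2)
    then show "M r \<le> M t"
      using rt l(1)[of r] l(1)[of t] l(3)[of r] l(3)[of t] mono_onD[OF l(2), of r t]
      by (auto intro!: mult_mono)
  qed
  show nonneg: "M t \<ge> 0" if "t \<ge> 0" for t
    using l(1)[OF that] l(3)[OF that] by simp
  show "weight_diff M i / M (real n) \<ge> 0"
    using mono_onD[OF mono, of "real i" "real i + 1"] nonneg[of "real n"]
    by (simp add: weight_diff_def)
  have "(\<Sum>i<n. weight_diff M i / M (real n)) = (\<Sum>i<n. M (real (Suc i)) - M (real i)) / M (real n)"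
    by (simp add: weight_diff_def sum_divide_distrib add.commute)
  also have "(\<Sum>i<n. M (real (Suc i)) - M (real i)) = M (real n) - M 0"
    using sum_lessThan_telescope[of "\<lambda>i. M (real i)" n] by simp
  also have "(M (real n) - M 0) / M (real n) \<le> 1"
    using nonneg[of 0] nonneg[of "real n"] by (auto simp: divide_le_eq_1)
  finally show "(\<Sum>i<n. weight_diff M i / M (real n)) \<le> 1" .
qed

lemma slowly_varying_floor_ratio:
  assumes sv: "slowly_varying l" and nonneg: "\<And>t. t \<ge> 0 \<Longrightarrow> l t \<ge> 0" and mono: "mono_on {0..} l"
    and j: "1 \<le> j" "j \<le> N"
  shows "(\<lambda>n. l (real (n * j div N)) / l (real n)) \<longlonglongrightarrow> 1"
proof -
  define x where "x = real j / real N"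
  have x: "0 < x" using j by (simp add: x_def)
  have lim: "(\<lambda>n. l (c * real n) / l (real n)) \<longlonglongrightarrow> 1" if "c > 0" for c
    using sv that filterlim_compose[OF _ filterlim_real_sequentially]
    unfolding slowly_varying_def by blast
  have d: "real (n * j div N) \<le> x * real n" "x * real n - 1 \<le> real (n * j div N)" for n
  proof -
    have "real (n * j div N) = real_of_int \<lfloor>real (n * j) / real N\<rfloor>"
      using floor_divide_of_nat_eq[where 'a = real, of "n * j" N] by (metis of_int_of_nat_eq)
    moreover have "real (n * j) / real N = x * real n" by (simp add: x_def)
    ultimately show "real (n * j div N) \<le> x * real n" "x * real n - 1 \<le> real (n * j div N)"
      by linarith+
  qed
  have "\<forall>\<^sub>F n in sequentially. l (x / 2 * real n) / l (real n) \<le> l (real (n * j div N)) / l (real n)"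
  proof -
    have "\<forall>\<^sub>F n in sequentially. 2 / x \<le> real n" using eventually_ge_at_top[of "nat \<lceil>2 / x\<rceil>"]
      by eventually_elim linarith
    then show ?thesis
    proof eventually_elim
      case (elim n)
      then have "x / 2 * real n \<le> x * real n - 1" using x by (simp add: field_simps)
      then have "x / 2 * real n \<le> real (n * j div N)" using d(2)[of n] by linarith
      then show ?case using x nonneg[of "real n"]
        by (intro divide_right_mono mono_onD[OF mono]) auto
    qed
  qed
  moreover have "\<forall>\<^sub>F n in sequentially. l (real (n * j div N)) / l (real n) \<le> l (x * real n) / l (real n)"
  proof (intro always_eventually allI)
    fix n
    show "l (real (n * j div N)) / l (real n) \<le> l (x * real n) / l (real n)"
      using d(1)[of n] x nonneg[of "real n"] by (intro divide_right_mono mono_onD[OF mono]) auto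
  qed
  ultimately show ?thesis
    by (rule tendsto_sandwich[OF _ _ lim lim]) (use x in auto)
qed

lemma floor_div_tendsto:
  assumes "N \<ge> 1"
  shows "(\<lambda>n. real (n * j div N) / real n) \<longlonglongrightarrow> real j / real N"
proof -
  have "(\<lambda>n. real (n * j div N) / real n - real j / real N) \<longlonglongrightarrow> 0"
  proof (rule Lim_null_comparison)
    show "\<forall>\<^sub>F n in sequentially. norm (real (n * j div N) / real n - real j / real N) \<le> 1 / real n"
      using eventually_gt_at_top[of 0]
    proof eventually_elim
      case (elim n)
      have "real (n * j div N) = real_of_int \<lfloor>real (n * j) / real N\<rfloor>"
        using floor_divide_of_nat_eq[where 'a = real, of "n * j" N] by (metis of_int_of_nat_eq)
      then have "\<bar>real (n * j div N) - real n * (real j / real N)\<bar> \<le> 1"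
        by simp linarith
      then have "\<bar>real (n * j div N) - real n * (real j / real N)\<bar> / real n \<le> 1 / real n"
        by (intro divide_right_mono) auto
      moreover have "real (n * j div N) / real n - real j / real N = (real (n * j div N) - real n * (real j / real N)) / real n"
        using elim by (simp add: diff_divide_distrib)
      ultimately show ?case by (simp only: real_norm_def abs_divide abs_of_nat)
    qed
    show "(\<lambda>n. 1 / real n) \<longlonglongrightarrow> 0" by (rule lim_1_over_n)
  qed
  then show ?thesis by (simp add: LIM_zero_iff)
qed

lemma weight_class_ratio_pos:
  assumes M: "M \<in> weight_class \<nu>" and \<nu>: "\<nu> > 0" and N: "N \<ge> 1" "j \<le> N"
  shows "(\<lambda>n. (M (real (n * j div N)) - M 0) / M (real n)) \<longlonglongrightarrow> (real j / real N) powr \<nu>"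
proof -
  obtain l where l: "\<And>t. t \<ge> 0 \<Longrightarrow> l t \<ge> 0" "mono_on {0..} l" "slowly_varying l"
    "\<And>t. t \<ge> 0 \<Longrightarrow> M t = l t * t powr \<nu>"
    using M \<nu> unfolding weight_class_def by auto
  have M0: "M 0 = 0" using l(4)[of 0] by simp
  show ?thesis
  proof (cases "j = 0")
    case False
    have "(\<lambda>n. l (real (n * j div N)) / l (real n) * (real (n * j div N) / real n) powr \<nu>) \<longlonglongrightarrow> 1 * (real j / real N) powr \<nu>"
      using False N by (intro tendsto_intros slowly_varying_floor_ratio l floor_div_tendsto) auto
    also have "(\<lambda>n. l (real (n * j div N)) / l (real n) * (real (n * j div N) / real n) powr \<nu>) =
      (\<lambda>n. (M (real (n * j div N)) - M 0) / M (real n))"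
      by (intro ext) (simp add: l(4) M0 powr_divide)
    finally show ?thesis by simp
  qed (simp add: M0)
qed

lemma weight_class_0_ratio:
  assumes M: "M \<in> weight_class 0"
  shows "(\<lambda>n. M 0 / M (real n)) \<longlonglongrightarrow> weight_ratio M" and "weight_ratio M \<in> {0..1}"
proof -
  note mono = weight_class_mono[OF M order_refl] and nonneg = weight_class_nonneg[OF M order_refl]
  define S where "S = (SUP t\<in>{0..}. ereal (M t))"
  have S_ge: "ereal (M t) \<le> S" if "t \<ge> 0" for t unfolding S_def using that by (intro SUP_upper) auto
  have limS: "((\<lambda>t. ereal (M t)) \<longlongrightarrow> S) at_top"
  proof (rule order_tendstoI)
    fix a assume "a < S"
    then obtain t where t: "t \<ge> 0" "a < ereal (M t)" unfolding S_def less_SUP_iff by auto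
    show "\<forall>\<^sub>F u in at_top. a < ereal (M u)" using eventually_ge_at_top[of t]
    proof eventually_elim
      case (elim u)
      then have "M t \<le> M u" using t by (intro mono_onD[OF mono]) auto
      then show ?case using t(2) by (meson ereal_less_eq(3) less_le_trans)
    qed
  next
    fix a assume "S < a"
    show "\<forall>\<^sub>F u in at_top. ereal (M u) < a" using eventually_ge_at_top[of 0]
      by eventually_elim (use S_ge \<open>S < a\<close> in \<open>meson le_less_trans\<close>)
  qed
  then have Lim: "Lim at_top (\<lambda>t. ereal (M t)) = S" by (intro tendsto_Lim) auto
  have limn: "(\<lambda>n. ereal (M (real n))) \<longlonglongrightarrow> S"
    by (rule filterlim_compose[OF limS filterlim_real_sequentially])
  have "S > 0"
  proof -
    have "\<exists>t\<ge>0. M t \<noteq> 0" using M unfolding weight_class_def constant_on_def by auto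
    then obtain t where "t \<ge> 0" "M t > 0" using nonneg by (metis less_le)
    then show ?thesis using S_ge[of t] by (metis ereal_less(2) less_le_trans)
  qed
  show lim: "(\<lambda>n. M 0 / M (real n)) \<longlonglongrightarrow> weight_ratio M"
  proof (cases S)
    case (real r)
    then have "(\<lambda>n. M (real n)) \<longlonglongrightarrow> r" "r > 0" using limn \<open>S > 0\<close> by auto
    then have "(\<lambda>n. M 0 / M (real n)) \<longlonglongrightarrow> M 0 / r" by (intro tendsto_intros) auto
    then show ?thesis using \<open>r > 0\<close> by (simp add: weight_ratio_def Lim real)
  next
    case PInf
    then have "filterlim (\<lambda>n. M (real n)) at_top sequentially"
      using limn by (simp add: tendsto_PInfty_eq_at_top)
    then have "(\<lambda>n. M 0 / M (real n)) \<longlonglongrightarrow> 0" by (intro tendsto_divide_0[OF tendsto_const] filterlim_at_top_imp_at_infinity)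
    then show ?thesis by (simp add: weight_ratio_def Lim PInf)
  next
    case MInf
    then show ?thesis using \<open>S > 0\<close> by simp
  qed
  have "0 \<le> M 0 / M (real n)" "M 0 / M (real n) \<le> 1" for n
    using nonneg[of 0] nonneg[of "real n"] mono_onD[OF mono, of 0 "real n"] by (auto simp: divide_le_eq_1)
  then show "weight_ratio M \<in> {0..1}"
    using LIMSEQ_le_const[OF lim] LIMSEQ_le_const2[OF lim] by auto
qed

lemma weight_class_ratio_0:
  assumes M: "M \<in> weight_class 0" and N: "N \<ge> 1" "j \<le> N"
  shows "(\<lambda>n. (M (real (n * j div N)) - M 0) / M (real n)) \<longlonglongrightarrow> (if real j / real N = 0 then 0 else 1 - weight_ratio M)"
proof (cases "j = 0")
  case False
  obtain l where l: "\<And>t. t \<ge> 0 \<Longrightarrow> l t \<ge> 0" "mono_on {0..} l" "slowly_varying l"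
    "\<And>t. t \<ge> 0 \<Longrightarrow> M t = l t"
    using M unfolding weight_class_def by auto
  have "(\<lambda>n. M (real (n * j div N)) / M (real n)) \<longlonglongrightarrow> 1"
    using slowly_varying_floor_ratio[OF l(3,1,2), of j N] False N by (simp add: l(4))
  from tendsto_diff[OF this weight_class_0_ratio(1)[OF M]]
  show ?thesis using False N by (simp add: diff_divide_distrib)
qed simp

lemma limit_operator_0:
  assumes M: "M \<in> weight_class 0"
  shows "limit_operator (\<lambda>n i. weight_diff M i / M (real n)) (\<lambda>z t. (1 - weight_ratio M) * z t)"
proof
  let ?c = "1 - weight_ratio M"
  have c: "0 \<le> ?c" "?c \<le> 1" using weight_class_0_ratio(2)[OF M] by auto
  show "weight_diff M i / M (real n) \<ge> 0" "(\<Sum>i<n. weight_diff M i / M (real n)) \<le> 1" for n i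
    using weight_class_diff_nonneg[OF M order_refl] weight_class_diff_sum[OF M order_refl] by auto
  show "?c * (\<Sum>j\<in>J. x j * e j t) = (\<Sum>j\<in>J. x j * (?c * e j t))" for J :: "nat set" and x e t
    by (simp add: sum_distrib_left mult_ac)
  show "\<bar>?c * z t - ?c * z' t\<bar> \<le> \<delta>" if "\<And>u. u \<in> {0..1} \<Longrightarrow> \<bar>z u - z' u\<bar> \<le> \<delta>" "t \<in> {0..1}" for z z' \<delta> and t :: real
  proof -
    have "\<bar>?c * z t - ?c * z' t\<bar> = ?c * \<bar>z t - z' t\<bar>"
      using c by (simp add: right_diff_distrib[symmetric] abs_mult)
    also have "\<dots> \<le> 1 * \<bar>z t - z' t\<bar>" using c by (intro mult_right_mono) auto
    finally show ?thesis using that(1)[OF that(2)] by simp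
  qed
  show "continuous_on {0..1} (\<lambda>t::real. ?c * 1)" by simp
  show "continuous_on {0..1} (\<lambda>t. ?c * z t)" if "lipschitz_from_0 L z" for L z
    by (intro continuous_intros lipschitz_from_0_continuous[OF that])
  show "\<forall>\<^sub>F n in sequentially. \<forall>t\<in>{0..1}. \<bar>discrete_average (\<lambda>n i. weight_diff M i / M (real n)) n z t - ?c * z t\<bar> \<le> \<epsilon>"
    if z: "lipschitz_from_0 L z" and \<epsilon>: "\<epsilon> > 0" for L z \<epsilon>
  proof (rule discrete_average_tendsto[where G = "\<lambda>x. if x = 0 then 0 else ?c" and M = M, OF _ _ _ _ _ z \<epsilon>])
    show "(\<lambda>n. (M (real (n * l div N)) - M 0) / M (real n)) \<longlonglongrightarrow> (if real l / real N = 0 then 0 else ?c)"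
      if "N \<ge> 1" "l \<le> N" for N l
      using weight_class_ratio_0[OF M that] .
    fix N :: nat and t :: real assume N: "N \<ge> 1"
    have "(\<Sum>l<N. ((if real (Suc l) / real N = 0 then 0 else ?c) - (if real l / real N = 0 then 0 else ?c)) * z (t - real l / real N))
      = (\<Sum>l<N. if l = 0 then ?c * z t else 0)"
      using N by (intro sum.cong) auto
    also have "\<dots> = ?c * z t" using N by simp
    finally show "\<bar>?c * z t - (\<Sum>l<N. ((if real (Suc l) / real N = 0 then 0 else ?c) - (if real l / real N = 0 then 0 else ?c)) * z (t - real l / real N))\<bar> \<le> L / real N"
      using lipschitz_from_0_nonneg[OF z] by simp
  qed (use weight_class_diff_nonneg[OF M order_refl] weight_class_diff_sum[OF M order_refl] in auto)
qed

definition fractional_average :: "real \<Rightarrow> (real \<Rightarrow> real) \<Rightarrow> real \<Rightarrow> real" where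
  "fractional_average \<nu> z t = \<nu> * (LINT s:{0..t}|lborel. z (t - s) * s powr (\<nu> - 1))"

lemma set_integrable_powr:
  fixes \<nu> t :: real
  assumes "\<nu> > 0" "t \<ge> 0"
  shows "set_integrable lborel {0..t} (\<lambda>s. s powr (\<nu> - 1))"
    and "(LINT s:{0..t}|lborel. s powr (\<nu> - 1)) = t powr \<nu> / \<nu>"
proof -
  have hi: "((\<lambda>s. s powr (\<nu> - 1)) has_integral (t powr \<nu> / \<nu>)) {0..t}"
    using has_integral_powr_from_0[of "\<nu> - 1" t] assms by simp
  then have "set_integrable lebesgue {0..t} (\<lambda>s. s powr (\<nu> - 1))"
    by (intro nonnegative_absolutely_integrable_1) auto
  then show i: "set_integrable lborel {0..t} (\<lambda>s. s powr (\<nu> - 1))"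
    unfolding set_integrable_def by (subst (asm) integrable_completion) auto
  show "(LINT s:{0..t}|lborel. s powr (\<nu> - 1)) = t powr \<nu> / \<nu>"
    using set_borel_integral_eq_integral(2)[OF i] integral_unique[OF hi] by simp
qed

lemma fractional_average_integrable:
  fixes z :: "real \<Rightarrow> real"
  assumes \<nu>: "\<nu> > 0" and t: "t \<in> {0..1}" and z: "continuous_on {0..1} z"
  shows "set_integrable lborel {0..t} (\<lambda>s. z (t - s) * s powr (\<nu> - 1))"
proof -
  obtain B where B: "\<And>u. u \<in> {0..1} \<Longrightarrow> \<bar>z u\<bar> \<le> B"
    using compact_imp_bounded[OF compact_continuous_image[OF z compact_Icc]]
    unfolding bounded_iff by (metis imageI real_norm_def)
  have B0: "B \<ge> 0" using B[of 0] by (smt (verit) atLeastAtMost_iff)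
  have zc: "continuous_on {0..t} (\<lambda>s. z (t - s))"
    using t by (intro continuous_on_compose2[OF z] continuous_intros) auto
  have "set_integrable lborel {0..t} (\<lambda>s. B * s powr (\<nu> - 1))"
    using set_integrable_powr(1)[OF \<nu>, of t] t by simp
  then show ?thesis
  proof (rule set_integrable_bound)
    have "(\<lambda>s. indicator {0..t} s *\<^sub>R z (t - s)) \<in> borel_measurable borel"
      by (rule borel_measurable_continuous_on_indicator[OF _ zc]) auto
    then have "(\<lambda>s. (indicator {0..t} s *\<^sub>R z (t - s)) * s powr (\<nu> - 1)) \<in> borel_measurable borel"
      by measurable
    then show "set_borel_measurable lborel {0..t} (\<lambda>s. z (t - s) * s powr (\<nu> - 1))"
      unfolding set_borel_measurable_def by (simp add: mult.assoc)
    show "AE s\<in>{0..t} in lborel. norm (z (t - s) * s powr (\<nu> - 1)) \<le> norm (B * s powr (\<nu> - 1))"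
      using B B0 t by (intro AE_I2) (auto simp: abs_mult intro!: mult_right_mono)
  qed
qed

lemma fractional_average_contraction:
  assumes \<nu>: "\<nu> > 0" and t: "t \<in> {0..1}" and z: "continuous_on {0..1} z" "continuous_on {0..1} z'"
    and d: "\<And>u. u \<in> {0..1} \<Longrightarrow> \<bar>z u - z' u\<bar> \<le> \<delta>"
  shows "\<bar>fractional_average \<nu> z t - fractional_average \<nu> z' t\<bar> \<le> \<delta>"
proof -
  note i = fractional_average_integrable[OF \<nu> t z(1)] fractional_average_integrable[OF \<nu> t z(2)]
  have \<delta>: "\<delta> \<ge> 0" using d[of 0] by (smt (verit) atLeastAtMost_iff)
  have ik: "set_integrable lborel {0..t} (\<lambda>s. \<delta> * s powr (\<nu> - 1))"
    using set_integrable_powr(1)[OF \<nu>, of t] t by simp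
  have "\<bar>(LINT s:{0..t}|lborel. z (t - s) * s powr (\<nu> - 1)) - (LINT s:{0..t}|lborel. z' (t - s) * s powr (\<nu> - 1))\<bar>
    = \<bar>LINT s:{0..t}|lborel. z (t - s) * s powr (\<nu> - 1) - z' (t - s) * s powr (\<nu> - 1)\<bar>"
    using i by (simp add: set_integral_diff)
  also have "\<dots> \<le> (LINT s:{0..t}|lborel. \<delta> * s powr (\<nu> - 1))"
  proof -
    let ?g = "\<lambda>s. indicator {0..t} s *\<^sub>R (z (t - s) * s powr (\<nu> - 1) - z' (t - s) * s powr (\<nu> - 1))"
    have "norm (integral\<^sup>L lborel ?g) \<le> (LINT s|lborel. indicator {0..t} s *\<^sub>R (\<delta> * s powr (\<nu> - 1)))"
    proof (rule Bochner_Integration.integral_norm_bound_integral)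
      show "integrable lborel ?g"
        using set_integral_diff(1)[OF i] by (simp add: set_integrable_def)
      show "integrable lborel (\<lambda>s. indicator {0..t} s *\<^sub>R (\<delta> * s powr (\<nu> - 1)))"
        using ik by (simp add: set_integrable_def)
      fix s :: real
      show "norm (?g s) \<le> indicator {0..t} s *\<^sub>R (\<delta> * s powr (\<nu> - 1))"
      proof (cases "s \<in> {0..t}")
        case True
        then have "\<bar>z (t - s) - z' (t - s)\<bar> * s powr (\<nu> - 1) \<le> \<delta> * s powr (\<nu> - 1)"
          using t by (intro mult_right_mono d) auto
        then show ?thesis using True by (simp add: left_diff_distrib[symmetric] abs_mult)
      qed simp
    qed
    then show ?thesis unfolding set_lebesgue_integral_def real_norm_def .
  qed
  also have "\<dots> = \<delta> * (t powr \<nu> / \<nu>)"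
    using set_integrable_powr(2)[OF \<nu>, of t] t by simp
  finally have "\<nu> * \<bar>(LINT s:{0..t}|lborel. z (t - s) * s powr (\<nu> - 1)) - (LINT s:{0..t}|lborel. z' (t - s) * s powr (\<nu> - 1))\<bar>
    \<le> \<nu> * (\<delta> * (t powr \<nu> / \<nu>))" using \<nu> by (intro mult_left_mono) auto
  also have "\<dots> = \<delta> * t powr \<nu>" using \<nu> by simp
  also have "\<dots> \<le> \<delta> * 1" using \<nu> t \<delta> by (intro mult_left_mono) (auto simp: powr_le1)
  finally show ?thesis using \<nu> by (simp add: fractional_average_def right_diff_distrib[symmetric] abs_mult)
qed

lemma fractional_average_sum:
  assumes \<nu>: "\<nu> > 0" and t: "t \<in> {0..1}" and J: "finite J" and e: "\<And>j. j \<in> J \<Longrightarrow> continuous_on {0..1} (e j)"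
  shows "fractional_average \<nu> (\<lambda>u. \<Sum>j\<in>J. x j * e j u) t = (\<Sum>j\<in>J. x j * fractional_average \<nu> (e j) t)"
proof -
  have "(LINT s:{0..t}|lborel. (\<Sum>j\<in>J. x j * e j (t - s)) * s powr (\<nu> - 1))
    = (LINT s|lborel. (\<Sum>j\<in>J. x j * (indicator {0..t} s *\<^sub>R (e j (t - s) * s powr (\<nu> - 1)))))"
    unfolding set_lebesgue_integral_def
    by (intro Bochner_Integration.integral_cong refl) (simp add: sum_distrib_left sum_distrib_right mult_ac)
  also have "\<dots> = (\<Sum>j\<in>J. x j * (LINT s:{0..t}|lborel. e j (t - s) * s powr (\<nu> - 1)))"
    using fractional_average_integrable[OF \<nu> t e] unfolding set_integrable_def set_lebesgue_integral_def
    by (subst Bochner_Integration.integral_sum) auto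
  finally show ?thesis by (simp add: fractional_average_def sum_distrib_left mult_ac)
qed

lemma fractional_average_const:
  assumes \<nu>: "\<nu> > 0" and t: "t \<in> {0..1}"
  shows "fractional_average \<nu> (\<lambda>_. 1) t = t powr \<nu>"
  using set_integrable_powr(2)[OF \<nu>, of t] t \<nu> by (simp add: fractional_average_def)

lemma fractional_average_extend:
  assumes \<nu>: "\<nu> > 0" and t: "t \<in> {0..1}" and z: "lipschitz_from_0 L z"
  shows "(\<lambda>s. z (t - s) * s powr (\<nu> - 1)) integrable_on {0..1}"
    and "fractional_average \<nu> z t = \<nu> * integral {0..1} (\<lambda>s. z (t - s) * s powr (\<nu> - 1))"
proof -
  have eq: "indicator {0..1} s *\<^sub>R (z (t - s) * s powr (\<nu> - 1)) = indicator {0..t} s *\<^sub>R (z (t - s) * s powr (\<nu> - 1))" for s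
    using t z by (auto simp: indicator_def lipschitz_from_0_def)
  have i: "set_integrable lborel {0..1} (\<lambda>s. z (t - s) * s powr (\<nu> - 1))"
    using fractional_average_integrable[OF \<nu> t lipschitz_from_0_continuous[OF z]]
    unfolding set_integrable_def eq .
  then show "(\<lambda>s. z (t - s) * s powr (\<nu> - 1)) integrable_on {0..1}"
    by (rule set_borel_integral_eq_integral)
  show "fractional_average \<nu> z t = \<nu> * integral {0..1} (\<lambda>s. z (t - s) * s powr (\<nu> - 1))"
    using set_borel_integral_eq_integral(2)[OF i]
    unfolding fractional_average_def set_lebesgue_integral_def eq by simp
qed

lemma integral_powr_interval:
  fixes \<nu> a b :: real
  assumes \<nu>: "\<nu> > 0" and ab: "0 \<le> a" "a \<le> b"
  shows "(\<lambda>s. s powr (\<nu> - 1)) integrable_on {a..b}"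
    and "\<nu> * integral {a..b} (\<lambda>s. s powr (\<nu> - 1)) = b powr \<nu> - a powr \<nu>"
proof -
  have hi: "((\<lambda>s. s powr (\<nu> - 1)) has_integral (t powr \<nu> / \<nu>)) {0..t}" if "t \<ge> 0" for t
    using has_integral_powr_from_0[of "\<nu> - 1" t] \<nu> that by simp
  have i: "(\<lambda>s. s powr (\<nu> - 1)) integrable_on {0..b}" using hi[of b] ab by auto
  then show "(\<lambda>s. s powr (\<nu> - 1)) integrable_on {a..b}"
    by (rule integrable_on_subinterval) (use ab in auto)
  have "integral {0..a} (\<lambda>s. s powr (\<nu> - 1)) + integral {a..b} (\<lambda>s. s powr (\<nu> - 1)) = integral {0..b} (\<lambda>s. s powr (\<nu> - 1))"
    using ab i by (intro Henstock_Kurzweil_Integration.integral_combine) auto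
  then have "integral {a..b} (\<lambda>s. s powr (\<nu> - 1)) = b powr \<nu> / \<nu> - a powr \<nu> / \<nu>"
    using integral_unique[OF hi[of a]] integral_unique[OF hi[of b]] ab by simp
  then show "\<nu> * integral {a..b} (\<lambda>s. s powr (\<nu> - 1)) = b powr \<nu> - a powr \<nu>"
    using \<nu> by (simp add: right_diff_distrib)
qed

lemma fractional_average_lipschitz:
  assumes \<nu>: "\<nu> > 0" and z: "lipschitz_from_0 L z"
  shows "continuous_on {0..1} (fractional_average \<nu> z)"
proof -
  have "\<bar>fractional_average \<nu> z t - fractional_average \<nu> z t'\<bar> \<le> L * \<bar>t - t'\<bar>" if t: "t \<in> {0..1}" "t' \<in> {0..1}" for t t'
  proof -
    note i = fractional_average_extend(1)[OF \<nu> t(1) z] fractional_average_extend(1)[OF \<nu> t(2) z]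
    note k = integral_powr_interval[OF \<nu>, of 0 1, simplified]
    have "norm (integral {0..1} (\<lambda>s. z (t - s) * s powr (\<nu> - 1) - z (t' - s) * s powr (\<nu> - 1)))
      \<le> integral {0..1} (\<lambda>s. (L * \<bar>t - t'\<bar>) * s powr (\<nu> - 1))"
    proof (rule Henstock_Kurzweil_Integration.integral_norm_bound_integral)
      fix s :: real
      have "\<bar>z (t - s) - z (t' - s)\<bar> \<le> L * \<bar>(t - s) - (t' - s)\<bar>"
        using z unfolding lipschitz_from_0_def by blast
      then have "\<bar>z (t - s) - z (t' - s)\<bar> * s powr (\<nu> - 1) \<le> (L * \<bar>t - t'\<bar>) * s powr (\<nu> - 1)"
        by (intro mult_right_mono) auto
      then show "norm (z (t - s) * s powr (\<nu> - 1) - z (t' - s) * s powr (\<nu> - 1)) \<le> (L * \<bar>t - t'\<bar>) * s powr (\<nu> - 1)"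
        by (simp add: left_diff_distrib[symmetric] abs_mult)
      show "(\<lambda>s. (L * \<bar>t - t'\<bar>) * s powr (\<nu> - 1)) integrable_on {0..1}"
        using integrable_cmul[OF k(1), of "L * \<bar>t - t'\<bar>"] by simp
    qed (intro integrable_diff i)
    then have "\<nu> * \<bar>integral {0..1} (\<lambda>s. z (t - s) * s powr (\<nu> - 1)) - integral {0..1} (\<lambda>s. z (t' - s) * s powr (\<nu> - 1))\<bar>
      \<le> \<nu> * ((L * \<bar>t - t'\<bar>) * integral {0..1} (\<lambda>s. s powr (\<nu> - 1)))"
      using i \<nu> by (intro mult_left_mono) (auto simp: Henstock_Kurzweil_Integration.integral_diff)
    also have "\<dots> = (L * \<bar>t - t'\<bar>) * (\<nu> * integral {0..1} (\<lambda>s. s powr (\<nu> - 1)))" by simp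
    also have "\<dots> = L * \<bar>t - t'\<bar>" using k(2) by simp
    finally show ?thesis using \<nu>
      unfolding fractional_average_extend(2)[OF \<nu> t(1) z] fractional_average_extend(2)[OF \<nu> t(2) z]
      by (simp add: right_diff_distrib[symmetric] abs_mult)
  qed
  then have "L-lipschitz_on {0..1} (fractional_average \<nu> z)"
    using lipschitz_from_0_nonneg[OF z] by (intro lipschitz_onI) (auto simp: dist_real_def)
  then show ?thesis by (rule lipschitz_on_continuous_on)
qed

lemma fractional_average_riemann_sum:
  assumes \<nu>: "\<nu> > 0" and z: "lipschitz_from_0 L z" and t: "t \<in> {0..1}" and N: "N \<ge> 1"
  shows "\<bar>fractional_average \<nu> z t - (\<Sum>l<N. ((real (Suc l) / real N) powr \<nu> - (real l / real N) powr \<nu>) * z (t - real l / real N))\<bar> \<le> L / real N"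
proof -
  define x where "x l = real l / real N" for l
  define f where "f s = z (t - s) * s powr (\<nu> - 1)" for s
  define \<Delta> where "\<Delta> l = x (Suc l) powr \<nu> - x l powr \<nu>" for l
  have x: "0 \<le> x l" "x l \<le> x (Suc l)" for l using N by (auto simp: x_def divide_right_mono)
  have x1: "x l \<le> 1" if "l \<le> N" for l using that N by (simp add: x_def)
  have L: "L \<ge> 0" by (rule lipschitz_from_0_nonneg[OF z])
  have f: "f integrable_on {0..1}" unfolding f_def by (rule fractional_average_extend(1)[OF \<nu> t z])
  have fsub: "f integrable_on {a..b}" if "0 \<le> a" "b \<le> 1" for a b
    by (rule integrable_on_subinterval[OF f]) (use that in auto)
  have telescope: "integral {0..x m} f = (\<Sum>l<m. integral {x l..x (Suc l)} f)" if "m \<le> N" for m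
    using that
  proof (induction m)
    case 0
    then show ?case by (simp add: x_def)
  next
    case (Suc m)
    then have "integral {0..x (Suc m)} f = integral {0..x m} f + integral {x m..x (Suc m)} f"
      using x x1[of "Suc m"] by (intro Henstock_Kurzweil_Integration.integral_combine[symmetric] fsub) auto
    then show ?case using Suc by simp
  qed
  have xN: "x N = 1" using N by (simp add: x_def)
  have cell: "\<bar>\<nu> * integral {x l..x (Suc l)} f - \<Delta> l * z (t - x l)\<bar> \<le> L / real N * \<Delta> l" if l: "l < N" for l
  proof -
    note k = integral_powr_interval[OF \<nu> x(1)[of l] x(2)]
    have i: "f integrable_on {x l..x (Suc l)}" using x x1[of "Suc l"] l by (intro fsub) auto
    have ik: "(\<lambda>s. c * s powr (\<nu> - 1)) integrable_on {x l..x (Suc l)}" for c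
      using integrable_cmul[OF k(1), of c] by simp
    have "norm (integral {x l..x (Suc l)} (\<lambda>s. f s - z (t - x l) * s powr (\<nu> - 1)))
      \<le> integral {x l..x (Suc l)} (\<lambda>s. (L / real N) * s powr (\<nu> - 1))"
    proof (rule Henstock_Kurzweil_Integration.integral_norm_bound_integral)
      show "(\<lambda>s. f s - z (t - x l) * s powr (\<nu> - 1)) integrable_on {x l..x (Suc l)}"
        by (intro integrable_diff i ik)
      show "(\<lambda>s. (L / real N) * s powr (\<nu> - 1)) integrable_on {x l..x (Suc l)}" by (rule ik)
      fix s assume s: "s \<in> {x l..x (Suc l)}"
      have "\<bar>z (t - s) - z (t - x l)\<bar> \<le> L * \<bar>(t - s) - (t - x l)\<bar>"
        using z unfolding lipschitz_from_0_def by blast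
      also have "\<dots> \<le> L * (1 / real N)"
      proof (rule mult_left_mono[OF _ L])
        have "x (Suc l) = x l + 1 / real N" by (simp add: x_def add_divide_distrib)
        then show "\<bar>(t - s) - (t - x l)\<bar> \<le> 1 / real N" using s by simp
      qed
      finally have "\<bar>z (t - s) - z (t - x l)\<bar> * s powr (\<nu> - 1) \<le> (L / real N) * s powr (\<nu> - 1)"
        by (intro mult_right_mono) auto
      then show "norm (f s - z (t - x l) * s powr (\<nu> - 1)) \<le> (L / real N) * s powr (\<nu> - 1)"
        by (simp add: f_def left_diff_distrib[symmetric] abs_mult)
    qed
    then have "\<bar>integral {x l..x (Suc l)} f - z (t - x l) * integral {x l..x (Suc l)} (\<lambda>s. s powr (\<nu> - 1))\<bar>
      \<le> (L / real N) * integral {x l..x (Suc l)} (\<lambda>s. s powr (\<nu> - 1))"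
      using i ik by (simp add: Henstock_Kurzweil_Integration.integral_diff)
    then have "\<nu> * \<bar>integral {x l..x (Suc l)} f - z (t - x l) * integral {x l..x (Suc l)} (\<lambda>s. s powr (\<nu> - 1))\<bar>
      \<le> \<nu> * ((L / real N) * integral {x l..x (Suc l)} (\<lambda>s. s powr (\<nu> - 1)))"
      using \<nu> by (intro mult_left_mono) auto
    also have "\<dots> = L / real N * \<Delta> l" using k(2) by (simp add: \<Delta>_def)
    also have "\<nu> * \<bar>integral {x l..x (Suc l)} f - z (t - x l) * integral {x l..x (Suc l)} (\<lambda>s. s powr (\<nu> - 1))\<bar>
      = \<bar>\<nu> * integral {x l..x (Suc l)} f - z (t - x l) * (\<nu> * integral {x l..x (Suc l)} (\<lambda>s. s powr (\<nu> - 1)))\<bar>"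
    proof -
      have "\<nu> * \<bar>A - y * B\<bar> = \<bar>\<nu> * A - y * (\<nu> * B)\<bar>" for A B y
      proof -
        have "\<nu> * \<bar>A - y * B\<bar> = \<bar>\<nu> * (A - y * B)\<bar>" using \<nu> by (simp add: abs_mult)
        then show ?thesis by (simp add: algebra_simps)
      qed
      then show ?thesis .
    qed
    finally show ?thesis unfolding k(2) by (simp add: \<Delta>_def mult.commute)
  qed
  have "fractional_average \<nu> z t = (\<Sum>l<N. \<nu> * integral {x l..x (Suc l)} f)"
    unfolding fractional_average_extend(2)[OF \<nu> t z] f_def[symmetric]
    using telescope[of N] xN by (simp add: sum_distrib_left)
  then have "\<bar>fractional_average \<nu> z t - (\<Sum>l<N. \<Delta> l * z (t - x l))\<bar> \<le> (\<Sum>l<N. L / real N * \<Delta> l)"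
    using cell by (simp add: sum_subtractf[symmetric]) (intro order_trans[OF sum_abs] sum_mono, auto)
  also have "\<dots> = L / real N * (\<Sum>l<N. \<Delta> l)" by (simp add: sum_distrib_left)
  also have "(\<Sum>l<N. \<Delta> l) = 1"
    using sum_lessThan_telescope[of "\<lambda>l. x l powr \<nu>" N] xN by (simp add: \<Delta>_def x_def)
  finally show ?thesis by (simp add: \<Delta>_def x_def)
qed

lemma limit_operator_pos:
  assumes M: "M \<in> weight_class \<nu>" and \<nu>: "\<nu> > 0"
  shows "limit_operator (\<lambda>n i. weight_diff M i / M (real n)) (fractional_average \<nu>)"
proof
  have \<nu>0: "\<nu> \<ge> 0" using \<nu> by simp
  note w = weight_class_diff_nonneg[OF M \<nu>0] weight_class_diff_sum[OF M \<nu>0]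
  show "weight_diff M i / M (real n) \<ge> 0" "(\<Sum>i<n. weight_diff M i / M (real n)) \<le> 1" for n i
    by (rule w)+
  show "fractional_average \<nu> (\<lambda>u. \<Sum>j\<in>J. x j * e j u) t = (\<Sum>j\<in>J. x j * fractional_average \<nu> (e j) t)"
    if "finite J" "\<And>j. j \<in> J \<Longrightarrow> continuous_on {0..1} (e j)" "t \<in> {0..1}" for J :: "nat set" and e t x
    using fractional_average_sum[OF \<nu> that(3,1,2)] .
  show "\<bar>fractional_average \<nu> z t - fractional_average \<nu> z' t\<bar> \<le> \<delta>"
    if "continuous_on {0..1} z" "continuous_on {0..1} z'" "\<And>u. u \<in> {0..1} \<Longrightarrow> \<bar>z u - z' u\<bar> \<le> \<delta>" "t \<in> {0..1}" for z z' \<delta> t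
    using fractional_average_contraction[OF \<nu> that(4,1,2,3)] .
  have "continuous_on {0..1} (\<lambda>t::real. t powr \<nu>)"
    using \<nu> by (intro continuous_on_powr' continuous_intros) auto
  then show "continuous_on {0..1} (fractional_average \<nu> (\<lambda>_. 1))"
    by (subst continuous_on_cong[OF refl fractional_average_const[OF \<nu>]]) auto
  show "continuous_on {0..1} (fractional_average \<nu> z)" if "lipschitz_from_0 L z" for L z
    by (rule fractional_average_lipschitz[OF \<nu> that])
  show "\<forall>\<^sub>F n in sequentially. \<forall>t\<in>{0..1}. \<bar>discrete_average (\<lambda>n i. weight_diff M i / M (real n)) n z t - fractional_average \<nu> z t\<bar> \<le> \<epsilon>"
    if z: "lipschitz_from_0 L z" and \<epsilon>: "\<epsilon> > 0" for L z \<epsilon>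
    using weight_class_ratio_pos[OF M \<nu>] fractional_average_riemann_sum[OF \<nu> z]
    by (intro discrete_average_tendsto[where G = "\<lambda>x. x powr \<nu>" and M = M, OF _ _ _ _ _ z \<epsilon>] w) auto
qed

section \<open>Partial sums and fractional Brownian motion\<close>

lemma normal_law_affine:
  assumes "\<sigma> \<ge> 0"
  shows "normal_law m \<sigma> = distr std_normal_distribution borel (\<lambda>x. m + \<sigma> * x)"
proof (cases "\<sigma> = 0")
  case True
  interpret real_distribution std_normal_distribution by (rule real_dist_normal_dist)
  show ?thesis using True by (simp add: normal_law_def distr_const)
next
  case False
  interpret real_distribution std_normal_distribution by (rule real_dist_normal_dist)
  have "distributed std_normal_distribution lborel (\<lambda>x. x) std_normal_density"
    by (simp add: distributed_def distr_id2)
  from normal_density_affine[OF this, of \<sigma> m] False assms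
  have "distributed std_normal_distribution lborel (\<lambda>x. m + \<sigma> * x) (normal_density m \<sigma>)" by simp
  then have "distr std_normal_distribution lborel (\<lambda>x. m + \<sigma> * x) = density lborel (normal_density m \<sigma>)"
    by (rule distributed_distr_eq_density[symmetric, THEN sym])
  then show ?thesis using False by (simp add: normal_law_def cong: distr_cong)
qed

lemma gaussian_moments:
  assumes N: "prob_space N" and U[measurable]: "U \<in> borel_measurable N"
    and d: "distr N borel U = normal_law m \<sigma>" and \<sigma>: "\<sigma> \<ge> 0"
  shows gaussian_square_integrable: "integrable N (\<lambda>\<omega>. (U \<omega>)\<^sup>2)"
    and gaussian_char: "(\<integral>\<omega>. U \<omega> \<partial>N) = 0 \<Longrightarrow> char (distr N borel U) 1 = exp (- ((\<integral>\<omega>. (U \<omega>)\<^sup>2 \<partial>N) / 2))"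
proof -
  interpret N: prob_space N by fact
  interpret S: real_distribution std_normal_distribution by (rule real_dist_normal_dist)
  have eq: "distr N borel U = distr std_normal_distribution borel (\<lambda>x. m + \<sigma> * x)"
    using d normal_law_affine[OF \<sigma>] by simp
  have i1: "integrable std_normal_distribution (\<lambda>x. x)" and e1: "(\<integral>x. x \<partial>std_normal_distribution) = 0"
    using integrable_std_normal_distribution_moment[of 1] integral_std_normal_distribution_moment_odd[of 1] by auto
  have i2: "integrable std_normal_distribution (\<lambda>x. x\<^sup>2)" and e2: "(\<integral>x. x\<^sup>2 \<partial>std_normal_distribution) = 1"
    using integrable_std_normal_distribution_moment[of 2] std_normal_distribution_even_moments(1)[of 1] by auto
  have sq: "(m + \<sigma> * x)\<^sup>2 = m\<^sup>2 + 2 * m * \<sigma> * x + \<sigma>\<^sup>2 * x\<^sup>2" for x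
    by (simp add: power2_sum power_mult_distrib)
  have isq: "integrable std_normal_distribution (\<lambda>x. (m + \<sigma> * x)\<^sup>2)"
    unfolding sq using i1 i2 by simp
  then have "integrable (distr N borel U) (\<lambda>x. x\<^sup>2)" unfolding eq by (simp add: integrable_distr_eq)
  then show "integrable N (\<lambda>\<omega>. (U \<omega>)\<^sup>2)" by (simp add: integrable_distr_eq)
  assume 0: "(\<integral>\<omega>. U \<omega> \<partial>N) = 0"
  have "(\<integral>\<omega>. U \<omega> \<partial>N) = (\<integral>x. x \<partial>distr N borel U)" by (simp add: integral_distr)
  also have "\<dots> = (\<integral>x. m + \<sigma> * x \<partial>std_normal_distribution)" unfolding eq by (simp add: integral_distr)
  also have "\<dots> = m" using i1 e1 S.prob_space by simp
  finally have m: "m = 0" using 0 by simp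
  have "(\<integral>\<omega>. (U \<omega>)\<^sup>2 \<partial>N) = (\<integral>x. x\<^sup>2 \<partial>distr N borel U)" by (simp add: integral_distr)
  also have "\<dots> = (\<integral>x. (m + \<sigma> * x)\<^sup>2 \<partial>std_normal_distribution)" unfolding eq by (simp add: integral_distr)
  also have "\<dots> = \<sigma>\<^sup>2" using e2 by (simp add: m power_mult_distrib)
  finally have v: "(\<integral>\<omega>. (U \<omega>)\<^sup>2 \<partial>N) = \<sigma>\<^sup>2" .
  have "char (distr N borel U) 1 = char std_normal_distribution \<sigma>"
    unfolding eq by (simp add: char_def integral_distr m)
  then show "char (distr N borel U) 1 = exp (- ((\<integral>\<omega>. (U \<omega>)\<^sup>2 \<partial>N) / 2))"
    by (simp add: v char_std_normal_distribution)
qed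

definition fbm_variance :: "real \<Rightarrow> nat \<Rightarrow> (nat \<Rightarrow> real) \<Rightarrow> real" where
  "fbm_variance H m c = (\<Sum>i\<le>m. \<Sum>j\<le>m. c i * c j * (((real i / real m) powr (2 * H) + (real j / real m) powr (2 * H)
     - \<bar>real i / real m - real j / real m\<bar> powr (2 * H)) / 2))"

lemma fbm_facts:
  assumes B: "fractional_brownian_motion N H B"
  shows fbm_prob: "prob_space N"
    and fbm_measurable: "t \<ge> 0 \<Longrightarrow> B t \<in> borel_measurable N"
    and fbm_integrable: "t \<ge> 0 \<Longrightarrow> integrable N (B t)"
    and fbm_continuous: "\<omega> \<in> space N \<Longrightarrow> continuous_on {0..} (\<lambda>t. B t \<omega>)"
    and fbm_char: "m \<ge> 1 \<Longrightarrow> char (distr N borel (\<lambda>\<omega>. \<Sum>j\<le>m. c j * B (real j / real m) \<omega>)) 1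
      = exp (- (fbm_variance H m c / 2))"
proof -
  show N: "prob_space N" using B by (simp add: fractional_brownian_motion_def)
  interpret prob_space N by fact
  have G: "gaussian_process N {0..} B" and mean: "\<And>t. t \<ge> 0 \<Longrightarrow> (\<integral>\<omega>. B t \<omega> \<partial>N) = 0"
    and cov: "\<And>s t. s \<ge> 0 \<Longrightarrow> t \<ge> 0 \<Longrightarrow> (\<integral>\<omega>. B s \<omega> * B t \<omega> \<partial>N)
        = (t powr (2 * H) + s powr (2 * H) - \<bar>t - s\<bar> powr (2 * H)) / 2"
    using B by (auto simp: fractional_brownian_motion_def)
  show "\<omega> \<in> space N \<Longrightarrow> continuous_on {0..} (\<lambda>t. B t \<omega>)"
    using B by (auto simp: fractional_brownian_motion_def)
  show meas: "B t \<in> borel_measurable N" if "t \<ge> 0" for t using G that by (simp add: gaussian_process_def)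
  have law: "\<exists>m \<sigma>. \<sigma> \<ge> 0 \<and> distr N borel (\<lambda>\<omega>. \<Sum>t\<in>F. c t * B t \<omega>) = normal_law m \<sigma>"
    if "finite F" "F \<subseteq> {0..}" for F c
    using G that unfolding gaussian_process_def by blast
  have sq: "integrable N (\<lambda>\<omega>. (B t \<omega>)\<^sup>2)" if t: "t \<ge> 0" for t
  proof -
    obtain m \<sigma> where "\<sigma> \<ge> 0" "distr N borel (\<lambda>\<omega>. \<Sum>t\<in>{t}. 1 * B t \<omega>) = normal_law m \<sigma>"
      using law[of "{t}" "\<lambda>_. 1"] t by auto
    then show ?thesis using gaussian_square_integrable[OF N meas[OF t]] by simp
  qed
  show int: "integrable N (B t)" if "t \<ge> 0" for t
    by (rule square_integrable_imp_integrable[OF meas sq]) (use that in auto)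
  assume m: "m \<ge> 1"
  define \<tau> where "\<tau> j = real j / real m" for j
  have inj: "inj_on \<tau> {..m}" using m by (auto simp: \<tau>_def inj_on_def)
  define c' where "c' t = c (inv_into {..m} \<tau> t)" for t
  have "(\<lambda>\<omega>. \<Sum>t\<in>\<tau> ` {..m}. c' t * B t \<omega>) = (\<lambda>\<omega>. \<Sum>j\<le>m. c j * B (\<tau> j) \<omega>)"
    by (intro ext) (simp add: sum.reindex[OF inj] c'_def inv_into_f_f[OF inj])
  moreover obtain \<mu> \<sigma> where "\<sigma> \<ge> 0" "distr N borel (\<lambda>\<omega>. \<Sum>t\<in>\<tau> ` {..m}. c' t * B t \<omega>) = normal_law \<mu> \<sigma>"
  proof -
    have "\<tau> ` {..m} \<subseteq> {0..}" by (auto simp: \<tau>_def)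
    then show ?thesis using law[of "\<tau> ` {..m}" c'] that by blast
  qed
  ultimately have d: "\<sigma> \<ge> 0" "distr N borel (\<lambda>\<omega>. \<Sum>j\<le>m. c j * B (\<tau> j) \<omega>) = normal_law \<mu> \<sigma>" by auto
  have \<tau>0: "\<tau> j \<ge> 0" for j by (simp add: \<tau>_def)
  note [measurable] = meas[OF \<tau>0]
  have Um: "(\<lambda>\<omega>. \<Sum>j\<le>m. c j * B (\<tau> j) \<omega>) \<in> borel_measurable N" by measurable
  have U0: "(\<integral>\<omega>. (\<Sum>j\<le>m. c j * B (\<tau> j) \<omega>) \<partial>N) = 0" using int mean \<tau>0 by simp
  have prod: "integrable N (\<lambda>\<omega>. B (\<tau> i) \<omega> * B (\<tau> j) \<omega>)" for i j
    by (intro integrable_mult_of_squares sq meas \<tau>0)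
  have "(\<Sum>j\<le>m. c j * B (\<tau> j) \<omega>)\<^sup>2 = (\<Sum>i\<le>m. \<Sum>j\<le>m. c i * c j * (B (\<tau> i) \<omega> * B (\<tau> j) \<omega>))" for \<omega>
    by (simp add: power2_eq_square sum_product mult_ac)
  then have "(\<integral>\<omega>. (\<Sum>j\<le>m. c j * B (\<tau> j) \<omega>)\<^sup>2 \<partial>N) = (\<Sum>i\<le>m. \<Sum>j\<le>m. c i * c j * (\<integral>\<omega>. B (\<tau> i) \<omega> * B (\<tau> j) \<omega> \<partial>N))"
    using prod by simp
  also have "\<dots> = fbm_variance H m c"
    unfolding fbm_variance_def cov[OF \<tau>0 \<tau>0]
    by (simp add: \<tau>_def abs_minus_commute add.commute)
  finally show "char (distr N borel (\<lambda>\<omega>. \<Sum>j\<le>m. c j * B (real j / real m) \<omega>)) 1 = exp (- (fbm_variance H m c / 2))"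
    using gaussian_char[OF N Um d(2,1) U0] by (simp add: \<tau>_def)
qed

locale linear_noise = white_noise P \<xi> for P :: "'a measure" and \<xi> +
  fixes a :: "int \<Rightarrow> real" and X :: "int \<Rightarrow> 'a \<Rightarrow> real"
  assumes a_square: "(\<lambda>k. (a k)\<^sup>2) summable_on UNIV"
    and X_linear: "linear_process P a \<xi> X"
begin

definition S :: "nat \<Rightarrow> 'a \<Rightarrow> real" where "S n = partial_sum X n"

definition coeff :: "nat \<Rightarrow> int \<Rightarrow> real" where "coeff n k = (\<Sum>l=1..n. a (int l - k))"

definition sd :: "nat \<Rightarrow> real" where "sd n = sqrt (expectation (\<lambda>\<omega>. (S n \<omega>)\<^sup>2))"

lemma lin_S: "lin (coeff n) (S n)"
proof -
  have "lin (\<lambda>k. a (j - k)) (X j)" for j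
    using X_linear by (simp add: linear_process_def)
  from lin_sum[of "{1..n}" "\<lambda>l k. a (int l - k)" "\<lambda>l. X (int l)" "\<lambda>_. 1", OF this]
  show ?thesis by (simp add: coeff_def[abs_def] S_def partial_sum_def[abs_def])
qed

lemma S_measurable[measurable]: "S n \<in> borel_measurable P"
  by (rule linD[OF lin_S])

lemma S_0: "S 0 = (\<lambda>_. 0)" by (simp add: S_def partial_sum_def fun_eq_iff)

lemma sd_nonneg: "sd n \<ge> 0" by (simp add: sd_def)

lemma sd_square: "(sd n)\<^sup>2 = expectation (\<lambda>\<omega>. (S n \<omega>)\<^sup>2)" by (simp add: sd_def)

lemma coeff_diff:
  assumes "p \<le> q"
  shows "coeff q k - coeff p k = coeff (q - p) (k - int p)"
proof -
  have "coeff q k = coeff p k + (\<Sum>l=p+1..q. a (int l - k))"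
  proof -
    have "{1..q} = {1..p} \<union> {p+1..q}" using assms by auto
    then show ?thesis unfolding coeff_def by (simp only:) (rule sum.union_disjoint, auto)
  qed
  also have "(\<Sum>l=p+1..q. a (int l - k)) = (\<Sum>l=1..q-p. a (int (l + p) - k))"
    by (rule sum.reindex_bij_witness[of _ "\<lambda>l. l + p" "\<lambda>l. l - p"]) (use assms in auto)
  also have "\<dots> = coeff (q - p) (k - int p)"
    unfolding coeff_def by (intro sum.cong) (auto simp: algebra_simps)
  finally show ?thesis by simp
qed

lemma increment_second_moment:
  assumes "p \<le> q"
  shows "expectation (\<lambda>\<omega>. (S q \<omega> - S p \<omega>)\<^sup>2) = (sd (q - p))\<^sup>2"
proof -
  have "((\<lambda>k. (coeff q k - coeff p k)\<^sup>2) has_sum expectation (\<lambda>\<omega>. (S q \<omega> - S p \<omega>)\<^sup>2)) UNIV"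
    by (rule lin_second_moment[OF lin_diff[OF lin_S lin_S]])
  then have 1: "((\<lambda>k. (coeff (q - p) (k - int p))\<^sup>2) has_sum expectation (\<lambda>\<omega>. (S q \<omega> - S p \<omega>)\<^sup>2)) UNIV"
    by (simp add: coeff_diff[OF assms])
  have bij: "bij_betw (\<lambda>k. k - int p) UNIV UNIV"
    by (rule bij_betwI[where g = "\<lambda>k. k + int p"]) auto
  have "((\<lambda>k. (coeff (q - p) (k - int p))\<^sup>2) has_sum (sd (q - p))\<^sup>2) UNIV"
    unfolding sd_square has_sum_reindex_bij_betw[OF bij, of "\<lambda>k. (coeff (q - p) k)\<^sup>2"]
    by (rule lin_second_moment[OF lin_S])
  then show ?thesis using 1 has_sum_unique by blast
qed

lemma covariance:
  "integrable P (\<lambda>\<omega>. S p \<omega> * S q \<omega>)"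
  "expectation (\<lambda>\<omega>. S p \<omega> * S q \<omega>) = ((sd p)\<^sup>2 + (sd q)\<^sup>2 - (sd (if p \<le> q then q - p else p - q))\<^sup>2) / 2"
proof -
  show i: "integrable P (\<lambda>\<omega>. S p \<omega> * S q \<omega>)"
    by (intro integrable_mult_of_squares lin_square_integrable(1)[OF lin_S]) auto
  have "expectation (\<lambda>\<omega>. (S q \<omega> - S p \<omega>)\<^sup>2) = (sd q)\<^sup>2 + (sd p)\<^sup>2 - 2 * expectation (\<lambda>\<omega>. S p \<omega> * S q \<omega>)"
    using i lin_square_integrable(1)[OF lin_S] by (simp add: power2_diff sd_square mult_ac)
  moreover have "expectation (\<lambda>\<omega>. (S q \<omega> - S p \<omega>)\<^sup>2) = (sd (if p \<le> q then q - p else p - q))\<^sup>2"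
    using increment_second_moment[of p q] increment_second_moment[of q p]
    by (auto simp: power2_commute)
  ultimately show "expectation (\<lambda>\<omega>. S p \<omega> * S q \<omega>) = ((sd p)\<^sup>2 + (sd q)\<^sup>2 - (sd (if p \<le> q then q - p else p - q))\<^sup>2) / 2"
    by simp
qed

lemma sd_diff: "\<bar>sd (m + n) - sd m\<bar> \<le> sd n"
proof -
  have inc: "sqrt (expectation (\<lambda>\<omega>. (S (m + n) \<omega> - S m \<omega>)\<^sup>2)) = sd n"
    using increment_second_moment[of m "m + n"] sd_nonneg by simp
  have "sd (m + n) \<le> sd m + sd n"
    using lin_norm_triangle[OF lin_S[of m] lin_diff[OF lin_S[of "m + n"] lin_S[of m]]] inc
    by (simp add: sd_def)
  moreover have "sqrt (expectation (\<lambda>\<omega>. (S m \<omega> - S (m + n) \<omega>)\<^sup>2)) = sd n"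
    using inc by (simp add: power2_commute)
  then have "sd m \<le> sd (m + n) + sd n"
    using lin_norm_triangle[OF lin_S[of "m + n"] lin_diff[OF lin_S[of m] lin_S[of "m + n"]]]
    by (simp add: sd_def)
  ultimately show ?thesis by simp
qed

lemma a_bounded: "\<exists>A. \<forall>k. \<bar>a k\<bar> \<le> A"
proof (intro exI allI)
  fix k
  have "(a k)\<^sup>2 = (\<Sum>\<^sub>\<infinity>k\<in>{k}. (a k)\<^sup>2)" by simp
  also have "\<dots> \<le> (\<Sum>\<^sub>\<infinity>k. (a k)\<^sup>2)"
    by (rule infsum_mono_neutral) (auto simp: a_square)
  finally show "\<bar>a k\<bar> \<le> sqrt (\<Sum>\<^sub>\<infinity>k. (a k)\<^sup>2)" by (intro real_le_rsqrt) simp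
qed

text \<open>
  Neighbouring coefficients differ by at most \<open>2 * A\<close>, so a large coefficient is accompanied by
  \<open>L\<close> large ones, whose squares sum up to at most \<open>(sd n)\<^sup>2\<close>.
\<close>

lemma coeff_bound:
  assumes A: "\<And>k. \<bar>a k\<bar> \<le> A" and L: "L \<ge> 1"
  shows "\<bar>coeff n k\<bar> \<le> sd n / sqrt (real L) + 2 * A * real L"
proof -
  have A0: "A \<ge> 0" using A[of 0] by linarith
  have step: "\<bar>coeff n (k + 1) - coeff n k\<bar> \<le> 2 * A" for k
  proof -
    have "coeff n (k + 1) - coeff n k = a (- k) - a (int n - k)"
    proof (induction n)
      case (Suc n)
      have "coeff (Suc n) j = coeff n j + a (int (Suc n) - j)" for j by (simp add: coeff_def)
      moreover have "a (int (Suc n) - (k + 1)) = a (int n - k)" by (simp add: algebra_simps)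
      ultimately show ?case using Suc by simp
    qed (simp add: coeff_def)
    then show ?thesis using A[of "- k"] A[of "int n - k"] by linarith
  qed
  have near: "\<bar>coeff n (k + int i) - coeff n k\<bar> \<le> 2 * A * real i" for i
  proof (induction i)
    case (Suc i)
    have "k + int (Suc i) = (k + int i) + 1" by simp
    then show ?case using Suc step[of "k + int i"] by (simp only: of_nat_Suc distrib_left)
  qed simp
  define D where "D = \<bar>coeff n k\<bar> - 2 * A * real L"
  show ?thesis
  proof (cases "D \<le> 0")
    case True
    have "0 \<le> sd n / sqrt (real L)" using sd_nonneg by simp
    then show ?thesis using True unfolding D_def by linarith
  next
    case False
    have "D\<^sup>2 \<le> (coeff n (k + int i))\<^sup>2" if "i < L" for i
    proof -
      have "2 * A * real i \<le> 2 * A * real L" using A0 that by (intro mult_left_mono) auto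
      then have "D \<le> \<bar>coeff n (k + int i)\<bar>" using near[of i] unfolding D_def by linarith
      then have "D\<^sup>2 \<le> \<bar>coeff n (k + int i)\<bar>\<^sup>2" using False by (intro power_mono) auto
      then show ?thesis by simp
    qed
    then have "(\<Sum>i<L. D\<^sup>2) \<le> (\<Sum>i<L. (coeff n (k + int i))\<^sup>2)" by (intro sum_mono) auto
    also have "\<dots> = (\<Sum>j\<in>(\<lambda>i. k + int i) ` {..<L}. (coeff n j)\<^sup>2)"
      by (subst sum.reindex) (auto simp: inj_on_def)
    also have "\<dots> \<le> (sd n)\<^sup>2" unfolding sd_square by (intro lin_coeff_bound[OF lin_S]) auto
    finally have "(D * sqrt (real L))\<^sup>2 \<le> (sd n)\<^sup>2" by (simp add: power_mult_distrib mult.commute)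
    then have "D * sqrt (real L) \<le> sd n" using sd_nonneg by (rule power2_le_imp_le)
    then have "D \<le> sd n / sqrt (real L)" using L by (simp add: field_simps)
    then show ?thesis unfolding D_def by linarith
  qed
qed

lemma scaled_partial_sums_char:
  assumes reg: "regular_sequence sd H" and m: "m \<ge> 1"
  shows "(\<lambda>n. char (distr P borel (\<lambda>\<omega>. \<Sum>j\<le>m. c j * (S (n * j div m) \<omega> / sd n))) 1)
    \<longlonglongrightarrow> exp (- (fbm_variance H m c / 2))"
proof -
  interpret regular_sequence sd H by (rule reg)
  define k where "k n j = n * j div m" for n j
  define T where "T n \<omega> = (\<Sum>j\<le>m. c j * (S (k n j) \<omega> / sd n))" for n \<omega>
  define b where "b n i = (\<Sum>j\<le>m. c j / sd n * coeff (k n j) i)" for n i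
  have T_eq: "T n \<omega> = (\<Sum>j\<le>m. c j / sd n * S (k n j) \<omega>)" for n \<omega>
    unfolding T_def by (intro sum.cong) auto
  have linT: "lin (b n) (T n)" for n
    unfolding b_def[abs_def] T_eq[abs_def] by (intro lin_sum lin_S)
  define V where "V n = expectation (\<lambda>\<omega>. (T n \<omega>)\<^sup>2)" for n
  have km: "\<bar>real m * real (k n j) - real j * real n\<bar> \<le> real m" for n j
    unfolding k_def by (rule div_error[OF m])
  have ratio: "(\<lambda>n. sd (k n j) / sd n) \<longlonglongrightarrow> (real j / real m) powr H" for j
    by (rule s_proportional[OF m km])
  define kd where "kd n i j = (if k n i \<le> k n j then k n j - k n i else k n i - k n j)" for n i j
  have ratio2: "(\<lambda>n. sd (kd n i j) / sd n) \<longlonglongrightarrow> \<bar>real i / real m - real j / real m\<bar> powr H" for i j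
  proof -
    define l where "l = (if i \<le> j then j - i else i - j)"
    have "(\<lambda>n. sd (kd n i j) / sd n) \<longlonglongrightarrow> (real l / real m) powr H"
    proof (rule s_proportional[OF m])
      fix n
      have mono: "k n i \<le> k n j" if "i \<le> j" for i j unfolding k_def using that by (intro div_le_mono) simp
      have le: "\<bar>real m * (real (k n j) - real (k n i)) - (real j - real i) * real n\<bar> \<le> 2 * real m" for i j
        using km[of n i] km[of n j] by (simp add: algebra_simps abs_le_iff)
      show "\<bar>real m * real (kd n i j) - real l * real n\<bar> \<le> 2 * real m"
      proof (cases "i \<le> j")
        case True
        then show ?thesis using mono[OF True] le[of j i] by (simp add: kd_def l_def of_nat_diff)
      next
        case False
        then have ji: "j \<le> i" by simp
        have "real (kd n i j) = real (k n i) - real (k n j)"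
          using mono[OF ji] by (auto simp: kd_def of_nat_diff)
        then show ?thesis using False le[of i j] by (simp add: l_def of_nat_diff)
      qed
    qed
    moreover have "real l / real m = \<bar>real i / real m - real j / real m\<bar>"
    proof -
      have "real l = \<bar>real i - real j\<bar>" by (auto simp: l_def of_nat_diff)
      then show ?thesis by (simp add: diff_divide_distrib[symmetric])
    qed
    ultimately show ?thesis by simp
  qed
  have Veq: "V n = (\<Sum>i\<le>m. \<Sum>j\<le>m. c i * c j * (((sd (k n i) / sd n)\<^sup>2 + (sd (k n j) / sd n)\<^sup>2 - (sd (kd n i j) / sd n)\<^sup>2) / 2))" for n
  proof -
    have "(T n \<omega>)\<^sup>2 = (\<Sum>i\<le>m. \<Sum>j\<le>m. (c i / sd n) * (c j / sd n) * (S (k n i) \<omega> * S (k n j) \<omega>))" for \<omega>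
      by (simp add: T_eq power2_eq_square sum_product mult_ac)
    then have "V n = (\<Sum>i\<le>m. \<Sum>j\<le>m. (c i / sd n) * (c j / sd n) * expectation (\<lambda>\<omega>. S (k n i) \<omega> * S (k n j) \<omega>))"
      unfolding V_def using covariance(1) by simp
    also have "\<dots> = (\<Sum>i\<le>m. \<Sum>j\<le>m. c i * c j * (((sd (k n i) / sd n)\<^sup>2 + (sd (k n j) / sd n)\<^sup>2 - (sd (kd n i j) / sd n)\<^sup>2) / 2))"
      unfolding covariance(2) kd_def
      by (intro sum.cong refl) (simp add: power_divide add_divide_distrib diff_divide_distrib power2_eq_square algebra_simps)
    finally show ?thesis .
  qed
  have Vlim: "V \<longlonglongrightarrow> fbm_variance H m c"
  proof -
    have sq: "x powr (2 * H) = (x powr H)\<^sup>2" for x :: real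
      by (simp add: power2_eq_square powr_add[symmetric])
    have "(\<lambda>n. \<Sum>i\<le>m. \<Sum>j\<le>m. c i * c j * (((sd (k n i) / sd n)\<^sup>2 + (sd (k n j) / sd n)\<^sup>2 - (sd (kd n i j) / sd n)\<^sup>2) / 2))
      \<longlonglongrightarrow> (\<Sum>i\<le>m. \<Sum>j\<le>m. c i * c j * ((((real i / real m) powr H)\<^sup>2 + ((real j / real m) powr H)\<^sup>2
     - (\<bar>real i / real m - real j / real m\<bar> powr H)\<^sup>2) / 2))"
      by (intro tendsto_intros ratio ratio2) auto
    then show ?thesis unfolding fbm_variance_def sq Veq[abs_def] .
  qed
  obtain A where A: "\<And>k. \<bar>a k\<bar> \<le> A" using a_bounded by blast
  have small: "\<forall>\<^sub>F n in sequentially. \<forall>i. \<bar>b n i\<bar> \<le> \<delta>" if \<delta>: "\<delta> > 0" for \<delta>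
  proof -
    define Q where "Q = (\<Sum>j\<le>m. \<bar>c j\<bar> * (real j / real m) powr H)"
    have "(\<lambda>L. Q * (1 / sqrt (real L))) \<longlonglongrightarrow> Q * 0"
      by (intro tendsto_mult tendsto_const) real_asymp
    then have "\<forall>\<^sub>F L in sequentially. Q * (1 / sqrt (real L)) < \<delta>"
      using \<delta> by (intro order_tendstoD) auto
    then have "\<forall>\<^sub>F L in sequentially. Q * (1 / sqrt (real L)) < \<delta> \<and> L \<ge> 1"
      using eventually_ge_at_top[of 1] by eventually_elim simp
    then obtain L where L: "Q * (1 / sqrt (real L)) < \<delta>" "L \<ge> 1"
      by (auto simp: eventually_sequentially)
    have "(\<lambda>n. 1 / sd n) \<longlonglongrightarrow> 0"
      using tendsto_inverse_0_at_top[OF s_at_top] by (simp add: inverse_eq_divide)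
    then have "(\<lambda>n. \<Sum>j\<le>m. \<bar>c j\<bar> * (sd (k n j) / sd n * (1 / sqrt (real L)) + 2 * A * real L * (1 / sd n)))
      \<longlonglongrightarrow> (\<Sum>j\<le>m. \<bar>c j\<bar> * ((real j / real m) powr H * (1 / sqrt (real L)) + 2 * A * real L * 0))"
      by (intro tendsto_intros ratio)
    also have "(\<Sum>j\<le>m. \<bar>c j\<bar> * ((real j / real m) powr H * (1 / sqrt (real L)) + 2 * A * real L * 0)) = Q * (1 / sqrt (real L))"
      by (simp add: Q_def sum_distrib_right sum_divide_distrib)
    finally have "\<forall>\<^sub>F n in sequentially. (\<Sum>j\<le>m. \<bar>c j\<bar> * (sd (k n j) / sd n * (1 / sqrt (real L)) + 2 * A * real L * (1 / sd n))) < \<delta>"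
      using L(1) by (rule order_tendstoD)
    then show ?thesis
    proof eventually_elim
      case (elim n)
      show ?case
      proof
        fix i
        have "\<bar>b n i\<bar> \<le> (\<Sum>j\<le>m. \<bar>c j / sd n * coeff (k n j) i\<bar>)" unfolding b_def by (rule sum_abs)
        also have "\<dots> \<le> (\<Sum>j\<le>m. \<bar>c j\<bar> * (sd (k n j) / sd n * (1 / sqrt (real L)) + 2 * A * real L * (1 / sd n)))"
        proof (rule sum_mono)
          fix j
          have "\<bar>c j / sd n * coeff (k n j) i\<bar> = \<bar>c j\<bar> * (\<bar>coeff (k n j) i\<bar> * (1 / sd n))"
            using sd_nonneg by (simp add: abs_mult)
          also have "\<dots> \<le> \<bar>c j\<bar> * ((sd (k n j) / sqrt (real L) + 2 * A * real L) * (1 / sd n))"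
            using sd_nonneg coeff_bound[OF A L(2)] by (intro mult_left_mono mult_right_mono) auto
          also have "\<dots> = \<bar>c j\<bar> * (sd (k n j) / sd n * (1 / sqrt (real L)) + 2 * A * real L * (1 / sd n))"
            by (simp add: add_divide_distrib distrib_right mult_ac)
          finally show "\<bar>c j / sd n * coeff (k n j) i\<bar> \<le> \<dots>" .
        qed
        finally show "\<bar>b n i\<bar> \<le> \<delta>" using elim by simp
      qed
    qed
  qed
  define Vl where "Vl = fbm_variance H m c"
  have Vl0: "Vl \<ge> 0" unfolding Vl_def
    by (rule LIMSEQ_le_const[OF Vlim]) (auto simp: V_def)
  have diff: "(\<lambda>n. char (distr P borel (T n)) 1 - of_real (exp (- (V n / 2)))) \<longlonglongrightarrow> 0"
  proof (rule tendstoI)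
    fix e :: real assume e: "e > 0"
    define e' where "e' = e / 2 / (Vl + 1)"
    have e': "e' > 0" using e Vl0 by (simp add: e'_def)
    obtain \<delta> where \<delta>: "\<delta> > 0" "\<And>b Y. lin b Y \<Longrightarrow> (\<And>k. \<bar>b k\<bar> \<le> \<delta>) \<Longrightarrow>
      cmod (char (distr P borel Y) 1 - exp (- (expectation (\<lambda>\<omega>. (Y \<omega>)\<^sup>2) / 2))) \<le> e' * expectation (\<lambda>\<omega>. (Y \<omega>)\<^sup>2)"
      using lin_char_gauss[OF e'] by blast
    have "\<forall>\<^sub>F n in sequentially. V n < Vl + 1" using order_tendstoD(2)[OF Vlim] Vl_def by simp
    then show "\<forall>\<^sub>F n in sequentially. dist (char (distr P borel (T n)) 1 - of_real (exp (- (V n / 2)))) 0 < e"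
      using small[OF \<delta>(1)]
    proof eventually_elim
      case (elim n)
      have "cmod (char (distr P borel (T n)) 1 - exp (- (V n / 2))) \<le> e' * V n"
        unfolding V_def using elim(2) by (intro \<delta>(2)[OF linT[of n]]) auto
      also have "\<dots> \<le> e' * (Vl + 1)" using elim(1) e' by (intro mult_left_mono) auto
      also have "\<dots> = e / 2"
      proof -
        have ne: "Vl + 1 \<noteq> 0" using Vl0 by simp
        show ?thesis by (simp only: nonzero_eq_divide_eq[OF ne, symmetric] e'_def)
      qed
      also have "\<dots> < e" using e by simp
      finally show ?case by simp
    qed
  qed
  have "(\<lambda>n. of_real (exp (- (V n / 2))) :: complex) \<longlonglongrightarrow> of_real (exp (- (Vl / 2)))"
    using Vlim unfolding Vl_def by (intro tendsto_intros) auto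
  from tendsto_add[OF diff this] show ?thesis
    by (simp add: T_def[abs_def] k_def Vl_def)
qed

end

section \<open>Functionals on the Skorokhod space\<close>

lemma uniform_ball_in_skorokhod_nbhd:
  assumes "y \<in> D01" "\<And>t. t \<in> {0..1} \<Longrightarrow> \<bar>y t - x t\<bar> < e"
  shows "y \<in> skorokhod_nbhd x e"
proof -
  have "e > 0" using assms(2)[of 0] by (smt (verit) atLeastAtMost_iff)
  moreover have "(\<lambda>t. t) \<in> time_changes" by (auto simp: time_changes_def strict_mono_on_def)
  ultimately show ?thesis using assms unfolding skorokhod_nbhd_def by force
qed

lemma step_path_D01: "(\<lambda>t\<in>{0..1}. f (nat \<lfloor>real n * t\<rfloor>)) \<in> D01"
proof -
  let ?x = "\<lambda>t\<in>{0..1}. f (nat \<lfloor>real n * t\<rfloor>)"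
  have right: "(?x \<longlongrightarrow> ?x t) (at_right t)" if t: "t \<in> {0..<1}" for t
  proof -
    obtain b where b: "b > t" "b \<le> 1" "\<And>s. t < s \<Longrightarrow> s < b \<Longrightarrow> \<lfloor>real n * s\<rfloor> = \<lfloor>real n * t\<rfloor>"
    proof (cases "n = 0")
      case True
      then show ?thesis using that[of 1] t by auto
    next
      case False
      define b where "b = min 1 ((of_int \<lfloor>real n * t\<rfloor> + 1) / real n)"
      have "real n * t < of_int \<lfloor>real n * t\<rfloor> + 1" by linarith
      then have "t < b" using t False by (simp add: b_def field_simps)
      moreover have "\<lfloor>real n * s\<rfloor> = \<lfloor>real n * t\<rfloor>" if "t < s" "s < b" for s
      proof (rule floor_unique)
        have "real n * t \<le> real n * s" using that by (intro mult_left_mono) auto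
        then show "of_int \<lfloor>real n * t\<rfloor> \<le> real n * s" by linarith
        have "s < (of_int \<lfloor>real n * t\<rfloor> + 1) / real n" using that by (simp add: b_def)
        then show "real n * s < of_int \<lfloor>real n * t\<rfloor> + 1" using False by (simp add: field_simps)
      qed
      ultimately show ?thesis using that[of b] by (auto simp: b_def)
    qed
    have "\<forall>\<^sub>F s in at_right t. ?x t = ?x s"
      unfolding eventually_at_right[OF b(1)] using b t by (intro exI[of _ b]) auto
    then show ?thesis by (rule Lim_transform_eventually[OF tendsto_const])
  qed
  have left: "\<exists>l. (?x \<longlongrightarrow> l) (at_left t)" if t: "t \<in> {0<..1}" for t
  proof -
    obtain b k where b: "b < t" "b \<ge> 0" "\<And>s. b < s \<Longrightarrow> s < t \<Longrightarrow> \<lfloor>real n * s\<rfloor> = k"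
    proof (cases "n = 0")
      case True
      then show ?thesis using that[of 0 0] t by auto
    next
      case False
      define k where "k = \<lceil>real n * t\<rceil> - 1"
      define b where "b = max 0 (of_int k / real n)"
      have "of_int k < real n * t" unfolding k_def by linarith
      then have "b < t" using t False by (simp add: b_def field_simps)
      moreover have "\<lfloor>real n * s\<rfloor> = k" if "b < s" "s < t" for s
      proof (rule floor_unique)
        have "of_int k / real n < s" using that by (simp add: b_def)
        then show "of_int k \<le> real n * s" using False by (simp add: field_simps)
        have "real n * s < real n * t" using that False by simp
        then show "real n * s < of_int k + 1" unfolding k_def by linarith
      qed
      ultimately show ?thesis using that[of b k] by (auto simp: b_def)
    qed
    have "\<forall>\<^sub>F s in at_left t. f (nat k) = ?x s"
      unfolding eventually_at_left[OF b(1)] using b t by (intro exI[of _ b]) auto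
    then show ?thesis by (intro exI) (rule Lim_transform_eventually[OF tendsto_const])
  qed
  show ?thesis using left right unfolding D01_def by (simp del: restrict_apply add: restrict_extensional)
qed

lemma continuous_path_D01:
  fixes x :: "real \<Rightarrow> real"
  assumes "continuous_on {0..1} x"
  shows "(\<lambda>t\<in>{0..1}. x t) \<in> D01"
proof -
  have lim: "((\<lambda>t\<in>{0..1}. x t) \<longlongrightarrow> x t) (at t within {0..1})" if "t \<in> {0..1}" for t
  proof -
    have "(x \<longlongrightarrow> x t) (at t within {0..1})" using assms that by (simp add: continuous_on_def)
    then show ?thesis
      by (rule Lim_transform_eventually) (auto simp: eventually_at_filter)
  qed
  have "((\<lambda>t\<in>{0..1}. x t) \<longlongrightarrow> x t) (at_right t)" if "t \<in> {0..<1}" for t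
    using tendsto_within_subset[OF lim[of t], of "{t..1}"] that
    by (simp add: at_within_Icc_at_right)
  moreover have "((\<lambda>t\<in>{0..1}. x t) \<longlongrightarrow> x t) (at_left t)" if "t \<in> {0<..1}" for t
    using tendsto_within_subset[OF lim[of t], of "{0..t}"] that
    by (simp add: at_within_Icc_at_left)
  moreover have "(\<lambda>t\<in>{0..1}. x t) t = x t" if "t \<in> {0..<1}" for t using that by simp
  ultimately show ?thesis unfolding D01_def
    by (intro CollectI conjI ballI restrict_extensional) (simp_all del: restrict_apply, blast)
qed

lemma measurable_skorokhodI:
  assumes "\<And>\<omega>. \<omega> \<in> space M \<Longrightarrow> f \<omega> \<in> D01"
    and "\<And>U. openin skorokhod_topology U \<Longrightarrow> {\<omega>\<in>space M. f \<omega> \<in> U} \<in> sets M"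
  shows "f \<in> measurable M skorokhod_borel"
  unfolding skorokhod_borel_def
proof (rule measurable_measure_of)
  show "{U. openin skorokhod_topology U} \<subseteq> Pow D01"
    using openin_subset[of skorokhod_topology] by (auto simp: topspace_skorokhod_topology)
  show "f -` U \<inter> space M \<in> sets M" if "U \<in> {U. openin skorokhod_topology U}" for U
    using assms(2)[of U] that by (simp add: vimage_def Int_def conj_commute)
qed (use assms(1) in auto)

lemma step_path_measurable:
  fixes Y :: "nat \<Rightarrow> 'a \<Rightarrow> real"
  assumes Y[measurable]: "\<And>i. Y i \<in> borel_measurable M"
  shows "(\<lambda>\<omega>. \<lambda>t\<in>{0..1}. Y (nat \<lfloor>real n * t\<rfloor>) \<omega>) \<in> measurable M skorokhod_borel"
proof (rule measurable_skorokhodI)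
  show "(\<lambda>t\<in>{0..1}. Y (nat \<lfloor>real n * t\<rfloor>) \<omega>) \<in> D01" for \<omega> by (rule step_path_D01)
  fix U assume U: "openin skorokhod_topology U"
  define V where "V = {v :: nat \<Rightarrow> real. (\<lambda>t\<in>{0..1}. v (nat \<lfloor>real n * t\<rfloor>)) \<in> U}"
  have "open V"
  proof (subst open_subopen, rule ballI)
    fix v assume v: "v \<in> V"
    then obtain e where e: "e > 0" "skorokhod_nbhd (\<lambda>t\<in>{0..1}. v (nat \<lfloor>real n * t\<rfloor>)) e \<subseteq> U"
      using U unfolding V_def openin_skorokhod_topology by blast
    define W where "W = (\<Inter>i\<in>{..n}. {v' :: nat \<Rightarrow> real. \<bar>v' i - v i\<bar> < e})"
    have "open W" unfolding W_def
    proof (intro open_INT ballI finite_atMost)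
      fix i
      have "continuous_on UNIV (\<lambda>v' :: nat \<Rightarrow> real. v' i)" by (rule continuous_on_product_coordinates)
      then show "open {v' :: nat \<Rightarrow> real. \<bar>v' i - v i\<bar> < e}"
        by (intro open_Collect_less continuous_intros)
    qed
    moreover have "v \<in> W" using e by (simp add: W_def)
    moreover have "W \<subseteq> V"
    proof
      fix v' assume v': "v' \<in> W"
      have "(\<lambda>t\<in>{0..1}. v' (nat \<lfloor>real n * t\<rfloor>)) \<in> skorokhod_nbhd (\<lambda>t\<in>{0..1}. v (nat \<lfloor>real n * t\<rfloor>)) e"
        using v' nat_floor_le[of _ n] by (intro uniform_ball_in_skorokhod_nbhd step_path_D01) (auto simp: W_def)
      then show "v' \<in> V" using e by (auto simp: V_def)
    qed
    ultimately show "\<exists>T. open T \<and> v \<in> T \<and> T \<subseteq> V" by blast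
  qed
  then have [measurable]: "V \<in> sets borel" by simp
  have [measurable]: "(\<lambda>\<omega> i. Y i \<omega>) \<in> borel_measurable M"
    by (rule measurable_coordinatewise_then_product) simp
  have "{\<omega>\<in>space M. (\<lambda>i. Y i \<omega>) \<in> V} \<in> sets M" by measurable
  then show "{\<omega>\<in>space M. (\<lambda>t\<in>{0..1}. Y (nat \<lfloor>real n * t\<rfloor>) \<omega>) \<in> U} \<in> sets M"
    by (simp add: V_def)
qed

lemma grid_approximation: "(\<lambda>n. real (nat \<lfloor>real n * t\<rfloor>) / real n) \<longlonglongrightarrow> t" if "t \<in> {0..1}"
proof -
  have "(\<lambda>n. real (nat \<lfloor>real n * t\<rfloor>) / real n - t) \<longlonglongrightarrow> 0"
  proof (rule Lim_null_comparison)
    show "\<forall>\<^sub>F n in sequentially. norm (real (nat \<lfloor>real n * t\<rfloor>) / real n - t) \<le> 1 / real n"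
      using eventually_gt_at_top[of 0] by eventually_elim (use floor_div_close[OF that] in auto)
  qed (rule lim_1_over_n)
  then show ?thesis by (simp add: LIM_zero_iff)
qed

lemma continuous_le_on_grid:
  fixes f :: "real \<Rightarrow> real"
  assumes f: "continuous_on {0..1} f" and le: "\<And>i m. i \<le> m \<Longrightarrow> m \<ge> 1 \<Longrightarrow> f (real i / real m) \<le> c"
    and t: "t \<in> {0..1}"
  shows "f t \<le> c"
proof (rule tendsto_upperbound)
  have in01: "real (nat \<lfloor>real n * t\<rfloor>) / real n \<in> {0..1}" for n
    using nat_floor_le[OF t, of n] by (auto simp: divide_le_eq_1)
  show "(\<lambda>n. f (real (nat \<lfloor>real n * t\<rfloor>) / real n)) \<longlonglongrightarrow> f t"
    using in01 by (intro continuous_on_tendsto_compose[OF f grid_approximation[OF t] t]) auto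
  show "\<forall>\<^sub>F n in sequentially. f (real (nat \<lfloor>real n * t\<rfloor>) / real n) \<le> c"
    using eventually_ge_at_top[of 1] by eventually_elim (intro le nat_floor_le[OF t])
qed auto

lemma continuous_path_measurable:
  fixes Z :: "real \<Rightarrow> 'b \<Rightarrow> real"
  assumes Z: "\<And>t. t \<in> {0..1} \<Longrightarrow> Z t \<in> borel_measurable N"
    and cont: "\<And>\<omega>. \<omega> \<in> space N \<Longrightarrow> continuous_on {0..1} (\<lambda>t. Z t \<omega>)"
  shows "path01 Z \<in> measurable N skorokhod_borel"
proof (rule measurable_skorokhodI)
  show inD: "path01 Z \<omega> \<in> D01" if "\<omega> \<in> space N" for \<omega>
    unfolding path01_def by (rule continuous_path_D01[OF cont[OF that]])
  fix U assume U: "openin skorokhod_topology U"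
  define q where "q qs t = real_of_rat (qs ! nat \<lfloor>real (length qs - 1) * t\<rfloor>)" for qs :: "rat list" and t
  define near where "near x qs r \<longleftrightarrow> (\<forall>m i. 1 \<le> m \<and> i \<le> m \<longrightarrow> \<bar>x (real i / real m) - q qs (real i / real m)\<bar> \<le> real_of_rat r)" for x qs r
  define I where "I = {(qs, r). \<forall>x. continuous_on {0..1} x \<longrightarrow> near x qs r \<longrightarrow> (\<lambda>t\<in>{0..1}. x t) \<in> U}"
  have "{\<omega>\<in>space N. path01 Z \<omega> \<in> U} = (\<Union>(qs, r)\<in>I. {\<omega>\<in>space N. near (\<lambda>t. Z t \<omega>) qs r})"
  proof (intro set_eqI iffI)
    fix \<omega> assume "\<omega> \<in> (\<Union>(qs, r)\<in>I. {\<omega>\<in>space N. near (\<lambda>t. Z t \<omega>) qs r})"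
    then show "\<omega> \<in> {\<omega>\<in>space N. path01 Z \<omega> \<in> U}" using cont unfolding I_def path01_def by auto
  next
    fix \<omega> assume \<omega>: "\<omega> \<in> {\<omega>\<in>space N. path01 Z \<omega> \<in> U}"
    define x where "x t = Z t \<omega>" for t
    have x: "continuous_on {0..1} x" using cont \<omega> by (simp add: x_def)
    obtain e where e: "e > 0" "skorokhod_nbhd (\<lambda>t\<in>{0..1}. x t) e \<subseteq> U"
      using U \<omega> unfolding openin_skorokhod_topology path01_def x_def by blast
    have "uniformly_continuous_on {0..1} x" by (rule compact_uniformly_continuous[OF x compact_Icc])
    then obtain d where d: "d > 0" "\<And>t s. t \<in> {0..1} \<Longrightarrow> s \<in> {0..1} \<Longrightarrow> \<bar>s - t\<bar> < d \<Longrightarrow> \<bar>x s - x t\<bar> < e / 8"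
      using e unfolding uniformly_continuous_on_def dist_real_def by (metis zero_less_divide_iff zero_less_numeral)
    obtain m where m: "m \<ge> 1" "1 / real m < d"
      using d(1) by (metis One_nat_def Suc_leI nat_approx_posE of_nat_0_less_iff zero_less_Suc)
    have "\<exists>r. \<bar>real_of_rat r - x (real j / real m)\<bar> < e / 8" for j
    proof -
      obtain r where "x (real j / real m) < real_of_rat r" "real_of_rat r < x (real j / real m) + e / 8"
        using of_rat_dense[of "x (real j / real m)" "x (real j / real m) + e / 8"] e by auto
      then show ?thesis by (intro exI[of _ r]) auto
    qed
    then obtain g where g: "\<And>j. \<bar>real_of_rat (g j) - x (real j / real m)\<bar> < e / 8" by metis
    define qs where "qs = map g [0..<Suc m]"
    have qx: "\<bar>x t - q qs t\<bar> < e / 4" if t: "t \<in> {0..1}" for t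
    proof -
      define k where "k = nat \<lfloor>real m * t\<rfloor>"
      have k: "k \<le> m" unfolding k_def by (rule nat_floor_le[OF t])
      have "q qs t = real_of_rat (g k)"
        using k unfolding q_def qs_def k_def[symmetric] by (simp add: k_def[symmetric] nth_append del: upt_Suc)
      moreover have "\<bar>x t - x (real k / real m)\<bar> < e / 8"
      proof (rule d(2))
        show "real k / real m \<in> {0..1}" using k by (auto simp: divide_le_eq_1)
        have "\<bar>real k / real m - t\<bar> \<le> 1 / real m" unfolding k_def using m by (intro floor_div_close[OF t]) simp
        then show "\<bar>t - real k / real m\<bar> < d" using m(2) by linarith
      qed (rule t)
      ultimately show ?thesis using g[of k] by linarith
    qed
    obtain r where r: "e / 4 < real_of_rat r" "real_of_rat r < e / 3"
      using of_rat_dense[of "e / 4" "e / 3"] e by auto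
    have grid: "real i / real k \<in> {0..1}" if "i \<le> k" for i k using that by (auto simp: divide_le_eq_1)
    have "near x qs r"
      unfolding near_def using qx[OF grid] r by (force intro: less_imp_le less_trans)
    moreover have "(qs, r) \<in> I"
      unfolding I_def
    proof (clarify)
      fix y assume y: "continuous_on {0..1} y" "near y qs r"
      have "\<bar>y t - x t\<bar> \<le> e / 3 + e / 4" if "t \<in> {0..1}" for t
      proof (rule continuous_le_on_grid[where f = "\<lambda>t. \<bar>y t - x t\<bar>", OF _ _ that])
        show "continuous_on {0..1} (\<lambda>t. \<bar>y t - x t\<bar>)" using x y by (intro continuous_intros)
        fix i k :: nat assume ik: "i \<le> k" "k \<ge> 1"
        have "\<bar>y (real i / real k) - q qs (real i / real k)\<bar> \<le> real_of_rat r"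
          using y(2) ik unfolding near_def by blast
        then show "\<bar>y (real i / real k) - x (real i / real k)\<bar> \<le> e / 3 + e / 4"
          using qx[OF grid[OF ik(1)]] r by linarith
      qed
      then have "(\<lambda>t\<in>{0..1}. y t) \<in> skorokhod_nbhd (\<lambda>t\<in>{0..1}. x t) e"
        using e by (intro uniform_ball_in_skorokhod_nbhd continuous_path_D01 y) force
      then show "(\<lambda>t\<in>{0..1}. y t) \<in> U" using e by auto
    qed
    ultimately show "\<omega> \<in> (\<Union>(qs, r)\<in>I. {\<omega>\<in>space N. near (\<lambda>t. Z t \<omega>) qs r})"
      using \<omega> unfolding x_def by blast
  qed
  also have "\<dots> \<in> sets N"
  proof (intro sets.countable_UN'')
    show "countable I" by (rule countableI_type)
    fix p assume "p \<in> I"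
    obtain qs r where p: "p = (qs, r)" by (cases p)
    have "{\<omega>\<in>space N. near (\<lambda>t. Z t \<omega>) qs r} \<in> sets N"
      unfolding near_def
    proof (intro sets.sets_Collect_countable_All)
      fix m i :: nat
      show "{\<omega> \<in> space N. 1 \<le> m \<and> i \<le> m \<longrightarrow> \<bar>Z (real i / real m) \<omega> - q qs (real i / real m)\<bar> \<le> real_of_rat r} \<in> sets N"
      proof (cases "1 \<le> m \<and> i \<le> m")
        case True
        then have [measurable]: "Z (real i / real m) \<in> borel_measurable N"
          by (intro Z) (auto simp: divide_le_eq_1)
        have "{\<omega> \<in> space N. \<bar>Z (real i / real m) \<omega> - q qs (real i / real m)\<bar> \<le> real_of_rat r} \<in> sets N"
          by measurable
        then show ?thesis using True by simp
      next
        case False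
        then have "{\<omega> \<in> space N. 1 \<le> m \<and> i \<le> m \<longrightarrow> \<bar>Z (real i / real m) \<omega> - q qs (real i / real m)\<bar> \<le> real_of_rat r} = space N"
          by blast
        then show ?thesis by (simp only: sets.top)
      qed
    qed
    then show "(case p of (qs, r) \<Rightarrow> {\<omega>\<in>space N. near (\<lambda>t. Z t \<omega>) qs r}) \<in> sets N" by (simp add: p)
  qed
  finally show "{\<omega>\<in>space N. path01 Z \<omega> \<in> U} \<in> sets N" .
qed

text \<open>
  The lower envelopes of a functional are Lipschitz continuous for the uniform distance and
  increase to the functional at its continuity points. They replace the portmanteau theorem,
  which is not available here because the uniform topology of \<open>D[0,1]\<close> is not separable.
\<close>

definition dist01 :: "(real \<Rightarrow> real) \<Rightarrow> (real \<Rightarrow> real) \<Rightarrow> real" where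
  "dist01 x y = (SUP t\<in>{0..1}. min 1 \<bar>x t - y t\<bar>)"

lemma dist01_bdd: "bdd_above ((\<lambda>t. min 1 \<bar>x t - y t :: real\<bar>) ` {0..1::real})"
  by (rule bdd_aboveI2[where M = 1]) simp

lemma dist01_upper: "t \<in> {0..1} \<Longrightarrow> min 1 \<bar>x t - y t\<bar> \<le> dist01 x y"
  unfolding dist01_def by (rule cSUP_upper[OF _ dist01_bdd])

lemma dist01_leI: "(\<And>t. t \<in> {0..1} \<Longrightarrow> min 1 \<bar>x t - y t\<bar> \<le> c) \<Longrightarrow> dist01 x y \<le> c"
  unfolding dist01_def by (rule cSUP_least) auto

lemma dist01_nonneg: "dist01 x y \<ge> 0"
  using dist01_upper[of 0 x y] by (smt (verit) atLeastAtMost_iff)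

lemma dist01_le_1: "dist01 x y \<le> 1" by (rule dist01_leI) simp

lemma dist01_triangle: "dist01 x z \<le> dist01 x y + dist01 y z"
proof (rule dist01_leI)
  fix t :: real assume t: "t \<in> {0..1}"
  show "min 1 \<bar>x t - z t\<bar> \<le> dist01 x y + dist01 y z"
    using dist01_upper[OF t, of x y] dist01_upper[OF t, of y z] by linarith
qed

lemma dist01_commute: "dist01 x y = dist01 y x"
  by (simp add: dist01_def abs_minus_commute)

lemma dist01_restrict: "dist01 (\<lambda>t\<in>{0..1}. x t) y = dist01 x y"
  unfolding dist01_def by (intro SUP_cong refl) simp

lemma dist01_refl: "dist01 x x = 0" by (simp add: dist01_def)

definition lower_envelope :: "((real \<Rightarrow> real) \<Rightarrow> real) \<Rightarrow> real \<Rightarrow> (real \<Rightarrow> real) \<Rightarrow> real" where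
  "lower_envelope G k x = (INF y\<in>D01. G y + k * dist01 x y)"

lemma D01_nonempty: "D01 \<noteq> {}" using continuous_path_D01[of "\<lambda>_. 0"] by auto

context
  fixes G :: "(real \<Rightarrow> real) \<Rightarrow> real"
  assumes G01: "\<forall>x. 0 \<le> G x \<and> G x \<le> 1"
begin

lemma lower_envelope_bdd: "k \<ge> 0 \<Longrightarrow> bdd_below ((\<lambda>y. G y + k * dist01 x y) ` D01)"
  by (rule bdd_belowI2[where m = 0]) (use G01 dist01_nonneg in \<open>auto intro!: add_nonneg_nonneg\<close>)

lemma lower_envelope_lower: "k \<ge> 0 \<Longrightarrow> y \<in> D01 \<Longrightarrow> lower_envelope G k x \<le> G y + k * dist01 x y"
  unfolding lower_envelope_def by (rule cINF_lower[OF lower_envelope_bdd])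

lemma lower_envelope_le: "k \<ge> 0 \<Longrightarrow> x \<in> D01 \<Longrightarrow> lower_envelope G k x \<le> G x"
  using lower_envelope_lower[of k x x] by (simp add: dist01_refl)

lemma lower_envelope_nonneg: "k \<ge> 0 \<Longrightarrow> lower_envelope G k x \<ge> 0"
  unfolding lower_envelope_def
  by (rule cINF_greatest[OF D01_nonempty]) (use G01 dist01_nonneg in \<open>auto intro!: add_nonneg_nonneg\<close>)

lemma lower_envelope_upper: "k \<ge> 0 \<Longrightarrow> lower_envelope G k x \<le> 1 + k"
proof -
  assume k: "k \<ge> 0"
  obtain y where y: "y \<in> D01" using D01_nonempty by blast
  have "k * dist01 x y \<le> k * 1" using k dist01_le_1 by (intro mult_left_mono) auto
  then show ?thesis using lower_envelope_lower[OF k y, of x] G01[rule_format, of y] by linarith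
qed

lemma lower_envelope_lipschitz:
  assumes k: "k \<ge> 0"
  shows "lower_envelope G k x \<le> lower_envelope G k x' + k * dist01 x x'"
proof -
  have "lower_envelope G k x - k * dist01 x x' \<le> lower_envelope G k x'"
    unfolding lower_envelope_def[of G k x']
  proof (rule cINF_greatest[OF D01_nonempty])
    fix y assume y: "y \<in> D01"
    have "k * dist01 x y \<le> k * (dist01 x x' + dist01 x' y)"
      using k dist01_triangle by (intro mult_left_mono) auto
    then show "lower_envelope G k x - k * dist01 x x' \<le> G y + k * dist01 x' y"
      using lower_envelope_lower[OF k y, of x] by (simp add: distrib_left)
  qed
  then show ?thesis by simp
qed

lemma lower_envelope_restrict: "lower_envelope G k (\<lambda>t\<in>{0..1}. x t) = lower_envelope G k x"
  by (simp add: lower_envelope_def dist01_restrict)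

lemma lower_envelope_tendsto:
  assumes cont: "unif_continuous_at_C01 G" and x: "x \<in> D01" "continuous_on {0..1} x"
  shows "(\<lambda>k. lower_envelope G (real k) x) \<longlonglongrightarrow> G x"
proof (rule LIMSEQ_I)
  fix e :: real assume e: "e > 0"
  obtain d where d: "d > 0" "\<And>y. y \<in> D01 \<Longrightarrow> (\<forall>t\<in>{0..1}. \<bar>y t - x t\<bar> < d) \<Longrightarrow> \<bar>G y - G x\<bar> < e / 2"
    using cont x e unfolding unif_continuous_at_C01_def by (meson half_gt_zero)
  define d' where "d' = min 1 d"
  have d': "d' > 0" using d by (simp add: d'_def)
  have "norm (lower_envelope G (real k) x - G x) < e" if k: "k \<ge> nat \<lceil>1 / d'\<rceil>" for k
  proof -
    have kd: "real k * d' \<ge> 1"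
    proof -
      have "1 / d' \<le> real k" using k by linarith
      then show ?thesis using d' by (simp add: field_simps)
    qed
    have "G x - e / 2 \<le> lower_envelope G (real k) x"
      unfolding lower_envelope_def
    proof (rule cINF_greatest[OF D01_nonempty])
      fix y assume y: "y \<in> D01"
      show "G x - e / 2 \<le> G y + real k * dist01 x y"
      proof (cases "dist01 x y < d'")
        case True
        have "\<bar>y t - x t\<bar> < d" if t: "t \<in> {0..1}" for t
          using dist01_upper[OF t, of x y] True by (auto simp: d'_def abs_minus_commute)
        then have "\<bar>G y - G x\<bar> < e / 2" using d(2)[OF y] by blast
        moreover have "0 \<le> real k * dist01 x y" using dist01_nonneg by simp
        ultimately show ?thesis by linarith
      next
        case False
        then have "real k * d' \<le> real k * dist01 x y" by (intro mult_left_mono) auto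
        then show ?thesis using kd G01[rule_format, of x] G01[rule_format, of y] e by linarith
      qed
    qed
    then show ?thesis using lower_envelope_le[of "real k" x] x e by simp
  qed
  then show "\<exists>no. \<forall>k\<ge>no. norm (lower_envelope G (real k) x - G x) < e" by blast
qed

end

section \<open>Convergence of the processes\<close>

definition hat :: "nat \<Rightarrow> nat \<Rightarrow> real \<Rightarrow> real" where
  "hat m j u = max 0 (1 - \<bar>real m * u - real j\<bar>)"

definition interp :: "nat \<Rightarrow> (nat \<Rightarrow> real) \<Rightarrow> real \<Rightarrow> real" where
  "interp m x u = (\<Sum>j\<le>m. x j * hat m j u)"

lemma hat_nonneg: "hat m j u \<ge> 0" by (simp add: hat_def)

lemma hat_le_1: "hat m j u \<le> 1" by (simp add: hat_def)

lemma hat_lipschitz: "\<bar>hat m j u - hat m j v\<bar> \<le> real m * \<bar>u - v\<bar>"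
proof -
  have "\<bar>hat m j u - hat m j v\<bar> \<le> \<bar>real m * u - real m * v\<bar>"
    unfolding hat_def by linarith
  also have "\<dots> = real m * \<bar>u - v\<bar>" by (simp add: right_diff_distrib[symmetric] abs_mult)
  finally show ?thesis .
qed

lemma hat_lipschitz_from_0: "j \<ge> 1 \<Longrightarrow> lipschitz_from_0 (real m) (hat m j)"
  unfolding lipschitz_from_0_def
proof (intro conjI allI impI hat_lipschitz)
  fix u :: real assume "j \<ge> 1" "u \<le> 0"
  then have "real m * u \<le> 0" "real j \<ge> 1" by (auto intro: mult_nonneg_nonpos)
  then show "hat m j u = 0" by (simp add: hat_def)
qed

lemma hat_continuous: "continuous_on A (hat m j)"
proof -
  have "(real m)-lipschitz_on A (hat m j)"
    using hat_lipschitz by (intro lipschitz_onI) (auto simp: dist_real_def)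
  then show ?thesis by (rule lipschitz_on_continuous_on)
qed

lemma interp_continuous: "continuous_on A (interp m x)"
  unfolding interp_def[abs_def] by (intro continuous_intros hat_continuous)

lemma hat_partition:
  assumes "u \<in> {0..1}"
  shows "(\<Sum>j\<le>m. hat m j u) = 1"
proof -
  have "(\<Sum>j\<le>k. max 0 (1 - \<bar>s - real j\<bar>)) = 1" if "0 \<le> s" "s \<le> real k" for s k
    using that
  proof (induction k)
    case (Suc k)
    show ?case
    proof (cases "s \<le> real k")
      case True
      then show ?thesis using Suc by simp
    next
      case False
      have "(\<Sum>j\<le>k. max 0 (1 - \<bar>s - real j\<bar>)) = max 0 (1 - \<bar>s - real k\<bar>)"
      proof -
        have "(\<Sum>j\<le>k. max 0 (1 - \<bar>s - real j\<bar>)) = (\<Sum>j\<in>{k}. max 0 (1 - \<bar>s - real j\<bar>))"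
        proof (rule sum.mono_neutral_right)
          show "\<forall>j\<in>{..k} - {k}. max 0 (1 - \<bar>s - real j\<bar>) = 0"
          proof
            fix j assume "j \<in> {..k} - {k}"
            then have "j + 1 \<le> k" by auto
            then have "real j + 1 \<le> real k" by linarith
            then show "max 0 (1 - \<bar>s - real j\<bar>) = 0" using False by simp
          qed
        qed auto
        then show ?thesis by simp
      qed
      then show ?thesis using False Suc.prems by simp
    qed
  qed simp
  moreover have "real m * u \<le> real m" using assms mult_left_mono[of u 1 "real m"] by simp
  ultimately show ?thesis unfolding hat_def using assms by simp
qed

lemma interp_close:
  assumes u: "u \<in> {0..1}" and c: "\<And>j. j \<le> m \<Longrightarrow> \<bar>real m * u - real j\<bar> < 1 \<Longrightarrow> \<bar>y - x j\<bar> \<le> c"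
  shows "\<bar>y - interp m x u\<bar> \<le> c"
proof -
  have "y - interp m x u = (\<Sum>j\<le>m. (y - x j) * hat m j u)"
  proof -
    have "(\<Sum>j\<le>m. (y - x j) * hat m j u) = y * (\<Sum>j\<le>m. hat m j u) - interp m x u"
      by (simp add: interp_def left_diff_distrib sum_subtractf sum_distrib_left)
    then show ?thesis by (simp add: hat_partition[OF u])
  qed
  also have "\<bar>\<dots>\<bar> \<le> (\<Sum>j\<le>m. \<bar>(y - x j) * hat m j u\<bar>)" by (rule sum_abs)
  also have "\<dots> \<le> (\<Sum>j\<le>m. c * hat m j u)"
  proof (rule sum_mono)
    fix j assume j: "j \<in> {..m}"
    show "\<bar>(y - x j) * hat m j u\<bar> \<le> c * hat m j u"
    proof (cases "\<bar>real m * u - real j\<bar> < 1")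
      case True
      then show ?thesis using c[of j] j hat_nonneg[of m j u] by (simp add: abs_mult mult_right_mono)
    next
      case False
      then have "hat m j u = 0" by (simp add: hat_def)
      then show ?thesis by simp
    qed
  qed
  also have "\<dots> = c" by (simp add: sum_distrib_left[symmetric] hat_partition[OF u])
  finally show ?thesis .
qed

lemma interp_uniform_limit:
  fixes z :: "real \<Rightarrow> real"
  assumes z: "continuous_on {0..1} z" and e: "e > 0"
  shows "\<forall>\<^sub>F m in sequentially. \<forall>u\<in>{0..1}. \<bar>z u - interp m (\<lambda>j. z (real j / real m)) u\<bar> \<le> e"
proof -
  have "uniformly_continuous_on {0..1} z" by (rule compact_uniformly_continuous[OF z compact_Icc])
  then obtain d where d: "d > 0" "\<forall>t\<in>{0..1}. \<forall>s\<in>{0..1}. dist s t < d \<longrightarrow> dist (z s) (z t) < e"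
    using e unfolding uniformly_continuous_on_def by blast
  have "\<forall>\<^sub>F m in sequentially. 1 / real m < d"
    using order_tendstoD(2)[OF lim_1_over_n d(1)] .
  then show ?thesis using eventually_ge_at_top[of 1]
  proof eventually_elim
    case (elim m)
    show ?case
    proof (intro ballI interp_close)
      fix u :: real and j assume u: "u \<in> {0..1}" and j: "j \<le> m" "\<bar>real m * u - real j\<bar> < 1"
      have "real m * \<bar>u - real j / real m\<bar> = \<bar>real m * u - real j\<bar>"
      proof -
        have "real m * (u - real j / real m) = real m * u - real j" using elim by (simp add: right_diff_distrib)
        then show ?thesis using abs_mult[of "real m" "u - real j / real m"] by simp
      qed
      then have "real m * \<bar>u - real j / real m\<bar> < 1" using j by simp
      then have "\<bar>u - real j / real m\<bar> < 1 / real m" using elim by (simp add: field_simps)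
      then have "dist u (real j / real m) < d" using elim by (simp add: dist_real_def)
      moreover have "real j / real m \<in> {0..1}" using j by (auto simp: divide_le_eq_1)
      ultimately show "\<bar>z u - z (real j / real m)\<bar> \<le> e" using d(2) u by (force simp: dist_real_def)
    qed
  qed
qed

context limit_operator
begin

lemma op_cong:
  assumes "continuous_on {0..1} z" "continuous_on {0..1} z'" "\<And>u. u \<in> {0..1} \<Longrightarrow> z u = z' u" "t \<in> {0..1}"
  shows "\<Phi> z t = \<Phi> z' t"
  using op_contraction[OF assms(1,2) _ assms(4), of 0] assms(3) by simp

lemma op_interp:
  assumes "t \<in> {0..1}"
  shows "\<Phi> (interp m x) t = (\<Sum>j\<le>m. x j * \<Phi> (hat m j) t)"
  unfolding interp_def[abs_def] by (rule op_sum) (use assms hat_continuous in auto)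

lemma op_interp_lipschitz:
  assumes t: "t \<in> {0..1}"
  shows "\<bar>\<Phi> (interp m x) t - \<Phi> (interp m x') t\<bar> \<le> (\<Sum>j\<le>m. \<bar>x j - x' j\<bar>)"
proof (rule op_contraction[OF interp_continuous interp_continuous _ t])
  fix u
  have "interp m x u - interp m x' u = (\<Sum>j\<le>m. (x j - x' j) * hat m j u)"
    by (simp add: interp_def left_diff_distrib sum_subtractf)
  also have "\<bar>\<dots>\<bar> \<le> (\<Sum>j\<le>m. \<bar>(x j - x' j) * hat m j u\<bar>)" by (rule sum_abs)
  also have "\<dots> \<le> (\<Sum>j\<le>m. \<bar>x j - x' j\<bar> * 1)"
    using hat_le_1 hat_nonneg by (intro sum_mono) (auto simp: abs_mult intro!: mult_left_le)
  finally show "\<bar>interp m x u - interp m x' u\<bar> \<le> (\<Sum>j\<le>m. \<bar>x j - x' j\<bar>)" by simp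
qed

lemma op_interp_continuous: "continuous_on {0..1} (\<Phi> (interp m x))"
proof -
  define e where "e j = (if j = 0 then (\<lambda>_. 1) else hat m j)" for j
  define x' where "x' j = (if j = 0 then x 0 else x j - x 0)" for j
  have ce: "continuous_on {0..1} (e j)" for j by (simp add: e_def hat_continuous)
  have eq: "interp m x u = (\<Sum>j\<le>m. x' j * e j u)" if u: "u \<in> {0..1}" for u
  proof -
    have 1: "(\<Sum>j\<le>m. x' j * e j u) = x 0 + (\<Sum>j\<in>{1..m}. (x j - x 0) * hat m j u)"
    proof -
      have "{..m} = insert 0 {1..m}" by auto
      then show ?thesis by (simp add: x'_def e_def)
    qed
    have "(\<Sum>j\<le>m. (x j - x 0) * hat m j u) = interp m x u - x 0 * (\<Sum>j\<le>m. hat m j u)"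
      by (simp add: interp_def left_diff_distrib sum_subtractf sum_distrib_left)
    moreover have "(\<Sum>j\<le>m. (x j - x 0) * hat m j u) = (\<Sum>j\<in>{1..m}. (x j - x 0) * hat m j u)"
    proof -
      have "{..m} = insert 0 {1..m}" by auto
      then show ?thesis by simp
    qed
    ultimately show ?thesis using 1 hat_partition[OF u, of m] by simp
  qed
  have cs: "continuous_on {0..1} (\<lambda>u. \<Sum>j\<le>m. x' j * e j u)"
    by (intro continuous_intros ce)
  have "\<Phi> (interp m x) t = (\<Sum>j\<le>m. x' j * \<Phi> (e j) t)" if t: "t \<in> {0..1}" for t
    using op_cong[OF interp_continuous cs eq t] op_sum[of "{..m}" e t x'] ce t by simp
  moreover have "continuous_on {0..1} (\<Phi> (e j))" for j
    using op_const op_lipschitz[OF hat_lipschitz_from_0] by (simp add: e_def)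
  then have "continuous_on {0..1} (\<lambda>t. \<Sum>j\<le>m. x' j * \<Phi> (e j) t)" by (intro continuous_intros)
  ultimately show ?thesis by (subst continuous_on_cong[OF refl]) auto
qed

lemma op_interp_uniform_limit:
  assumes z: "continuous_on {0..1} z"
  shows "uniform_limit {0..1} (\<lambda>m. \<Phi> (interp m (\<lambda>j. z (real j / real m)))) (\<Phi> z) sequentially"
  unfolding uniform_limit_iff
proof (intro allI impI)
  fix e :: real assume e: "e > 0"
  then have "e / 2 > 0" by simp
  from interp_uniform_limit[OF z this]
  show "\<forall>\<^sub>F m in sequentially. \<forall>t\<in>{0..1}. dist (\<Phi> (interp m (\<lambda>j. z (real j / real m))) t) (\<Phi> z t) < e"
  proof eventually_elim
    case (elim m)
    show ?case
    proof
      fix t :: real assume t: "t \<in> {0..1}"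
      have "\<bar>\<Phi> z t - \<Phi> (interp m (\<lambda>j. z (real j / real m))) t\<bar> \<le> e / 2"
        using elim by (intro op_contraction[OF z interp_continuous _ t]) auto
      then show "dist (\<Phi> (interp m (\<lambda>j. z (real j / real m))) t) (\<Phi> z t) < e"
        using e by (simp add: dist_real_def abs_minus_commute)
    qed
  qed
qed

lemma op_continuous:
  assumes "continuous_on {0..1} z"
  shows "continuous_on {0..1} (\<Phi> z)"
  by (rule uniform_limit_theorem[OF _ op_interp_uniform_limit[OF assms]]) (auto simp: op_interp_continuous)

end

locale process_convergence = limit_operator w \<Phi> + P: prob_space P + N: prob_space N
  for w \<Phi> and P :: "'a measure" and N :: "'b measure" +
  fixes S :: "nat \<Rightarrow> 'a \<Rightarrow> real" and s :: "nat \<Rightarrow> real" and B :: "real \<Rightarrow> 'b \<Rightarrow> real" and H :: real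
  assumes reg: "regular_sequence s H"
    and S_measurable[measurable]: "S k \<in> borel_measurable P"
    and S_0: "S 0 = (\<lambda>_. 0)"
    and S_square: "integrable P (\<lambda>\<omega>. (S k \<omega>)\<^sup>2)" "P.expectation (\<lambda>\<omega>. (S k \<omega>)\<^sup>2) = (s k)\<^sup>2"
    and modulus: "\<eta> > 0 \<Longrightarrow> e > 0 \<Longrightarrow> \<exists>m0. \<forall>m\<ge>m0. \<forall>\<^sub>F n in sequentially.
      P.prob {\<omega>\<in>space P. \<exists>i\<le>n. \<exists>i'\<le>n. \<bar>real i - real i'\<bar> \<le> real n / real m + 1 \<and> \<bar>S i \<omega> - S i' \<omega>\<bar> \<ge> \<eta> * s n} \<le> e"
    and B_measurable: "t \<ge> 0 \<Longrightarrow> B t \<in> borel_measurable N"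
    and B_integrable: "t \<ge> 0 \<Longrightarrow> integrable N (B t)"
    and B_continuous: "\<omega> \<in> space N \<Longrightarrow> continuous_on {0..1} (\<lambda>t. B t \<omega>)"
    and char_limit: "m \<ge> 1 \<Longrightarrow> (\<lambda>n. char (distr P borel (\<lambda>\<omega>. \<Sum>j\<le>m. c j * (S (n * j div m) \<omega> / s n))) 1)
      \<longlonglongrightarrow> char (distr N borel (\<lambda>\<omega>. \<Sum>j\<le>m. c j * B (real j / real m) \<omega>)) 1"
begin

definition approx :: "nat \<Rightarrow> real \<Rightarrow> 'a \<Rightarrow> real" where
  "approx n t \<omega> = (\<Sum>i<nat \<lfloor>real n * t\<rfloor>. w n i * (S (nat \<lfloor>real n * t\<rfloor> - i) \<omega> / s n))"

definition limit :: "real \<Rightarrow> 'b \<Rightarrow> real" where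
  "limit t \<omega> = \<Phi> (\<lambda>u. B u \<omega>) t"

lemma limit_continuous: "\<omega> \<in> space N \<Longrightarrow> continuous_on {0..1} (\<lambda>t. limit t \<omega>)"
  unfolding limit_def using op_continuous[OF B_continuous] by simp

lemma limit_measurable:
  assumes t: "t \<in> {0..1}"
  shows "limit t \<in> borel_measurable N"
proof (rule borel_measurable_LIMSEQ_real)
  show "(\<lambda>m. \<Phi> (interp m (\<lambda>j. B (real j / real m) \<omega>)) t) \<longlonglongrightarrow> limit t \<omega>" if "\<omega> \<in> space N" for \<omega>
    unfolding limit_def by (rule tendsto_uniform_limitI[OF op_interp_uniform_limit[OF B_continuous[OF that]] t])
  have [measurable]: "B (real j / real m) \<in> borel_measurable N" for j m by (rule B_measurable) simp
  show "(\<lambda>\<omega>. \<Phi> (interp m (\<lambda>j. B (real j / real m) \<omega>)) t) \<in> borel_measurable N" for m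
    unfolding op_interp[OF t] by measurable
qed

lemma limit_path_measurable: "path01 limit \<in> measurable N skorokhod_borel"
  by (rule continuous_path_measurable[OF limit_measurable limit_continuous])

lemma approx_path_measurable: "path01 (approx n) \<in> measurable P skorokhod_borel"
proof -
  have "path01 (approx n) = (\<lambda>\<omega>. \<lambda>t\<in>{0..1}. (\<lambda>k \<omega>. \<Sum>i<k. w n i * (S (k - i) \<omega> / s n)) (nat \<lfloor>real n * t\<rfloor>) \<omega>)"
    by (simp add: path01_def approx_def fun_eq_iff)
  also have "\<dots> \<in> measurable P skorokhod_borel" by (rule step_path_measurable) measurable
  finally show ?thesis .
qed

lemma S_abs:
  "integrable P (S k)" "P.expectation (\<lambda>\<omega>. \<bar>S k \<omega>\<bar>) \<le> s k"
proof -
  interpret regular_sequence s H by (rule reg)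
  show i: "integrable P (S k)" by (rule P.square_integrable_imp_integrable[OF _ S_square(1)]) simp
  have "(P.expectation (\<lambda>\<omega>. \<bar>S k \<omega>\<bar>))\<^sup>2 \<le> P.expectation (\<lambda>\<omega>. \<bar>S k \<omega>\<bar>\<^sup>2)"
    using P.variance_positive[of "\<lambda>\<omega>. \<bar>S k \<omega>\<bar>"] P.variance_eq[of "\<lambda>\<omega>. \<bar>S k \<omega>\<bar>"] i S_square(1) by simp
  then have "(P.expectation (\<lambda>\<omega>. \<bar>S k \<omega>\<bar>))\<^sup>2 \<le> (s k)\<^sup>2" by (simp add: S_square(2))
  then show "P.expectation (\<lambda>\<omega>. \<bar>S k \<omega>\<bar>) \<le> s k" using s_nonneg by (rule power2_le_imp_le)
qed

definition node :: "nat \<Rightarrow> nat \<Rightarrow> nat \<Rightarrow> 'a \<Rightarrow> real" where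
  "node m n j \<omega> = S (n * j div m) \<omega> / s n"

lemma node_measurable[measurable]: "node m n j \<in> borel_measurable P"
  unfolding node_def[abs_def] by measurable

lemma node_integrable: "integrable P (node m n j)"
  unfolding node_def[abs_def] using S_abs(1) by simp

lemma node_bounded:
  assumes m: "m \<ge> 1"
  shows "\<forall>\<^sub>F n in sequentially. \<forall>j\<in>{..m}. P.expectation (\<lambda>\<omega>. \<bar>node m n j \<omega>\<bar>) \<le> 2"
proof (intro eventually_ball_finite ballI finite_atMost)
  interpret regular_sequence s H by (rule reg)
  fix j assume j: "j \<in> {..m}"
  have "(\<lambda>n. s (n * j div m) / s n) \<longlonglongrightarrow> (real j / real m) powr H"
    by (rule s_proportional[OF m div_error[OF m]])
  moreover have "(real j / real m) powr H < 2"
  proof -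
    have "(real j / real m) powr H \<le> 1" using j m H_pos by (intro powr_le1) (auto simp: divide_le_eq_1)
    then show ?thesis by simp
  qed
  ultimately have "\<forall>\<^sub>F n in sequentially. s (n * j div m) / s n < 2" by (rule order_tendstoD)
  then show "\<forall>\<^sub>F n in sequentially. P.expectation (\<lambda>\<omega>. \<bar>node m n j \<omega>\<bar>) \<le> 2"
  proof eventually_elim
    case (elim n)
    have "P.expectation (\<lambda>\<omega>. \<bar>node m n j \<omega>\<bar>) = P.expectation (\<lambda>\<omega>. \<bar>S (n * j div m) \<omega>\<bar>) / s n"
      using s_nonneg by (simp add: node_def)
    also have "\<dots> \<le> s (n * j div m) / s n" using S_abs(2) s_nonneg by (intro divide_right_mono)
    finally show ?case using elim by simp
  qed
qed

lemma approx_close: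
  assumes n: "n \<ge> 1" and m: "m \<ge> 1" and t: "t \<in> {0..1}" and \<eta>: "\<eta> > 0"
    and osc: "\<And>i i'. i \<le> n \<Longrightarrow> i' \<le> n \<Longrightarrow> \<bar>real i - real i'\<bar> \<le> real n / real m + 1 \<Longrightarrow> \<bar>S i \<omega> - S i' \<omega>\<bar> < \<eta> * s n"
    and op: "\<And>j. 1 \<le> j \<Longrightarrow> j \<le> m \<Longrightarrow> \<bar>discrete_average w n (hat m j) t - \<Phi> (hat m j) t\<bar> \<le> \<epsilon>"
  shows "\<bar>approx n t \<omega> - \<Phi> (interp m (\<lambda>j. node m n j \<omega>)) t\<bar> \<le> \<eta> + \<epsilon> * (\<Sum>j\<le>m. \<bar>node m n j \<omega>\<bar>)"
proof -
  interpret regular_sequence s H by (rule reg)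
  have sn: "s n > 0" using n by (rule s_pos)
  define k where "k = nat \<lfloor>real n * t\<rfloor>"
  have k: "k \<le> n" unfolding k_def by (rule nat_floor_le[OF t])
  define x where "x j = node m n j \<omega>" for j
  have x0: "x 0 = 0" by (simp add: x_def node_def S_0)
  define u where "u i = (real k - real i) / real n" for i
  have close: "\<bar>S (k - i) \<omega> / s n - interp m x (u i)\<bar> \<le> \<eta>" if i: "i < k" for i
  proof (rule interp_close)
    show "u i \<in> {0..1}" using i k n by (auto simp: u_def divide_le_eq_1)
    fix j assume j: "j \<le> m" "\<bar>real m * u i - real j\<bar> < 1"
    have e1: "real m * u i - real j = (real m * real (k - i) - real n * real j) / real n"
      using i n by (simp add: u_def of_nat_diff field_simps)
    have "\<bar>real m * real (k - i) - real n * real j\<bar> < real n"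
      using j(2) n unfolding e1 by (simp add: abs_divide)
    moreover have "\<bar>real m * real (n * j div m) - real n * real j\<bar> \<le> real m"
      using div_error[OF m, of n j] by (simp add: mult.commute)
    ultimately have "\<bar>real m * real (k - i) - real m * real (n * j div m)\<bar> \<le> real n + real m" by linarith
    then have "real m * \<bar>real (k - i) - real (n * j div m)\<bar> \<le> real n + real m"
      by (simp add: right_diff_distrib[symmetric] abs_mult)
    then have "\<bar>real (k - i) - real (n * j div m)\<bar> \<le> (real n + real m) / real m"
      using m by (simp add: field_simps)
    also have "\<dots> = real n / real m + 1" using m by (simp add: add_divide_distrib)
    finally have "\<bar>real (k - i) - real (n * j div m)\<bar> \<le> real n / real m + 1" .
    moreover have "n * j div m \<le> n" using j m
      by (metis div_le_mono mult_le_mono2 nonzero_mult_div_cancel_right not_one_le_zero)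
    ultimately have "\<bar>S (k - i) \<omega> - S (n * j div m) \<omega>\<bar> < \<eta> * s n" using k by (intro osc) auto
    then have "\<bar>S (k - i) \<omega> - S (n * j div m) \<omega>\<bar> / s n \<le> \<eta>" using sn by (simp add: divide_le_eq)
    then show "\<bar>S (k - i) \<omega> / s n - x j\<bar> \<le> \<eta>"
      using sn by (simp add: x_def node_def diff_divide_distrib[symmetric] abs_divide)
  qed
  have avg_eq: "discrete_average w n z t = (\<Sum>i<k. w n i * z (u i))" for z
    by (simp add: discrete_average_def k_def u_def)
  have sub: "(\<Sum>i<k. w n i) \<le> 1"
    by (rule order_trans[OF sum_mono2 w_sum[of n]]) (use k w_nonneg in auto)
  have "\<bar>approx n t \<omega> - discrete_average w n (interp m x) t\<bar> = \<bar>\<Sum>i<k. w n i * (S (k - i) \<omega> / s n - interp m x (u i))\<bar>"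
    by (simp add: approx_def avg_eq k_def[symmetric] right_diff_distrib sum_subtractf)
  also have "\<dots> \<le> (\<Sum>i<k. \<bar>w n i * (S (k - i) \<omega> / s n - interp m x (u i))\<bar>)" by (rule sum_abs)
  also have "\<dots> \<le> (\<Sum>i<k. w n i * \<eta>)"
    using close w_nonneg by (intro sum_mono) (auto simp: abs_mult intro!: mult_left_mono)
  also have "\<dots> = \<eta> * (\<Sum>i<k. w n i)" by (simp add: sum_distrib_left mult.commute)
  also have "\<dots> \<le> \<eta> * 1" using sub \<eta> by (intro mult_left_mono) auto
  finally have 1: "\<bar>approx n t \<omega> - discrete_average w n (interp m x) t\<bar> \<le> \<eta>" by simp
  have avg: "discrete_average w n (interp m x) t = (\<Sum>j\<le>m. x j * discrete_average w n (hat m j) t)"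
  proof -
    have "discrete_average w n (interp m x) t = (\<Sum>i<k. \<Sum>j\<le>m. x j * (w n i * hat m j (u i)))"
      unfolding avg_eq interp_def by (simp add: sum_distrib_left mult_ac)
    also have "\<dots> = (\<Sum>j\<le>m. \<Sum>i<k. x j * (w n i * hat m j (u i)))" by (rule sum.swap)
    finally show ?thesis
      by (simp add: avg_eq sum_distrib_left)
  qed
  have "\<bar>discrete_average w n (interp m x) t - \<Phi> (interp m x) t\<bar>
    = \<bar>\<Sum>j\<le>m. x j * (discrete_average w n (hat m j) t - \<Phi> (hat m j) t)\<bar>"
    by (simp add: avg op_interp[OF t] right_diff_distrib sum_subtractf)
  also have "\<dots> \<le> (\<Sum>j\<le>m. \<bar>x j * (discrete_average w n (hat m j) t - \<Phi> (hat m j) t)\<bar>)" by (rule sum_abs)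
  also have "\<dots> \<le> (\<Sum>j\<le>m. \<epsilon> * \<bar>x j\<bar>)"
  proof (rule sum_mono)
    fix j assume "j \<in> {..m}"
    then show "\<bar>x j * (discrete_average w n (hat m j) t - \<Phi> (hat m j) t)\<bar> \<le> \<epsilon> * \<bar>x j\<bar>"
      using op[of j] x0 by (cases "j = 0") (auto simp: abs_mult mult.commute[of \<epsilon>] intro!: mult_left_mono)
  qed
  also have "\<dots> = \<epsilon> * (\<Sum>j\<le>m. \<bar>x j\<bar>)" by (simp add: sum_distrib_left)
  finally have 2: "\<bar>discrete_average w n (interp m x) t - \<Phi> (interp m x) t\<bar> \<le> \<epsilon> * (\<Sum>j\<le>m. \<bar>x j\<bar>)" .
  show ?thesis using 1 2 unfolding x_def by linarith
qed

context
  fixes G :: "(real \<Rightarrow> real) \<Rightarrow> real"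
  assumes G01: "\<forall>x. 0 \<le> G x \<and> G x \<le> 1"
    and G_meas[measurable]: "G \<in> borel_measurable skorokhod_borel"
    and G_cont: "unif_continuous_at_C01 G"
begin

abbreviation nodal :: "real \<Rightarrow> nat \<Rightarrow> (nat \<Rightarrow> real) \<Rightarrow> real" where
  "nodal k m x \<equiv> lower_envelope G k (\<Phi> (interp m x))"

lemma nodal_lipschitz:
  assumes "k \<ge> 0"
  shows "\<bar>nodal k m x - nodal k m x'\<bar> \<le> k * (\<Sum>j\<le>m. \<bar>x j - x' j\<bar>)"
proof -
  have d: "dist01 (\<Phi> (interp m x)) (\<Phi> (interp m x')) \<le> (\<Sum>j\<le>m. \<bar>x j - x' j\<bar>)" for x x'
    by (rule dist01_leI) (use op_interp_lipschitz in \<open>auto intro: min.coboundedI2\<close>)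
  have "nodal k m x \<le> nodal k m x' + k * (\<Sum>j\<le>m. \<bar>x j - x' j\<bar>)" for x x'
    using lower_envelope_lipschitz[OF G01 assms, of "\<Phi> (interp m x)" "\<Phi> (interp m x')"]
      mult_left_mono[OF d[of x x'] assms] by linarith
  from this[of x x'] this[of x' x] show ?thesis by (simp add: abs_le_iff abs_minus_commute)
qed

lemma nodal_bounded: "k \<ge> 0 \<Longrightarrow> \<bar>nodal k m x\<bar> \<le> 1 + k"
  using lower_envelope_nonneg[OF G01, of k "\<Phi> (interp m x)"] lower_envelope_upper[OF G01, of k "\<Phi> (interp m x)"]
  by simp

lemma nodal_borel[measurable]: "k \<ge> 0 \<Longrightarrow> nodal k m \<in> borel_measurable borel"
  by (rule borel_measurable_continuous_onI[OF continuous_on_finitely_lipschitz[OF nodal_lipschitz]])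

lemma limit_path: "\<omega> \<in> space N \<Longrightarrow> path01 limit \<omega> \<in> D01 \<and> continuous_on {0..1} (path01 limit \<omega>)"
  using continuous_path_D01[OF limit_continuous] continuous_on_eq[OF limit_continuous, of _ "path01 limit \<omega>"]
  by (simp add: path01_def)

lemma B_nodes_measurable[measurable]: "(\<lambda>\<omega> j. B (real j / real m) \<omega>) \<in> borel_measurable N"
  by (rule measurable_coordinatewise_then_product) (auto intro: B_measurable)

lemma envelope_limit:
  assumes k: "k \<ge> 0" and \<omega>: "\<omega> \<in> space N"
  shows "(\<lambda>m. nodal k m (\<lambda>j. B (real j / real m) \<omega>)) \<longlonglongrightarrow> lower_envelope G k (path01 limit \<omega>)"
proof -
  let ?z = "\<lambda>m. \<Phi> (interp m (\<lambda>j. B (real j / real m) \<omega>))"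
  have env: "lower_envelope G k (path01 limit \<omega>) = lower_envelope G k (\<lambda>t. limit t \<omega>)"
    unfolding path01_def by (rule lower_envelope_restrict[OF G01])
  have "(\<lambda>m. nodal k m (\<lambda>j. B (real j / real m) \<omega>) - lower_envelope G k (\<lambda>t. limit t \<omega>)) \<longlonglongrightarrow> 0"
  proof (rule Lim_null_comparison)
    show "\<forall>\<^sub>F m in sequentially. norm (nodal k m (\<lambda>j. B (real j / real m) \<omega>) - lower_envelope G k (\<lambda>t. limit t \<omega>))
      \<le> k * dist01 (?z m) (\<lambda>t. limit t \<omega>)"
    proof (intro always_eventually allI)
      fix m
      show "norm (nodal k m (\<lambda>j. B (real j / real m) \<omega>) - lower_envelope G k (\<lambda>t. limit t \<omega>))
        \<le> k * dist01 (?z m) (\<lambda>t. limit t \<omega>)"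
        using lower_envelope_lipschitz[OF G01 k, of "?z m" "\<lambda>t. limit t \<omega>"]
          lower_envelope_lipschitz[OF G01 k, of "\<lambda>t. limit t \<omega>" "?z m"]
        unfolding dist01_commute[of "\<lambda>t. limit t \<omega>"] real_norm_def abs_le_iff by linarith
    qed
    have "(\<lambda>m. dist01 (?z m) (\<lambda>t. limit t \<omega>)) \<longlonglongrightarrow> 0"
    proof (rule LIMSEQ_I)
      fix e :: real assume e: "e > 0"
      then have "\<forall>\<^sub>F m in sequentially. \<forall>t\<in>{0..1}. dist (?z m t) (\<Phi> (\<lambda>u. B u \<omega>) t) < e / 2"
        using op_interp_uniform_limit[OF B_continuous[OF \<omega>]] unfolding uniform_limit_iff by (meson half_gt_zero)
      then obtain m0 where m0: "\<And>m t. m \<ge> m0 \<Longrightarrow> t \<in> {0..1} \<Longrightarrow> \<bar>?z m t - limit t \<omega>\<bar> < e / 2"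
        unfolding eventually_sequentially limit_def dist_real_def by blast
      have "norm (dist01 (?z m) (\<lambda>t. limit t \<omega>) - 0) < e" if "m \<ge> m0" for m
      proof -
        have "dist01 (?z m) (\<lambda>t. limit t \<omega>) \<le> e / 2"
        proof (rule dist01_leI)
          fix t :: real assume "t \<in> {0..1}"
          from m0[OF that this] show "min 1 \<bar>?z m t - limit t \<omega>\<bar> \<le> e / 2" by linarith
        qed
        then show ?thesis using e dist01_nonneg[of "?z m" "\<lambda>t. limit t \<omega>"] by simp
      qed
      then show "\<exists>no. \<forall>m\<ge>no. norm (dist01 (?z m) (\<lambda>t. limit t \<omega>) - 0) < e" by blast
    qed
    from tendsto_mult_right_zero[OF this, of k]
    show "(\<lambda>m. k * dist01 (?z m) (\<lambda>t. limit t \<omega>)) \<longlonglongrightarrow> 0" .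
  qed
  then show ?thesis unfolding env by (simp add: LIM_zero_iff)
qed

lemma envelope_expectation:
  assumes e: "e > 0"
  shows "\<exists>k\<ge>1. \<forall>\<^sub>F m in sequentially. N.expectation (\<lambda>\<omega>. nodal k m (\<lambda>j. B (real j / real m) \<omega>))
    \<ge> N.expectation (\<lambda>\<omega>. G (path01 limit \<omega>)) - e"
proof -
  have [measurable]: "path01 limit \<in> measurable N skorokhod_borel" by (rule limit_path_measurable)
  have env_meas: "(\<lambda>\<omega>. lower_envelope G k (path01 limit \<omega>)) \<in> borel_measurable N" if k: "k \<ge> 0" for k
  proof (rule borel_measurable_LIMSEQ_real[OF envelope_limit[OF k]])
    show "(\<lambda>\<omega>. nodal k m (\<lambda>j. B (real j / real m) \<omega>)) \<in> borel_measurable N" for m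
      using measurable_compose[OF B_nodes_measurable nodal_borel[OF k]] .
  qed
  have "(\<lambda>k. N.expectation (\<lambda>\<omega>. lower_envelope G (real k) (path01 limit \<omega>))) \<longlonglongrightarrow> N.expectation (\<lambda>\<omega>. G (path01 limit \<omega>))"
  proof (rule integral_dominated_convergence[where w = "\<lambda>_. 1"])
    show "AE \<omega> in N. (\<lambda>k. lower_envelope G (real k) (path01 limit \<omega>)) \<longlonglongrightarrow> G (path01 limit \<omega>)"
      using limit_path by (intro AE_I2 lower_envelope_tendsto[OF G01 G_cont]) auto
    show "AE \<omega> in N. norm (lower_envelope G (real k) (path01 limit \<omega>)) \<le> 1" for k
    proof (intro AE_I2)
      fix \<omega> assume "\<omega> \<in> space N"
      then have "lower_envelope G (real k) (path01 limit \<omega>) \<le> G (path01 limit \<omega>)"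
        using limit_path by (intro lower_envelope_le[OF G01]) auto
      then show "norm (lower_envelope G (real k) (path01 limit \<omega>)) \<le> 1"
        using G01[rule_format, of "path01 limit \<omega>"] lower_envelope_nonneg[OF G01, of "real k" "path01 limit \<omega>"] by simp
    qed
  qed (use env_meas in auto)
  then have "\<forall>\<^sub>F k in sequentially. N.expectation (\<lambda>\<omega>. lower_envelope G (real k) (path01 limit \<omega>)) > N.expectation (\<lambda>\<omega>. G (path01 limit \<omega>)) - e / 2"
    using e by (intro order_tendstoD) auto
  then obtain k0 where k0: "\<And>k. k \<ge> k0 \<Longrightarrow> N.expectation (\<lambda>\<omega>. lower_envelope G (real k) (path01 limit \<omega>)) > N.expectation (\<lambda>\<omega>. G (path01 limit \<omega>)) - e / 2"
    by (auto simp: eventually_sequentially)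
  define k where "k = real (max 1 k0)"
  have k: "k \<ge> 1" "k \<ge> 0" by (auto simp: k_def)
  have "(\<lambda>m. N.expectation (\<lambda>\<omega>. nodal k m (\<lambda>j. B (real j / real m) \<omega>))) \<longlonglongrightarrow> N.expectation (\<lambda>\<omega>. lower_envelope G k (path01 limit \<omega>))"
  proof (rule integral_dominated_convergence[where w = "\<lambda>_. 1 + k"])
    show "(\<lambda>\<omega>. nodal k m (\<lambda>j. B (real j / real m) \<omega>)) \<in> borel_measurable N" for m
      using measurable_compose[OF B_nodes_measurable nodal_borel[OF k(2)]] .
    show "AE \<omega> in N. norm (nodal k m (\<lambda>j. B (real j / real m) \<omega>)) \<le> 1 + k" for m
      using nodal_bounded[OF k(2)] by simp
  qed (use env_meas[OF k(2)] envelope_limit[OF k(2)] in auto)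
  moreover have "N.expectation (\<lambda>\<omega>. lower_envelope G k (path01 limit \<omega>)) > N.expectation (\<lambda>\<omega>. G (path01 limit \<omega>)) - e"
    using k0[of "max 1 k0"] e by (simp add: k_def)
  ultimately have "\<forall>\<^sub>F m in sequentially. N.expectation (\<lambda>\<omega>. nodal k m (\<lambda>j. B (real j / real m) \<omega>)) > N.expectation (\<lambda>\<omega>. G (path01 limit \<omega>)) - e"
    by (rule order_tendstoD)
  then have "\<forall>\<^sub>F m in sequentially. N.expectation (\<lambda>\<omega>. nodal k m (\<lambda>j. B (real j / real m) \<omega>)) \<ge> N.expectation (\<lambda>\<omega>. G (path01 limit \<omega>)) - e"
    by eventually_elim simp
  then show ?thesis using k(1) by blast
qed

lemma fdd_limit:
  assumes m: "m \<ge> 1" and k: "k \<ge> 0"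
  shows "(\<lambda>n. P.expectation (\<lambda>\<omega>. nodal k m (\<lambda>j. node m n j \<omega>))) \<longlonglongrightarrow> N.expectation (\<lambda>\<omega>. nodal k m (\<lambda>j. B (real j / real m) \<omega>))"
proof -
  define C where "C = 2 + (\<Sum>j\<le>m. N.expectation (\<lambda>\<omega>. \<bar>B (real j / real m) \<omega>\<bar>))"
  have C2: "2 \<le> C" by (simp add: C_def sum_nonneg)
  have B0: "real j / real m \<ge> 0" for j by simp
  show ?thesis
  proof (rule fdd_convergence[OF P.prob_space_axioms N.prob_space_axioms node_measurable B_measurable[OF B0] _
      node_integrable B_integrable[OF B0] _ _ nodal_lipschitz[OF k] nodal_bounded[OF k], where C = C])
    show "(\<lambda>n. char (distr P borel (\<lambda>\<omega>. \<Sum>j\<le>m. c j * node m n j \<omega>)) 1)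
        \<longlonglongrightarrow> char (distr N borel (\<lambda>\<omega>. \<Sum>j\<le>m. c j * B (real j / real m) \<omega>)) 1" for c
      unfolding node_def by (rule char_limit[OF m])
    fix j assume j: "j \<le> m"
    show "\<forall>\<^sub>F n in sequentially. P.expectation (\<lambda>\<omega>. \<bar>node m n j \<omega>\<bar>) \<le> C"
      using node_bounded[OF m] by eventually_elim (use j C2 in force)
    have "N.expectation (\<lambda>\<omega>. \<bar>B (real j / real m) \<omega>\<bar>) \<le> (\<Sum>j\<le>m. N.expectation (\<lambda>\<omega>. \<bar>B (real j / real m) \<omega>\<bar>))"
      using j by (intro member_le_sum) auto
    then show "N.expectation (\<lambda>\<omega>. \<bar>B (real j / real m) \<omega>\<bar>) \<le> C" by (simp add: C_def)
  qed
qed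

lemma lower_bound:
  assumes e: "e > 0"
  shows "\<forall>\<^sub>F n in sequentially. P.expectation (\<lambda>\<omega>. G (path01 (approx n) \<omega>)) \<ge> N.expectation (\<lambda>\<omega>. G (path01 limit \<omega>)) - e"
proof -
  have e5: "e / 5 > 0" using e by simp
  obtain k where k: "k \<ge> 1" and kev: "\<forall>\<^sub>F m in sequentially. N.expectation (\<lambda>\<omega>. nodal k m (\<lambda>j. B (real j / real m) \<omega>))
    \<ge> N.expectation (\<lambda>\<omega>. G (path01 limit \<omega>)) - e / 5"
    using envelope_expectation[OF e5] by blast
  have k0: "k \<ge> 0" using k by simp
  define \<eta> where "\<eta> = e / 5 / k"
  have \<eta>: "\<eta> > 0" "k * \<eta> = e / 5" using e k by (auto simp: \<eta>_def)
  obtain m0 where m0: "\<And>m. m \<ge> m0 \<Longrightarrow> \<forall>\<^sub>F n in sequentially.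
      P.prob {\<omega>\<in>space P. \<exists>i\<le>n. \<exists>i'\<le>n. \<bar>real i - real i'\<bar> \<le> real n / real m + 1 \<and> \<bar>S i \<omega> - S i' \<omega>\<bar> \<ge> \<eta> * s n} \<le> \<eta>"
    using modulus[OF \<eta>(1,1)] by blast
  have "\<forall>\<^sub>F m in sequentially. N.expectation (\<lambda>\<omega>. nodal k m (\<lambda>j. B (real j / real m) \<omega>))
    \<ge> N.expectation (\<lambda>\<omega>. G (path01 limit \<omega>)) - e / 5 \<and> m \<ge> max 1 m0"
    using kev eventually_ge_at_top[of "max 1 m0"] by eventually_elim simp
  then obtain m where m: "m \<ge> 1" "m \<ge> m0" and mlow: "N.expectation (\<lambda>\<omega>. nodal k m (\<lambda>j. B (real j / real m) \<omega>))
    \<ge> N.expectation (\<lambda>\<omega>. G (path01 limit \<omega>)) - e / 5"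
    by (auto simp: eventually_sequentially)
  define \<epsilon> where "\<epsilon> = \<eta> / (2 * real (Suc m))"
  have \<epsilon>: "\<epsilon> > 0" using \<eta> by (simp add: \<epsilon>_def)
  have fd: "\<forall>\<^sub>F n in sequentially. P.expectation (\<lambda>\<omega>. nodal k m (\<lambda>j. node m n j \<omega>)) > N.expectation (\<lambda>\<omega>. nodal k m (\<lambda>j. B (real j / real m) \<omega>)) - e / 5"
    using e by (intro order_tendstoD(1)[OF fdd_limit[OF m(1) k0]]) simp
  have ops: "\<forall>\<^sub>F n in sequentially. \<forall>j\<in>{1..m}. \<forall>t\<in>{0..1}. \<bar>discrete_average w n (hat m j) t - \<Phi> (hat m j) t\<bar> \<le> \<epsilon>"
    by (intro eventually_ball_finite ballI op_limit[OF hat_lipschitz_from_0 \<epsilon>]) auto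
  show ?thesis using fd ops m0[OF m(2)] node_bounded[OF m(1)] eventually_ge_at_top[of 1]
  proof eventually_elim
    case (elim n)
    define A where "A = {\<omega>\<in>space P. \<exists>i\<le>n. \<exists>i'\<le>n. \<bar>real i - real i'\<bar> \<le> real n / real m + 1 \<and> \<bar>S i \<omega> - S i' \<omega>\<bar> \<ge> \<eta> * s n}"
    have [measurable]: "A \<in> sets P" unfolding A_def by measurable
    have [measurable]: "path01 (approx n) \<in> measurable P skorokhod_borel" by (rule approx_path_measurable)
    have [measurable]: "(\<lambda>\<omega> j. node m n j \<omega>) \<in> borel_measurable P"
      by (rule measurable_coordinatewise_then_product) simp
    have [measurable]: "(\<lambda>\<omega>. nodal k m (\<lambda>j. node m n j \<omega>)) \<in> borel_measurable P"
      using measurable_compose[OF _ nodal_borel[OF k0]] by measurable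
    let ?D = "\<lambda>\<omega>. indicator A \<omega> + (\<eta> + \<epsilon> * (\<Sum>j\<le>m. \<bar>node m n j \<omega>\<bar>))"
    have pt: "nodal k m (\<lambda>j. node m n j \<omega>) - k * ?D \<omega> \<le> G (path01 (approx n) \<omega>)" if \<omega>: "\<omega> \<in> space P" for \<omega>
    proof -
      have R0: "\<eta> + \<epsilon> * (\<Sum>j\<le>m. \<bar>node m n j \<omega>\<bar>) \<ge> 0" using \<eta> \<epsilon> by (simp add: sum_nonneg)
      have "dist01 (\<Phi> (interp m (\<lambda>j. node m n j \<omega>))) (path01 (approx n) \<omega>) \<le> ?D \<omega>"
      proof (cases "\<omega> \<in> A")
        case True
        then show ?thesis using dist01_le_1[of "\<Phi> (interp m (\<lambda>j. node m n j \<omega>))" "path01 (approx n) \<omega>"] R0 by simp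
      next
        case False
        have "\<bar>approx n t \<omega> - \<Phi> (interp m (\<lambda>j. node m n j \<omega>)) t\<bar> \<le> \<eta> + \<epsilon> * (\<Sum>j\<le>m. \<bar>node m n j \<omega>\<bar>)"
          if t: "t \<in> {0..1}" for t
        proof (rule approx_close[OF elim(5) m(1) t \<eta>(1)])
          show "\<bar>S i \<omega> - S i' \<omega>\<bar> < \<eta> * s n"
            if "i \<le> n" "i' \<le> n" "\<bar>real i - real i'\<bar> \<le> real n / real m + 1" for i i'
          proof (rule ccontr)
            assume "\<not> \<bar>S i \<omega> - S i' \<omega>\<bar> < \<eta> * s n"
            then have "\<bar>S i \<omega> - S i' \<omega>\<bar> \<ge> \<eta> * s n" by simp
            then have "\<omega> \<in> A" unfolding A_def using \<omega> that by blast
            then show False using False by simp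
          qed
        qed (use elim(2) t in auto)
        then show ?thesis using False
          by (intro dist01_leI) (auto simp: path01_def abs_minus_commute intro: min.coboundedI2)
      qed
      then have "k * dist01 (\<Phi> (interp m (\<lambda>j. node m n j \<omega>))) (path01 (approx n) \<omega>) \<le> k * ?D \<omega>"
        using k0 by (intro mult_left_mono) auto
      moreover have "path01 (approx n) \<omega> \<in> D01"
        using measurable_space[OF approx_path_measurable \<omega>] by (simp add: space_skorokhod_borel)
      ultimately show ?thesis
        using lower_envelope_lower[OF G01 k0, of "path01 (approx n) \<omega>" "\<Phi> (interp m (\<lambda>j. node m n j \<omega>))"] by linarith
    qed
    have if': "integrable P (\<lambda>\<omega>. nodal k m (\<lambda>j. node m n j \<omega>))"
      by (rule P.integrable_const_bound[where B = "1 + k"]) (use nodal_bounded[OF k0] in auto)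
    have iA: "integrable P (indicat_real A)" by (rule P.integrable_const_bound[where B = 1]) auto
    then have iD: "integrable P ?D"
      using node_integrable by (intro Bochner_Integration.integrable_add) auto
    have iG: "integrable P (\<lambda>\<omega>. G (path01 (approx n) \<omega>))"
      by (rule P.integrable_const_bound[where B = 1]) (use G01 in \<open>auto simp: abs_le_iff intro: order_trans[OF _ zero_le_one]\<close>)
    have "P.expectation (\<lambda>\<omega>. nodal k m (\<lambda>j. node m n j \<omega>)) - k * P.expectation ?D
      = P.expectation (\<lambda>\<omega>. nodal k m (\<lambda>j. node m n j \<omega>) - k * ?D \<omega>)"
      using if' iD by (subst Bochner_Integration.integral_diff) auto
    also have "\<dots> \<le> P.expectation (\<lambda>\<omega>. G (path01 (approx n) \<omega>))"
      using if' iD iG pt by (intro integral_mono) auto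
    finally have main: "P.expectation (\<lambda>\<omega>. nodal k m (\<lambda>j. node m n j \<omega>)) - k * P.expectation ?D
      \<le> P.expectation (\<lambda>\<omega>. G (path01 (approx n) \<omega>))" .
    have "P.expectation ?D = P.prob A + (\<eta> + \<epsilon> * (\<Sum>j\<le>m. P.expectation (\<lambda>\<omega>. \<bar>node m n j \<omega>\<bar>)))"
    proof -
      have "P.expectation (indicat_real A) = P.prob A" by simp
      then show ?thesis using node_integrable iA by (simp add: P.prob_space)
    qed
    also have "\<dots> \<le> \<eta> + (\<eta> + \<epsilon> * (\<Sum>j\<le>m. 2))"
      using elim(3,4) \<epsilon> unfolding A_def by (intro add_mono mult_left_mono sum_mono) auto
    also have "\<dots> = 3 * \<eta>" by (simp add: \<epsilon>_def field_simps)
    finally have "k * P.expectation ?D \<le> k * (3 * \<eta>)" using k0 by (intro mult_left_mono) auto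
    also have "\<dots> = 3 * (e / 5)" by (simp only: \<eta>(2)[symmetric] mult.left_commute)
    finally show ?case using main elim(1) mlow by linarith
  qed
qed

end

end

lemma cumulative_sum_partial_sums:
  "cumulative_sum M X k \<omega> = (\<Sum>i<k. weight_diff M i * partial_sum X (k - i) \<omega>)"
proof (induction k)
  case 0
  then show ?case by (simp add: cumulative_sum_def weighted_sum_def)
next
  case (Suc k)
  have step: "partial_sum X (Suc k - i) \<omega> = partial_sum X (k - i) \<omega> + X (int (Suc k) - int i) \<omega>" if "i < Suc k" for i
  proof -
    have "partial_sum X (Suc (k - i)) \<omega> = partial_sum X (k - i) \<omega> + X (int (Suc (k - i))) \<omega>"
      by (simp add: partial_sum_def)
    moreover have "Suc (k - i) = Suc k - i" "int (Suc (k - i)) = int (Suc k) - int i" using that by auto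
    ultimately show ?thesis by simp
  qed
  have "(\<Sum>i<Suc k. weight_diff M i * partial_sum X (Suc k - i) \<omega>)
    = (\<Sum>i<Suc k. weight_diff M i * partial_sum X (k - i) \<omega>) + (\<Sum>i<Suc k. X (int (Suc k) - int i) \<omega> * weight_diff M i)"
    unfolding sum.distrib[symmetric] by (intro sum.cong) (auto simp: step distrib_left mult.commute)
  also have "(\<Sum>i<Suc k. weight_diff M i * partial_sum X (k - i) \<omega>) = (\<Sum>i<k. weight_diff M i * partial_sum X (k - i) \<omega>)"
    by (simp add: partial_sum_def)
  also have "\<dots> = cumulative_sum M X k \<omega>" using Suc by simp
  also have "cumulative_sum M X k \<omega> + (\<Sum>i<Suc k. X (int (Suc k) - int i) \<omega> * weight_diff M i) = cumulative_sum M X (Suc k) \<omega>"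
    by (simp add: cumulative_sum_def weighted_sum_def)
  finally show ?case by simp
qed

lemma (in process_convergence) expectation_tendsto:
  assumes G01: "\<forall>x. 0 \<le> G x \<and> G x \<le> 1" and G: "G \<in> borel_measurable skorokhod_borel"
    and cont: "unif_continuous_at_C01 G"
  shows "(\<lambda>n. P.expectation (\<lambda>\<omega>. G (path01 (approx n) \<omega>))) \<longlonglongrightarrow> N.expectation (\<lambda>\<omega>. G (path01 limit \<omega>))"
proof (rule tendstoI)
  fix e :: real assume e: "e > 0"
  then have e2: "e / 2 > 0" by simp
  have G01': "\<forall>x. 0 \<le> 1 - G x \<and> 1 - G x \<le> 1" using G01 by auto
  have G': "(\<lambda>x. 1 - G x) \<in> borel_measurable skorokhod_borel" using G by measurable
  have cont': "unif_continuous_at_C01 (\<lambda>x. 1 - G x)"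
    using cont unfolding unif_continuous_at_C01_def by (simp add: abs_minus_commute)
  note [measurable] = G approx_path_measurable limit_path_measurable
  have iP: "integrable P (\<lambda>\<omega>. G (path01 (approx n) \<omega>))" for n
    by (rule P.integrable_const_bound[where B = 1]) (use G01 in auto)
  have iN: "integrable N (\<lambda>\<omega>. G (path01 limit \<omega>))"
    by (rule N.integrable_const_bound[where B = 1]) (use G01 in auto)
  show "\<forall>\<^sub>F n in sequentially. dist (P.expectation (\<lambda>\<omega>. G (path01 (approx n) \<omega>))) (N.expectation (\<lambda>\<omega>. G (path01 limit \<omega>))) < e"
    using lower_bound[OF G01 G cont e2] lower_bound[OF G01' G' cont' e2]
  proof eventually_elim
    case (elim n)
    then show ?case using iP[of n] iN e by (simp add: P.prob_space N.prob_space dist_real_def abs_less_iff)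
  qed
qed

lemma (in process_convergence) C_convergence: "C_converges P approx N limit"
  unfolding C_converges_def
proof (intro conjI allI ballI impI approx_path_measurable limit_path_measurable limit_continuous)
  fix F assume F[measurable]: "F \<in> borel_measurable skorokhod_borel" and cont: "unif_continuous_at_C01 F"
  note [measurable] = approx_path_measurable limit_path_measurable
  show "weak_conv_m (\<lambda>n. distr P borel (\<lambda>\<omega>. F (path01 (approx n) \<omega>))) (distr N borel (\<lambda>\<omega>. F (path01 limit \<omega>)))"
  proof (rule integral_cts_step_conv_imp_weak_conv)
    show "real_distribution (distr P borel (\<lambda>\<omega>. F (path01 (approx n) \<omega>)))" for n
      by (rule P.real_distribution_distr) measurable
    show "real_distribution (distr N borel (\<lambda>\<omega>. F (path01 limit \<omega>)))"
      by (rule N.real_distribution_distr) measurable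
    fix x y :: real assume xy: "x < y"
    define G where "G p = cts_step x y (F p)" for p
    have uc: "isUCont (cts_step x y)" by (rule cts_step_uniformly_continuous[OF xy])
    have [measurable]: "cts_step x y \<in> borel_measurable borel"
      using isUCont_isCont[OF uc] by (intro borel_measurable_continuous_onI) (simp add: continuous_at_imp_continuous_on)
    have "\<forall>p. 0 \<le> G p \<and> G p \<le> 1" using xy by (auto simp: G_def cts_step_def)
    moreover have "G \<in> borel_measurable skorokhod_borel" unfolding G_def[abs_def] by measurable
    moreover have "unif_continuous_at_C01 G"
      unfolding unif_continuous_at_C01_def
    proof (intro ballI impI allI)
      fix p and e :: real assume p: "p \<in> D01" "continuous_on {0..1} p" and e: "e > 0"
      obtain d where d: "d > 0" "\<And>u v. dist u v < d \<Longrightarrow> dist (cts_step x y u) (cts_step x y v) < e"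
        using uc e unfolding isUCont_def by blast
      obtain d' where "d' > 0" "\<And>q. q \<in> D01 \<Longrightarrow> \<forall>t\<in>{0..1}. \<bar>q t - p t\<bar> < d' \<Longrightarrow> \<bar>F q - F p\<bar> < d"
        using cont p d(1) unfolding unif_continuous_at_C01_def by blast
      then show "\<exists>d>0. \<forall>q\<in>D01. (\<forall>t\<in>{0..1}. \<bar>q t - p t\<bar> < d) \<longrightarrow> \<bar>G q - G p\<bar> < e"
        using d(2) unfolding G_def dist_real_def by (intro exI[of _ d']) blast
    qed
    ultimately have "(\<lambda>n. P.expectation (\<lambda>\<omega>. G (path01 (approx n) \<omega>))) \<longlonglongrightarrow> N.expectation (\<lambda>\<omega>. G (path01 limit \<omega>))"
      by (rule expectation_tendsto)
    then show "(\<lambda>n. integral\<^sup>L (distr P borel (\<lambda>\<omega>. F (path01 (approx n) \<omega>))) (cts_step x y))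
      \<longlonglongrightarrow> integral\<^sup>L (distr N borel (\<lambda>\<omega>. F (path01 limit \<omega>))) (cts_step x y)"
      by (simp add: integral_distr G_def)
  qed
qed

lemma (in linear_noise) tail_bound:
  assumes \<alpha>: "\<alpha> \<ge> 2" and mom: "integrable P (\<lambda>\<omega>. \<bar>\<xi> 1 \<omega>\<bar> powr \<alpha>)"
  shows "\<exists>K\<ge>0. \<forall>p q x. p < q \<longrightarrow> x > 0 \<longrightarrow>
    prob {\<omega>\<in>space P. \<bar>S q \<omega> - S p \<omega>\<bar> \<ge> x} \<le> K * sd (q - p) powr \<alpha> / x powr \<alpha>"
proof -
  have "integrable (distr P borel (\<xi> 1)) (\<lambda>x. \<bar>x\<bar> powr \<alpha>)" using mom by (simp add: integrable_distr_eq)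
  then have mom': "integrable P (\<lambda>\<omega>. \<bar>\<xi> k \<omega>\<bar> powr \<alpha>)" for k
    unfolding same[of 1 k] by (simp add: integrable_distr_eq)
  have eq: "expectation (\<lambda>\<omega>. \<bar>\<xi> k \<omega>\<bar> powr \<alpha>) = expectation (\<lambda>\<omega>. \<bar>\<xi> 1 \<omega>\<bar> powr \<alpha>)" for k
  proof -
    have "expectation (\<lambda>\<omega>. \<bar>\<xi> k \<omega>\<bar> powr \<alpha>) = (\<integral>x. \<bar>x\<bar> powr \<alpha> \<partial>distr P borel (\<xi> k))"
      by (simp add: integral_distr)
    also have "\<dots> = expectation (\<lambda>\<omega>. \<bar>\<xi> 1 \<omega>\<bar> powr \<alpha>)" unfolding same[of k 1] by (simp add: integral_distr)
    finally show ?thesis .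
  qed
  obtain K where K: "K \<ge> 0" "\<And>F b. finite F \<Longrightarrow> integrable P (\<lambda>\<omega>. \<bar>\<Sum>k\<in>F. b k * \<xi> k \<omega>\<bar> powr \<alpha>) \<and>
    expectation (\<lambda>\<omega>. \<bar>\<Sum>k\<in>F. b k * \<xi> k \<omega>\<bar> powr \<alpha>) \<le> K * (\<Sum>k\<in>F. (b k)\<^sup>2) powr (\<alpha> / 2)"
    using weighted_sum_moment_bound[OF indep \<alpha> int1 int2 mom' mean second eq_refl[OF eq]] by blast
  have "prob {\<omega>\<in>space P. \<bar>S q \<omega> - S p \<omega>\<bar> \<ge> x} \<le> K * 2 powr \<alpha> * sd (q - p) powr \<alpha> / x powr \<alpha>"
    if "p < q" "x > 0" for p q x
  proof -
    have "prob {\<omega>\<in>space P. \<bar>S q \<omega> - S p \<omega>\<bar> \<ge> x}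
      \<le> K * 2 powr \<alpha> * (expectation (\<lambda>\<omega>. (S q \<omega> - S p \<omega>)\<^sup>2)) powr (\<alpha> / 2) / x powr \<alpha>"
      using K by (intro lin_tail_bound[OF \<alpha> mom' K(1) _ lin_diff[OF lin_S lin_S] that(2)]) (simp add: fsum_def)
    also have "expectation (\<lambda>\<omega>. (S q \<omega> - S p \<omega>)\<^sup>2) = (sd (q - p))\<^sup>2"
      using that by (intro increment_second_moment) simp
    also have "(sd (q - p))\<^sup>2 powr (\<alpha> / 2) = sd (q - p) powr \<alpha>"
    proof -
      have e: "(sd (q - p))\<^sup>2 = sd (q - p) powr 2"
        using sd_nonneg[of "q - p"] by (cases "sd (q - p) = 0") (auto simp: powr_numeral)
      show ?thesis unfolding e powr_powr by simp
    qed
    finally show ?thesis .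
  qed
  then show ?thesis using K(1) by (intro exI[of _ "K * 2 powr \<alpha>"]) auto
qed

lemma (in linear_noise) weighted_convergence:
  assumes H: "0 < H" and h_pos: "\<And>x. x > 0 \<Longrightarrow> h x > 0" and h: "slowly_varying h"
    and var: "\<And>n::nat. n \<ge> 1 \<Longrightarrow> variance (partial_sum X n) = (h (real n))\<^sup>2 * real n powr (2 * H)"
    and \<alpha>: "\<alpha> \<ge> 2" "\<alpha> * H > 1" and mom: "integrable P (\<lambda>\<omega>. \<bar>\<xi> 1 \<omega>\<bar> powr \<alpha>)"
    and B: "fractional_brownian_motion N H B"
    and op: "limit_operator (\<lambda>n i. weight_diff M i / M (real n)) \<Phi>"
  shows "C_converges P (normalized_process h H M X) N (\<lambda>t \<omega>. \<Phi> (\<lambda>u. B u \<omega>) t)"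
proof -
  have sd_eq: "sd n = h (real n) * real n powr H" if n: "n \<ge> 1" for n
  proof -
    have "(sd n)\<^sup>2 = variance (partial_sum X n)"
      using lin_mean[OF lin_S[of n]] by (simp add: sd_square S_def)
    also have "\<dots> = (h (real n) * real n powr H)\<^sup>2"
      using var[OF n] by (simp add: power_mult_distrib power2_eq_square powr_add[symmetric])
    finally show ?thesis using sd_nonneg[of n] h_pos[of "real n"] n by (simp add: power2_eq_iff_nonneg)
  qed
  have reg: "regular_sequence sd H"
  proof
    show "sd 0 = 0" by (simp add: sd_def S_0)
    show "0 < sd n" if "1 \<le> n" for n using sd_eq[OF that] h_pos[of "real n"] that by simp
    show "(\<lambda>m. sd (p * m) / sd m) \<longlonglongrightarrow> real p powr H" if p: "p \<ge> 1" for p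
    proof -
      have "((\<lambda>x. h (real p * x) / h x) \<longlongrightarrow> 1) at_top" using h p unfolding slowly_varying_def by simp
      then have "(\<lambda>m. h (real p * real m) / h (real m)) \<longlonglongrightarrow> 1"
        by (rule filterlim_compose[OF _ filterlim_real_sequentially])
      from tendsto_mult_right[OF this, of "real p powr H"]
      have "(\<lambda>m. h (real p * real m) / h (real m) * real p powr H) \<longlonglongrightarrow> real p powr H" by simp
      moreover have "\<forall>\<^sub>F m in sequentially. h (real p * real m) / h (real m) * real p powr H = sd (p * m) / sd m"
        using eventually_ge_at_top[of 1]
      proof eventually_elim
        case (elim m)
        then have "p * m \<ge> 1" using p by simp
        then show ?case using elim by (simp add: sd_eq powr_mult)
      qed
      ultimately show ?thesis by (rule Lim_transform_eventually)
    qed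
  qed (use H sd_diff in auto)
  obtain K where K: "K \<ge> 0" "\<And>p q x. p < q \<Longrightarrow> x > 0 \<Longrightarrow>
    prob {\<omega>\<in>space P. \<bar>S q \<omega> - S p \<omega>\<bar> \<ge> x} \<le> K * sd (q - p) powr \<alpha> / x powr \<alpha>"
    using tail_bound[OF \<alpha>(1) mom] by blast
  interpret process_convergence "\<lambda>n i. weight_diff M i / M (real n)" \<Phi> P N S sd B H
  proof (intro process_convergence.intro op process_convergence_axioms.intro prob_space_axioms fbm_prob[OF B] reg
      S_measurable S_0 lin_square_integrable(1)[OF lin_S] sd_square[symmetric] fbm_measurable[OF B] fbm_integrable[OF B])
    show "\<exists>m0. \<forall>m\<ge>m0. \<forall>\<^sub>F n in sequentially.
      prob {\<omega>\<in>space P. \<exists>i\<le>n. \<exists>i'\<le>n. \<bar>real i - real i'\<bar> \<le> real n / real m + 1 \<and> \<bar>S i \<omega> - S i' \<omega>\<bar> \<ge> \<eta> * sd n} \<le> e"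
      if "\<eta> > 0" "e > 0" for \<eta> e
      using \<alpha> by (intro modulus_of_continuity[OF reg S_measurable K _ \<alpha>(2) that]) auto
    show "continuous_on {0..1} (\<lambda>t. B t \<omega>)" if "\<omega> \<in> space N" for \<omega>
      by (rule continuous_on_subset[OF fbm_continuous[OF B that]]) auto
    show "(\<lambda>n. char (distr P borel (\<lambda>\<omega>. \<Sum>j\<le>m. c j * (S (n * j div m) \<omega> / sd n))) 1)
      \<longlonglongrightarrow> char (distr N borel (\<lambda>\<omega>. \<Sum>j\<le>m. c j * B (real j / real m) \<omega>)) 1" if "m \<ge> 1" for m c
      using scaled_partial_sums_char[OF reg that, of c] fbm_char[OF B that, of c] by simp
  qed auto
  have "normalized_process h H M X n t \<omega> = approx n t \<omega>" if t: "t \<in> {0..1}" for n t \<omega>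
  proof (cases "n = 0")
    case False
    then have sd: "h (real n) * real n powr H = sd n" using sd_eq[of n] by simp
    show ?thesis
      unfolding normalized_process_def approx_def cumulative_sum_partial_sums sd S_def
      by (simp add: sum_divide_distrib mult.commute[of "sd n"])
  qed (simp add: normalized_process_def approx_def)
  then have path: "path01 (normalized_process h H M X n) = path01 (approx n)" for n
    by (auto simp: path01_def fun_eq_iff)
  have lim: "(\<lambda>t \<omega>. \<Phi> (\<lambda>u. B u \<omega>) t) = limit" by (simp add: limit_def fun_eq_iff)
  show ?thesis using C_convergence unfolding C_converges_def path lim .
qed

theorem theorem1:
  fixes P :: "'a measure" and N :: "'b measure"
    and \<xi> X :: "int \<Rightarrow> 'a \<Rightarrow> real" and a :: "int \<Rightarrow> real"
    and h :: "real \<Rightarrow> real" and H \<alpha> :: real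
    and B :: "real \<Rightarrow> 'b \<Rightarrow> real"
  assumes "prob_space P"
    and "prob_space.indep_vars P (\<lambda>_. borel) \<xi> UNIV"
    and "\<And>j k. distr P borel (\<xi> j) = distr P borel (\<xi> k)"
    and "\<And>k. integrable P (\<xi> k)"
    and "\<And>k. integrable P (\<lambda>\<omega>. (\<xi> k \<omega>)\<^sup>2)"
    and "\<And>k. prob_space.expectation P (\<xi> k) = 0"
    and "\<And>k. prob_space.variance P (\<xi> k) = 1"
    and "(\<lambda>k. (a k)\<^sup>2) summable_on UNIV"
    and "linear_process P a \<xi> X"
    and "0 < H" and "H < 1"
    and "\<And>x. x > 0 \<Longrightarrow> h x > 0"
    and "slowly_varying h"
    and "\<And>n::nat. n \<ge> 1 \<Longrightarrow>
           prob_space.variance P (partial_sum X n) = (h (real n))\<^sup>2 * real n powr (2 * H)"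
    and "\<alpha> \<ge> 2" and "\<alpha> * H > 1"
    and "integrable P (\<lambda>\<omega>. \<bar>\<xi> 1 \<omega>\<bar> powr \<alpha>)"
    and "fractional_brownian_motion N H B"
  shows "(\<forall>\<nu> M. \<nu> > 0 \<and> M \<in> weight_class \<nu> \<longrightarrow>
            C_converges P (normalized_process h H M X) N (Z_process \<nu> B)) \<and>
         (\<forall>M. M \<in> weight_class 0 \<longrightarrow>
            C_converges P (normalized_process h H M X) N
              (\<lambda>t \<omega>. (1 - weight_ratio M) * B t \<omega>))"
proof -
  interpret prob_space P by fact
  have "expectation (\<lambda>\<omega>. (\<xi> k \<omega>)\<^sup>2) = 1" for k
    using assms(6,7)[of k] by simp
  then interpret linear_noise P \<xi> a X
    by unfold_locales (use assms in auto)
  have conv: "C_converges P (normalized_process h H M X) N (\<lambda>t \<omega>. \<Phi> (\<lambda>u. B u \<omega>) t)"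
    if "limit_operator (\<lambda>n i. weight_diff M i / M (real n)) \<Phi>" for M \<Phi>
    by (rule weighted_convergence[OF assms(10) _ assms(13) _ assms(15-18) that]) (use assms(12,14) in auto)
  have "C_converges P (normalized_process h H M X) N (Z_process \<nu> B)" if "\<nu> > 0" "M \<in> weight_class \<nu>" for \<nu> M
  proof -
    have "Z_process \<nu> B = (\<lambda>t \<omega>. fractional_average \<nu> (\<lambda>u. B u \<omega>) t)"
      by (simp add: Z_process_def fractional_average_def fun_eq_iff)
    then show ?thesis using conv[OF limit_operator_pos[OF that(2,1)]] by simp
  qed
  moreover have "C_converges P (normalized_process h H M X) N (\<lambda>t \<omega>. (1 - weight_ratio M) * B t \<omega>)"
    if "M \<in> weight_class 0" for M
    using conv[OF limit_operator_0[OF that]] .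
  ultimately show ?thesis by blast
qed

end
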